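(* Let $\beta_1$ be the bijective correspondence between $\mathbb{F}_1$ and $\mathbb{M}_1=\{\mu_\alpha:\alpha\in\mathbb{F}_1\}$ that pairs $\alpha$ with $\mu_\alpha$. The class of all fixed points of $\beta_1$ is $\{C_{\theta,\sigma^2}:\theta\in\mathbb{R},\ \sigma^2\in(0,+\infty]\}$. In other words, for $\alpha\in\mathbb{F}_1$, one has $\mu_\alpha=\alpha$ if and only if $\alpha=C_{\theta,\sigma^2}$ for some $\theta\in\mathbb{R}$ and $\sigma^2\in(0,+\infty]$.
   Context: $\mathbb{F}_1$ is the set of probability measures $\alpha$ on $(\mathbb{R},\mathscr{B}(\mathbb{R}))$ with $\int_{\mathbb{R}}\log(1+|x|)\,\alpha(dx)<+\infty$. A random probability measure $\tilde\varphi$ on $\mathbb{R}$ is a Dirichlet process with parameter $\alpha$ (law $\mathscr{D}_\alpha$) if, for every finite measurable partition $C_1,\ldots,C_{n+1}$ of $\mathbb{R}$, $(\tilde\varphi(C_1),\ldots,\tilde\varphi(C_n))$ has the Dirichlet distribution with parameter $(\alpha(C_1),\ldots,\alpha(C_{n+1}))$ (components with $\alpha(C_i)=0$ being a.s. $0$). For $\alpha\in\mathbb{F}_1$, $\int|x|\,\tilde\varphi(dx)<\infty$ a.s., and $\mu_\alpha$ is the probability distribution of $\tilde\varphi(I)=\int x\,\tilde\varphi(dx)$ under $\mathscr{D}_\alpha$. The map $\alpha\mapsto\mu_\alpha$ is injective on $\mathbb{F}_1$. For $\theta\in\mathbb{R}$ and $\sigma\in(0,+\infty)$, $C_{\theta,\sigma^2}$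 is the Cauchy distribution $C_{\theta,\sigma^2}(dx)=\frac{\sigma}{\pi(1+\sigma^2(x-\theta)^2)}\,dx$, and $C_{\theta,+\infty}=\delta_\theta$ is the unit point mass at $\theta$. *)

theory Defs
  imports "HOL-Probability.Probability"
begin

definition F1 :: "real measure set" where
  "F1 = {\<alpha>. prob_space \<alpha> \<and> sets \<alpha> = sets borel \<and> integrable \<alpha> (\<lambda>x. ln (1 + \<bar>x\<bar>))}"

definition gamma_law :: "real \<Rightarrow> real measure" where
  "gamma_law a =
     (if a = 0 then return borel 0
      else density lborel (\<lambda>x. ennreal (if x > 0 then x powr (a - 1) * exp (- x) / Gamma a else 0)))"

text \<open>Ferguson's definition: the Dirichlet distribution with parameter
  \<open>(a 0, \<dots>, a n)\<close>, where all \<open>a i\<close> are nonnegative and not all are zero, is the law of the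
  first \<open>n\<close> components of \<open>(Z\<^sub>0, \<dots>, Z\<^sub>n) / (Z\<^sub>0 + \<dots> + Z\<^sub>n)\<close>, for independent \<open>Z\<^sub>i\<close>
  distributed as \<open>gamma_law (a i)\<close>.  A component with \<open>a i = 0\<close> is almost surely zero. If
  all \<open>a i\<close> are positive, this law has density proportional to
  \<open>(\<Prod>i<n. x i powr (a i - 1)) * (1 - (\<Sum>i<n. x i)) powr (a n - 1)\<close> on the open simplex.\<close>

definition dirichlet_law :: "nat \<Rightarrow> (nat \<Rightarrow> real) \<Rightarrow> (nat \<Rightarrow> real) measure" where
  "dirichlet_law n a =
     distr (\<Pi>\<^sub>M i\<in>{..n}. gamma_law (a i)) (\<Pi>\<^sub>M i\<in>{..<n}. borel)
       (\<lambda>z. \<lambda>i\<in>{..<n}. z i / (\<Sum>j\<le>n. z j))"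

text \<open>\<open>D\<close> is a law on the space of Borel probability measures on the line. Cells of a
  partition \<open>C 0, \<dots>, C n\<close> may be empty or null.\<close>

definition is_dirichlet_process_law :: "real measure \<Rightarrow> real measure measure \<Rightarrow> bool" where
  "is_dirichlet_process_law \<alpha> D \<longleftrightarrow>
     D \<in> space (prob_algebra (prob_algebra borel)) \<and>
     (\<forall>n (C :: nat \<Rightarrow> real set).
        (\<forall>i\<le>n. C i \<in> sets borel) \<and> disjoint_family_on C {..n} \<and> (\<Union>i\<le>n. C i) = UNIV \<longrightarrow>
        distr D (\<Pi>\<^sub>M i\<in>{..<n}. borel) (\<lambda>\<phi>. \<lambda>i\<in>{..<n}. measure \<phi> (C i)) =
        dirichlet_law n (\<lambda>i. measure \<alpha> (C i)))"

text \<open>The description is proper: a Dirichlet process exists for every Borel probability measure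
  \<open>\<alpha>\<close> on the line, and its law is determined by the finite-dimensional distributions.\<close>

definition dirichlet_process_law :: "real measure \<Rightarrow> real measure measure" where
  "dirichlet_process_law \<alpha> = (THE D. is_dirichlet_process_law \<alpha> D)"

lemma measurable_mean [measurable]:
  "(\<lambda>\<phi>. \<integral>x. x \<partial>\<phi>) \<in> borel_measurable (prob_algebra (borel :: real measure))"
proof -
  have nn: "(\<lambda>\<phi>. \<integral>\<^sup>+x. f x \<partial>\<phi>) \<in> borel_measurable (prob_algebra (borel :: real measure))"
    if "f \<in> borel_measurable borel" for f
    unfolding prob_algebra_def
    by (intro measurable_restrict_space1 nn_integral_measurable_subprob_algebra that)
  have eq: "(\<integral>x. x \<partial>\<phi>) =
      (if (\<integral>\<^sup>+x. ennreal \<bar>x\<bar> \<partial>\<phi>) < \<infinity>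
       then enn2real (\<integral>\<^sup>+x. ennreal x \<partial>\<phi>) - enn2real (\<integral>\<^sup>+x. ennreal (- x) \<partial>\<phi>) else 0)"
    if "\<phi> \<in> space (prob_algebra borel)" for \<phi> :: "real measure"
  proof -
    have [measurable_cong]: "sets \<phi> = sets borel"
      using that by (simp add: space_prob_algebra)
    have "integrable \<phi> (\<lambda>x. x) \<longleftrightarrow> (\<integral>\<^sup>+x. ennreal \<bar>x\<bar> \<partial>\<phi>) < \<infinity>"
      by (simp add: integrable_iff_bounded)
    then show ?thesis
      using real_lebesgue_integral_def[of \<phi> "\<lambda>x. x"] not_integrable_integral_eq[of \<phi> "\<lambda>x. x"]
      by auto
  qed
  have [measurable]:
    "(\<lambda>\<phi>. \<integral>\<^sup>+x. ennreal \<bar>x\<bar> \<partial>\<phi>) \<in> borel_measurable (prob_algebra (borel :: real measure))"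
    "(\<lambda>\<phi>. \<integral>\<^sup>+x. ennreal x \<partial>\<phi>) \<in> borel_measurable (prob_algebra (borel :: real measure))"
    "(\<lambda>\<phi>. \<integral>\<^sup>+x. ennreal (- x) \<partial>\<phi>) \<in> borel_measurable (prob_algebra (borel :: real measure))"
    by (intro nn; measurable)+
  show ?thesis
    by (subst measurable_cong[OF eq]) measurable
qed

definition mean_law :: "real measure \<Rightarrow> real measure" where
  "mean_law \<alpha> = distr (dirichlet_process_law \<alpha>) borel (\<lambda>\<phi>. \<integral>x. x \<partial>\<phi>)"

definition M1 :: "real measure set" where
  "M1 = mean_law ` F1"

definition beta1 :: "real measure \<Rightarrow> real measure" where
  "beta1 = restrict mean_law F1"

lemma beta1_image: "beta1 ` F1 = M1"
  by (simp add: beta1_def M1_def)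

text \<open>The second argument is the parameter \<open>\<sigma>\<^sup>2\<close>, which may be infinite. In this
  parametrization \<open>1 / \<sigma>\<close> is the scale.\<close>

definition cauchy_law :: "real \<Rightarrow> ennreal \<Rightarrow> real measure" where
  "cauchy_law \<theta> s =
     (if s = \<infinity> then return borel \<theta>
      else (let \<sigma> = sqrt (enn2real s)
            in density lborel (\<lambda>x. ennreal (\<sigma> / (pi * (1 + \<sigma>\<^sup>2 * (x - \<theta>)\<^sup>2))))))"

end

theory Submission
  imports Defs
begin

text \<open>Let \<open>M\<close> be the mean of a Dirichlet process with parameter \<open>\<alpha>\<close>, and let \<open>\<mu>\<close> be its law. Breaking
off the first stick of a stick-breaking representation gives \<open>M = V X + (1 - V) M'\<close> in law, where
\<open>V\<close> is uniform on \<open>(0, 1)\<close>, \<open>X\<close> has law \<open>\<alpha>\<close>, \<open>M'\<close> has law \<open>\<mu>\<close>, and the three are independent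
(\<open>mean_law_self_similar\<close>). For \<open>Re z > 0\<close> let \<open>F\<^sub>\<nu>(z) = \<integral> 1 / (z - \<i> x) \<nu>(dx)\<close>, a rotated Stieltjes
transform. Averaging \<open>1 / (z - \<i> M)\<^sup>2\<close> over \<open>V\<close> first, with \<open>\<integral> (v a + (1 - v) b)\<^bsup>-2\<^esup> dv = 1 / (a b)\<close>
over \<open>(0, 1)\<close>, one gets the differential equation \<open>F\<^sub>\<mu>' = - F\<^sub>\<alpha> F\<^sub>\<mu>\<close> (\<open>stieltjes_mean_law_derivative\<close>),
which is the differentiated Markov--Krein identity and contains no logarithms.

If \<open>\<mu> = \<alpha>\<close>, it says that \<open>1 / F\<^sub>\<alpha>\<close> has derivative 1, so \<open>F\<^sub>\<alpha>(z) = 1 / (z + c)\<close>. Since \<open>F\<^sub>\<alpha>\<close> has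
positive real part, \<open>Re c \<ge> 0\<close>. This is the transform of the Cauchy law with scale \<open>Re c\<close> centred
at \<open>- Im c\<close>, or of a point mass if \<open>Re c = 0\<close>, and the transform determines the measure
(\<open>stieltjes_inj\<close>). Conversely, if \<open>F\<^sub>\<alpha>(z) = 1 / (z + c)\<close>, then \<open>(z + c) F\<^sub>\<mu>(z)\<close> has derivative zero;
since \<open>n F\<^sub>\<mu>(n)\<close> tends to 1, the constant is 1 and \<open>F\<^sub>\<mu> = F\<^sub>\<alpha>\<close>.

Before that, the definite description behind \<open>dirichlet_process_law\<close> has to be identified with
the law of a stick-breaking measure. Existence rests on the same self-similarity, one level down:
a Dirichlet vector \<open>Y\<close> satisfies \<open>Y = V e\<^sub>J + (1 - V) Y\<close> in law for a random vertex \<open>e\<^sub>J\<close>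
(\<open>dirichlet_law_self_similar\<close>), by size-biasing and exponential tilting of independent gamma
variables. Iterating this equation replaces \<open>Y\<close> by the cell masses of the stick-breaking measure
and a remainder that vanishes. Uniqueness holds because the finite-dimensional laws along
partitions determine the joint laws of all evaluations, and these generate the
\<open>\<sigma>\<close>-algebra (\<open>prob_algebra_measure_eqI\<close>). The logarithmic moment makes the mean of the
stick-breaking measure an absolutely convergent series: the unbroken length after \<open>k\<close> steps has
expectation \<open>2\<^bsup>-k\<^esup>\<close>, while the \<open>k\<close>-th atom is eventually at most \<open>(3/2)\<^sup>k\<close> in modulus.\<close>

section \<open>Gamma laws\<close>

lemma sets_gamma_law [measurable_cong, simp]: "sets (gamma_law a) = sets borel"
  by (simp add: gamma_law_def)

lemma space_gamma_law [simp]: "space (gamma_law a) = UNIV"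
  by (simp add: gamma_law_def)

lemma nn_integral_gamma_law:
  assumes "a > 0" "h \<in> borel_measurable borel"
  shows "(\<integral>\<^sup>+z. h z \<partial>gamma_law a) =
    (\<integral>\<^sup>+z. ennreal (if z > 0 then z powr (a - 1) * exp (- z) / Gamma a else 0) * h z \<partial>lborel)"
  using assms by (simp add: gamma_law_def nn_integral_density)

lemma prob_space_gamma_law:
  assumes "a \<ge> 0"
  shows "prob_space (gamma_law a)"
proof (cases "a = 0")
  case True
  then show ?thesis by (simp add: gamma_law_def prob_space_return)
next
  case False
  with assms have a: "a > 0" by simp
  then have G: "Gamma a > 0" by (rule Gamma_real_pos)
  have "(\<integral>\<^sup>+z. ennreal (if z > 0 then z powr (a - 1) * exp (- z) / Gamma a else 0) \<partial>lborel) =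
    (\<integral>\<^sup>+z. ennreal (1 / Gamma a) * ennreal (indicator {0..} z * z powr (a - 1) / exp z) \<partial>lborel)"
    using G by (intro nn_integral_cong)
      (auto simp: indicator_def exp_minus divide_simps simp flip: ennreal_mult')
  also have "\<dots> = ennreal (1 / Gamma a) * ennreal (Gamma a)"
    using a by (subst nn_integral_cmult) (auto simp: Gamma_conv_nn_integral_real)
  also have "\<dots> = 1" using G by (simp flip: ennreal_mult')
  finally show ?thesis using a nn_integral_gamma_law[of a "\<lambda>_. 1"]
    by (intro prob_spaceI) simp
qed

lemma AE_gamma_law_pos:
  assumes "a > 0"
  shows "AE z in gamma_law a. z > 0"
proof -
  have "AE z in gamma_law a. z > 0 \<longleftrightarrow> True"
    using assms unfolding gamma_law_def by (simp, subst AE_density) auto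
  then show ?thesis by simp
qed

lemma AE_gamma_law_nonneg: "a \<ge> 0 \<Longrightarrow> AE z in gamma_law a. z \<ge> 0"
proof (cases "a = 0")
  case True
  have "AE z in return borel (0::real). z \<ge> 0" by (subst AE_return) auto
  then show ?thesis by (simp only: gamma_law_def True if_True refl)
qed (use AE_gamma_law_pos[of a] in \<open>auto elim!: eventually_mono\<close>)

text \<open>An exponential weight only rescales a gamma density, and the power of \<open>c\<close> normalizes it. Scale
invariant functionals of independent gamma variables will therefore not see such a weight.\<close>

lemma gamma_law_tilting:
  assumes a: "a \<ge> 0" and c: "c \<ge> 1" and [measurable]: "k \<in> borel_measurable borel"
  shows "(\<integral>\<^sup>+z. ennreal (c powr a * exp (- (c - 1) * z)) * k (c * z) \<partial>gamma_law a)
    = (\<integral>\<^sup>+z. k z \<partial>gamma_law a)"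
proof (cases "a = 0")
  case True
  then show ?thesis using c by (simp add: gamma_law_def nn_integral_return)
next
  case False
  with a have a: "a > 0" by simp
  then have G: "Gamma a > 0" by (rule Gamma_real_pos)
  have "(\<integral>\<^sup>+z. k z \<partial>gamma_law a) = ennreal \<bar>c\<bar> *
     (\<integral>\<^sup>+z. ennreal (if c * z > 0 then (c * z) powr (a - 1) * exp (- (c * z)) / Gamma a else 0) * k (c * z) \<partial>lborel)"
    using a c by (subst nn_integral_gamma_law, simp, simp,
      subst nn_integral_real_affine[where c = c and t = 0]) (simp_all cong: if_cong)
  also have "\<dots> = (\<integral>\<^sup>+z. ennreal c * (ennreal (if c * z > 0 then (c * z) powr (a - 1) * exp (- (c * z)) / Gamma a else 0) * k (c * z)) \<partial>lborel)"
    using c by (subst nn_integral_cmult) auto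
  also have "\<dots> = (\<integral>\<^sup>+z. ennreal (if z > 0 then z powr (a - 1) * exp (- z) / Gamma a else 0) *
      (ennreal (c powr a * exp (- (c - 1) * z)) * k (c * z)) \<partial>lborel)"
  proof (intro nn_integral_cong)
    fix z :: real
    have "c * ((c * z) powr (a - 1) * exp (- (c * z)) / Gamma a) =
      z powr (a - 1) * exp (- z) / Gamma a * (c powr a * exp (- (c - 1) * z))" if "z > 0"
    proof -
      have "exp (- (c * z)) = exp (-z) * exp (- (c - 1) * z)"
        by (simp add: algebra_simps flip: exp_add)
      moreover have "c * (c * z) powr (a - 1) = z powr (a - 1) * c powr a"
        using c that by (simp add: powr_mult powr_diff)
      ultimately show ?thesis by (simp add: field_simps)
    qed
    then show "ennreal c * (ennreal (if c * z > 0 then (c * z) powr (a - 1) * exp (- (c * z)) / Gamma a else 0) * k (c * z)) =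
      ennreal (if z > 0 then z powr (a - 1) * exp (- z) / Gamma a else 0) *
      (ennreal (c powr a * exp (- (c - 1) * z)) * k (c * z))"
      using c G by (cases "z > 0")
        (simp_all add: zero_less_mult_iff mult.assoc[symmetric] ennreal_mult'[symmetric] del: mult_minus_left)
  qed
  also have "\<dots> = (\<integral>\<^sup>+z. ennreal (c powr a * exp (- (c - 1) * z)) * k (c * z) \<partial>gamma_law a)"
    using a by (simp add: nn_integral_gamma_law)
  finally show ?thesis ..
qed

text \<open>Weighting the density of shape \<open>a\<close> with its argument gives \<open>a\<close> times the density of shape \<open>a + 1\<close>,
which is the law of the sum of a variable of shape \<open>a\<close> and an independent standard exponential
one. In this form the identity also covers the degenerate case \<open>a = 0\<close>.\<close>

lemma gamma_law_size_bias:
  assumes a: "a \<ge> 0" and [measurable]: "h \<in> borel_measurable borel"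
  shows "(\<integral>\<^sup>+z. ennreal z * h z \<partial>gamma_law a) =
    ennreal a * (\<integral>\<^sup>+z. (\<integral>\<^sup>+e. ennreal (exp (- e)) * indicator {0<..} e * h (z + e) \<partial>lborel) \<partial>gamma_law a)"
proof (cases "a = 0")
  case True
  then show ?thesis by (simp add: gamma_law_def nn_integral_return)
next
  case False
  with a have a: "a > 0" by simp
  then have G: "Gamma a > 0" by (rule Gamma_real_pos)
  let ?d = "\<lambda>z. if z > 0 then z powr (a - 1) * exp (- z) / Gamma a else (0::real)"
  have "(\<integral>\<^sup>+z. (\<integral>\<^sup>+e. ennreal (exp (- e)) * indicator {0<..} e * h (z + e) \<partial>lborel) \<partial>gamma_law a)
    = (\<integral>\<^sup>+z. (\<integral>\<^sup>+w. ennreal (exp (- (w - z))) * indicator {0<..} (w - z) * h w \<partial>lborel) \<partial>gamma_law a)"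
  proof (rule nn_integral_cong)
    fix z :: real
    show "(\<integral>\<^sup>+e. ennreal (exp (- e)) * indicator {0<..} e * h (z + e) \<partial>lborel) =
      (\<integral>\<^sup>+w. ennreal (exp (- (w - z))) * indicator {0<..} (w - z) * h w \<partial>lborel)"
      by (subst (2) nn_integral_real_affine[where c = 1 and t = z]) auto
  qed
  also have "\<dots> = (\<integral>\<^sup>+z. ennreal (?d z) *
      (\<integral>\<^sup>+w. ennreal (exp (- (w - z))) * indicator {0<..} (w - z) * h w \<partial>lborel) \<partial>lborel)"
    using a by (subst nn_integral_gamma_law) auto
  also have "\<dots> = (\<integral>\<^sup>+z. (\<integral>\<^sup>+w. ennreal (?d z) *
      (ennreal (exp (- (w - z))) * indicator {0<..} (w - z) * h w) \<partial>lborel) \<partial>lborel)"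
    by (subst nn_integral_cmult) auto
  also have "\<dots> = (\<integral>\<^sup>+w. (\<integral>\<^sup>+z. ennreal (?d z) *
      (ennreal (exp (- (w - z))) * indicator {0<..} (w - z) * h w) \<partial>lborel) \<partial>lborel)"
    by (rule lborel_pair.Fubini') measurable
  also have "\<dots> = (\<integral>\<^sup>+w. ennreal (1 / a) * (ennreal (?d w) * (ennreal w * h w)) \<partial>lborel)"
  proof (rule nn_integral_cong)
    fix w :: real
    have "(\<integral>\<^sup>+z. ennreal (?d z) * (ennreal (exp (- (w - z))) * indicator {0<..} (w - z) * h w) \<partial>lborel)
      = (\<integral>\<^sup>+z. (ennreal (exp (- w) / Gamma a) * h w) * (ennreal (z powr (a - 1)) * indicator {0<..<w} z) \<partial>lborel)"
    proof (rule nn_integral_cong)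
      fix z :: real
      have "z powr (a - 1) * exp (- z) / Gamma a * exp (- (w - z)) = exp (- w) / Gamma a * z powr (a - 1)"
        by (simp add: field_simps flip: exp_add)
      then have "ennreal (z powr (a - 1) * exp (- z) / Gamma a) * ennreal (exp (- (w - z))) =
          ennreal (exp (- w) / Gamma a) * ennreal (z powr (a - 1))"
        using G by (subst (1 2) ennreal_mult[symmetric]) auto
      then show "ennreal (?d z) * (ennreal (exp (- (w - z))) * indicator {0<..} (w - z) * h w) =
         (ennreal (exp (- w) / Gamma a) * h w) * (ennreal (z powr (a - 1)) * indicator {0<..<w} z)"
        by (cases "0 < z \<and> z < w") (auto simp: indicator_def mult_ac)
    qed
    also have "\<dots> = (ennreal (exp (- w) / Gamma a) * h w) * (\<integral>\<^sup>+z. ennreal (z powr (a - 1)) * indicator {0<..<w} z \<partial>lborel)"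
      by (subst nn_integral_cmult) auto
    also have "(\<integral>\<^sup>+z. ennreal (z powr (a - 1)) * indicator {0<..<w} z \<partial>lborel) = ennreal (if w > 0 then w powr a / a else 0)"
    proof (cases "w > 0")
      case True
      have "((\<lambda>z. z powr (a - 1)) has_integral (w powr a / a)) {0..w}"
        using has_integral_powr_from_0[of "a - 1" w] a True by simp
      then have "(\<integral>\<^sup>+z. ennreal (indicator {0..w} z * z powr (a - 1)) \<partial>lborel) = ennreal (w powr a / a)"
        by (intro nn_integral_has_integral_lebesgue) auto
      also have "(\<integral>\<^sup>+z. ennreal (indicator {0..w} z * z powr (a - 1)) \<partial>lborel) =
        (\<integral>\<^sup>+z. ennreal (z powr (a - 1)) * indicator {0..w} z \<partial>lborel)"
        by (intro nn_integral_cong) (auto simp: indicator_def)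
      finally have "(\<integral>\<^sup>+z. ennreal (z powr (a - 1)) * indicator {0..w} z \<partial>lborel) = ennreal (w powr a / a)" .
      moreover have "(\<integral>\<^sup>+z. ennreal (z powr (a - 1)) * indicator {0..w} z \<partial>lborel) =
         (\<integral>\<^sup>+z. ennreal (z powr (a - 1)) * indicator {0<..<w} z \<partial>lborel)"
        using AE_lborel_singleton[of 0] AE_lborel_singleton[of w]
        by (intro nn_integral_cong_AE) (auto elim!: eventually_elim2 simp: indicator_def)
      ultimately show ?thesis using True by simp
    qed auto
    also have "(ennreal (exp (- w) / Gamma a) * h w) * ennreal (if w > 0 then w powr a / a else 0) =
      ennreal (1 / a) * (ennreal (?d w) * (ennreal w * h w))"
    proof (cases "w > 0")
      case True
      have "w powr a = w * w powr (a - 1)" using True by (simp add: powr_diff)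
      then have "exp (- w) / Gamma a * (w powr a / a) = 1 / a * (?d w * w)"
        using True by (simp add: field_simps)
      then have "ennreal (exp (- w) / Gamma a) * ennreal (w powr a / a) = ennreal (1 / a) * (ennreal (?d w) * ennreal w)"
        using True a G by (simp flip: ennreal_mult)
      then show ?thesis using True by (simp add: mult_ac)
    qed auto
    finally show "(\<integral>\<^sup>+z. ennreal (?d z) * (ennreal (exp (- (w - z))) * indicator {0<..} (w - z) * h w) \<partial>lborel) = \<dots>" .
  qed
  also have "\<dots> = ennreal (1 / a) * (\<integral>\<^sup>+w. ennreal w * h w \<partial>gamma_law a)"
    using a by (simp add: nn_integral_gamma_law nn_integral_cmult)
  finally show ?thesis
    using a by (simp add: mult.assoc[symmetric] flip: ennreal_mult)
qed

section \<open>Self-similarity of Dirichlet distributions\<close>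

text \<open>The fraction \<open>v = e / (s + e)\<close> of the total that an exponential variable \<open>e\<close> takes when it joins a
given amount \<open>s\<close>. Given \<open>v\<close>, the dependence on \<open>s\<close> is only through an exponential weight, which is
what \<open>gamma_law_tilting\<close> can remove.\<close>

lemma exponential_ratio_substitution:
  fixes s :: real and \<psi> :: "real \<Rightarrow> ennreal"
  assumes s: "s > 0" and [measurable]: "\<psi> \<in> borel_measurable borel"
  shows "(\<integral>\<^sup>+e. ennreal (exp (- e)) * indicator {0<..} e * (\<psi> (e / (s + e)) * ennreal (1 / (s + e))) \<partial>lborel)
    = (\<integral>\<^sup>+v. indicator {0<..<1} v * (ennreal (exp (- s * (v / (1 - v))) / (1 - v)) * \<psi> v) \<partial>lborel)"
proof -
  define f where "f e = ennreal (exp (- e)) * (\<psi> (e / (s + e)) * ennreal (1 / (s + e)))" for e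
  define g where "g v = s * (v / (1 - v))" for v
  define f' where "f' v = ennreal (exp (- s * (v / (1 - v))) / (1 - v)) * \<psi> v" for v
  define b where "b m = real (Suc m) / real (Suc (Suc m))" for m
  have [measurable]: "f \<in> borel_measurable borel" "f' \<in> borel_measurable borel"
    unfolding f_def f'_def by measurable
  have b: "0 < b m" "b m < 1" for m by (auto simp: b_def)
  have gb: "g (b m) = s * real (Suc m)" for m
    by (simp add: g_def b_def field_simps)
  have step: "emeasure (density lborel f) {0..g (b m)} = emeasure (density lborel f') {0..b m}" for m
  proof -
    have "emeasure (density lborel f) {0..g (b m)} = (\<integral>\<^sup>+x. f x * indicator {g 0..g (b m)} x \<partial>lborel)"
      by (simp add: emeasure_density g_def)
    also have "\<dots> = (\<integral>\<^sup>+v. f (g v) * ennreal (s / (1 - v)\<^sup>2) * indicator {0..b m} v \<partial>lborel)"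
    proof (rule nn_integral_substitution_aux)
      fix v assume v: "v \<in> {0..b m}"
      then have "v < 1" using b[of m] by auto
      then show "(g has_real_derivative s / (1 - v)\<^sup>2) (at v)"
        unfolding g_def by (auto intro!: derivative_eq_intros simp: field_simps power2_eq_square)
      show "0 \<le> s / (1 - v)\<^sup>2" using s by simp
    next
      show "continuous_on {0..b m} (\<lambda>v. s / (1 - v)\<^sup>2)"
        using b[of m] by (intro continuous_intros) auto
    qed (use b in auto)
    also have "\<dots> = (\<integral>\<^sup>+v. f' v * indicator {0..b m} v \<partial>lborel)"
    proof (rule nn_integral_cong)
      fix v
      show "f (g v) * ennreal (s / (1 - v)\<^sup>2) * indicator {0..b m} v = f' v * indicator {0..b m} v"
      proof (cases "v \<in> {0..b m}")
        case True
        then have v: "0 \<le> v" "v < 1" using b[of m] by auto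
        have sg: "s + g v = s / (1 - v)" using v by (simp add: g_def field_simps)
        then have ratio: "g v / (s + g v) = v" using v s by (simp add: g_def)
        have "exp (- g v) * (1 / (s + g v)) * (s / (1 - v)\<^sup>2) = exp (- s * (v / (1 - v))) / (1 - v)"
          unfolding sg using v s by (simp add: g_def power2_eq_square)
        moreover have "ennreal (exp (- g v) * (1 / (s + g v)) * (s / (1 - v)\<^sup>2)) =
          ennreal (exp (- g v)) * ennreal (1 / (s + g v)) * ennreal (s / (1 - v)\<^sup>2)"
        proof -
          have "0 \<le> 1 / (s + g v)" "0 \<le> s / (1 - v)\<^sup>2" using v s by (simp_all add: sg)
          then show ?thesis
            by (subst ennreal_mult, simp, simp, subst ennreal_mult) auto
        qed
        ultimately show ?thesis using True by (simp add: f_def f'_def ratio mult_ac)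
      qed simp
    qed
    also have "\<dots> = emeasure (density lborel f') {0..b m}"
      by (simp add: emeasure_density)
    finally show ?thesis .
  qed
  \<comment> \<open>The intervals \<open>{0..b m}\<close> exhaust \<open>{0..<1}\<close>, and their images exhaust \<open>{0..}\<close>.\<close>
  have U1: "(\<Union>m. {0..g (b m)}) = {0..}"
  proof (intro set_eqI iffI)
    fix x :: real assume x: "x \<in> {0..}"
    obtain m :: nat where "x / s \<le> real m" using real_arch_simple by blast
    then have "x \<le> s * real (Suc m)" using s by (simp add: field_simps)
    then show "x \<in> (\<Union>m. {0..g (b m)})" unfolding gb using x by auto
  qed auto
  have U2: "(\<Union>m. {0..b m}) = {0..<1}"
  proof (intro set_eqI iffI)
    fix x :: real assume x: "x \<in> {0..<1}"
    obtain m :: nat where "1 / (1 - x) \<le> real m" using real_arch_simple by blast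
    then have m: "1 \<le> real m * (1 - x)" using x by (simp add: field_simps)
    have "x * real (Suc (Suc m)) = real (Suc (Suc m)) - real m * (1 - x) - 2 * (1 - x)"
      by (simp add: algebra_simps)
    also have "\<dots> \<le> real (Suc m)" using m x by simp
    finally have "x \<le> b m" by (simp add: b_def field_simps)
    then show "x \<in> (\<Union>m. {0..b m})" using x by auto
  next
    fix x :: real assume "x \<in> (\<Union>m. {0..b m})"
    then show "x \<in> {0..<1}" using b by (auto intro: le_less_trans)
  qed
  have "(\<integral>\<^sup>+e. ennreal (exp (- e)) * indicator {0<..} e * (\<psi> (e / (s + e)) * ennreal (1 / (s + e))) \<partial>lborel)
    = (\<integral>\<^sup>+e. f e * indicator {0..} e \<partial>lborel)"
    using AE_lborel_singleton[of "0::real"]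
    by (intro nn_integral_cong_AE) (auto elim!: eventually_mono simp: f_def indicator_def)
  also have "\<dots> = emeasure (density lborel f) (\<Union>m. {0..g (b m)})"
    unfolding U1 by (simp add: emeasure_density)
  also have "\<dots> = (SUP m. emeasure (density lborel f) {0..g (b m)})"
    using s unfolding gb
    by (intro SUP_emeasure_incseq[symmetric]) (auto simp: incseq_def intro: order_trans mult_left_mono)
  also have "\<dots> = (SUP m. emeasure (density lborel f') {0..b m})"
    unfolding step ..
  also have "\<dots> = emeasure (density lborel f') (\<Union>m. {0..b m})"
  proof (intro SUP_emeasure_incseq)
    have "b m \<le> b m'" if "m \<le> m'" for m m'
      using that by (simp add: b_def field_simps)
    then show "incseq (\<lambda>m. {0..b m})" by (auto simp: incseq_def intro: order_trans)
  qed auto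
  also have "\<dots> = (\<integral>\<^sup>+v. f' v * indicator {0..<1} v \<partial>lborel)"
    unfolding U2 by (simp add: emeasure_density)
  also have "\<dots> = (\<integral>\<^sup>+v. indicator {0<..<1} v * (ennreal (exp (- s * (v / (1 - v))) / (1 - v)) * \<psi> v) \<partial>lborel)"
    using AE_lborel_singleton[of "0::real"]
    by (intro nn_integral_cong_AE) (auto elim!: eventually_mono simp: f'_def indicator_def)
  finally show ?thesis .
qed

definition gamma_vector :: "nat \<Rightarrow> (nat \<Rightarrow> real) \<Rightarrow> (nat \<Rightarrow> real) measure" where
  "gamma_vector n a = (\<Pi>\<^sub>M i\<in>{..n}. gamma_law (a i))"

definition proportions :: "nat \<Rightarrow> (nat \<Rightarrow> real) \<Rightarrow> nat \<Rightarrow> real" where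
  "proportions n z = (\<lambda>i\<in>{..<n}. z i / (\<Sum>j\<le>n. z j))"

lemma dirichlet_law_eq:
  "dirichlet_law n a = distr (gamma_vector n a) (\<Pi>\<^sub>M i\<in>{..<n}. borel) (proportions n)"
  by (simp add: dirichlet_law_def gamma_vector_def proportions_def[abs_def])

lemma sets_gamma_vector [measurable_cong, simp]:
  "sets (gamma_vector n a) = sets (\<Pi>\<^sub>M i\<in>{..n}. borel)"
  unfolding gamma_vector_def by (intro sets_PiM_cong) auto

lemma space_gamma_vector [simp]: "space (gamma_vector n a) = ({..n} \<rightarrow>\<^sub>E UNIV)"
  by (simp add: gamma_vector_def space_PiM)

lemma measurable_proportions [measurable]:
  "proportions n \<in> (\<Pi>\<^sub>M i\<in>{..n}. borel) \<rightarrow>\<^sub>M (\<Pi>\<^sub>M i\<in>{..<n}. borel)"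
  unfolding proportions_def[abs_def] by measurable

lemma proportions_scale:
  assumes "c \<noteq> 0"
  shows "proportions n (\<lambda>i\<in>{..n}. c * z i) = proportions n z"
  unfolding proportions_def using assms
  by (intro restrict_ext) (simp add: sum_distrib_left[symmetric])

lemma product_sigma_finite_gamma_law:
  assumes "\<And>i. a i \<ge> 0"
  shows "product_sigma_finite (\<lambda>i. gamma_law (a i))"
  using prob_space_gamma_law[OF assms] by (simp add: product_sigma_finite_def prob_space_imp_sigma_finite)

lemma prob_space_gamma_vector:
  assumes "\<And>i. a i \<ge> 0"
  shows "prob_space (gamma_vector n a)"
  unfolding gamma_vector_def by (intro prob_space_PiM prob_space_gamma_law assms)

lemma prob_space_dirichlet_law:
  assumes "\<And>i. a i \<ge> 0"
  shows "prob_space (dirichlet_law n a)"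
  unfolding dirichlet_law_eq
  by (intro prob_space.prob_space_distr prob_space_gamma_vector assms) measurable

lemma sets_dirichlet_law [measurable_cong, simp]:
  "sets (dirichlet_law n a) = sets (\<Pi>\<^sub>M i\<in>{..<n}. borel)"
  by (simp add: dirichlet_law_def)

text \<open>For total shape 1, a weight exponential in the total of independent gamma variables amounts to a
common rescaling. This takes the place of the independence of the proportions from the total.\<close>

lemma gamma_vector_tilting:
  assumes a: "\<And>i. a i \<ge> 0" "(\<Sum>i\<le>n. a i) = 1" and c: "c \<ge> 1"
    and [measurable]: "k \<in> borel_measurable (\<Pi>\<^sub>M i\<in>{..n}. borel)"
  shows "(\<integral>\<^sup>+z. ennreal (c * exp (- (c - 1) * (\<Sum>i\<le>n. z i))) * k (\<lambda>i\<in>{..n}. c * z i) \<partial>gamma_vector n a)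
    = (\<integral>\<^sup>+z. k z \<partial>gamma_vector n a)"
proof -
  interpret product_sigma_finite "\<lambda>i. gamma_law (a i)"
    by (rule product_sigma_finite_gamma_law[OF a(1)])
  let ?w = "\<lambda>z::nat \<Rightarrow> real. ennreal (c * exp (- (c - 1) * (\<Sum>i\<le>n. z i)))"
  let ?s = "\<lambda>z::nat \<Rightarrow> real. \<lambda>i\<in>{..n}. c * z i"
  have w: "?w z = (\<Prod>i\<le>n. ennreal (c powr a i * exp (- (c - 1) * z i)))" for z
  proof -
    have "c = (\<Prod>i\<le>n. c powr a i)" using c a(2) by (simp flip: powr_sum)
    then have "c * exp (- (c - 1) * (\<Sum>i\<le>n. z i)) = (\<Prod>i\<le>n. c powr a i * exp (- (c - 1) * z i))"
      by (simp add: prod.distrib sum_distrib_left exp_sum)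
    then show ?thesis by (simp add: prod_ennreal)
  qed
  have "distr (density (gamma_vector n a) ?w) (\<Pi>\<^sub>M i\<in>{..n}. borel) ?s = gamma_vector n a"
    unfolding gamma_vector_def
  proof (rule PiM_eqI)
    show "sets (distr (density (\<Pi>\<^sub>M i\<in>{..n}. gamma_law (a i)) ?w) (\<Pi>\<^sub>M i\<in>{..n}. borel) ?s)
       = sets (\<Pi>\<^sub>M i\<in>{..n}. gamma_law (a i))"
      by (simp, intro sets_PiM_cong) auto
  next
    fix A assume A: "\<And>i. i \<in> {..n} \<Longrightarrow> A i \<in> sets (gamma_law (a i))"
    then have [measurable]: "\<And>i. i \<le> n \<Longrightarrow> A i \<in> sets borel" by simp
    have "Pi\<^sub>E {..n} A \<in> sets (\<Pi>\<^sub>M i\<in>{..n}. borel)"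
      by (intro sets_PiM_I_finite) auto
    note box = this
    moreover have "?s \<in> gamma_vector n a \<rightarrow>\<^sub>M (\<Pi>\<^sub>M i\<in>{..n}. borel)" by measurable
    ultimately have pre [measurable]: "?s -` Pi\<^sub>E {..n} A \<inter> ({..n} \<rightarrow>\<^sub>E UNIV) \<in> sets (gamma_vector n a)"
      using measurable_sets[of ?s "gamma_vector n a"] by simp
    have "emeasure (distr (density (gamma_vector n a) ?w) (\<Pi>\<^sub>M i\<in>{..n}. borel) ?s) (Pi\<^sub>E {..n} A)
      = emeasure (density (gamma_vector n a) ?w) (?s -` Pi\<^sub>E {..n} A \<inter> space (density (gamma_vector n a) ?w))"
      by (rule emeasure_distr[OF _ box]) measurable
    also have "\<dots> = emeasure (density (gamma_vector n a) ?w) (?s -` Pi\<^sub>E {..n} A \<inter> ({..n} \<rightarrow>\<^sub>E UNIV))"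
      by (simp only: space_density space_gamma_vector)
    also have "\<dots> = (\<integral>\<^sup>+z. ?w z * indicator (?s -` Pi\<^sub>E {..n} A \<inter> ({..n} \<rightarrow>\<^sub>E UNIV)) z \<partial>gamma_vector n a)"
      by (rule emeasure_density[OF _ pre]) measurable
    also have "\<dots> = (\<integral>\<^sup>+z. (\<Prod>i\<le>n. ennreal (c powr a i * exp (- (c - 1) * z i)) * indicator (A i) (c * z i)) \<partial>gamma_vector n a)"
    proof (rule nn_integral_cong)
      fix z :: "nat \<Rightarrow> real" assume "z \<in> space (gamma_vector n a)"
      then have "indicator (?s -` Pi\<^sub>E {..n} A \<inter> ({..n} \<rightarrow>\<^sub>E UNIV)) z = (\<Prod>i\<le>n. indicator (A i) (c * z i) :: ennreal)"
        by (auto simp: indicator_def PiE_iff prod.neutral)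
      then show "?w z * indicator (?s -` Pi\<^sub>E {..n} A \<inter> ({..n} \<rightarrow>\<^sub>E UNIV)) z
        = (\<Prod>i\<le>n. ennreal (c powr a i * exp (- (c - 1) * z i)) * indicator (A i) (c * z i))"
        by (simp only: w prod.distrib)
    qed
    also have "\<dots> = (\<Prod>i\<le>n. \<integral>\<^sup>+x. ennreal (c powr a i * exp (- (c - 1) * x)) * indicator (A i) (c * x) \<partial>gamma_law (a i))"
      unfolding gamma_vector_def by (intro product_nn_integral_prod) auto
    also have "\<dots> = (\<Prod>i\<in>{..n}. emeasure (gamma_law (a i)) (A i))"
      using a c by (intro prod.cong refl) (subst gamma_law_tilting, auto)
    finally show "emeasure (distr (density (\<Pi>\<^sub>M i\<in>{..n}. gamma_law (a i)) ?w) (\<Pi>\<^sub>M i\<in>{..n}. borel) ?s) (Pi\<^sub>E {..n} A)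
      = (\<Prod>i\<in>{..n}. emeasure (gamma_law (a i)) (A i))"
      unfolding gamma_vector_def .
  qed simp
  then have "(\<integral>\<^sup>+z. k z \<partial>gamma_vector n a) =
      (\<integral>\<^sup>+z. k z \<partial>distr (density (gamma_vector n a) ?w) (\<Pi>\<^sub>M i\<in>{..n}. borel) ?s)"
    by simp
  also have "\<dots> = (\<integral>\<^sup>+z. ?w z * k (?s z) \<partial>gamma_vector n a)"
    by (simp add: nn_integral_distr nn_integral_density)
  finally show ?thesis ..
qed

lemma gamma_vector_size_bias:
  assumes a: "\<And>i. a i \<ge> 0" and j: "j \<le> n"
    and [measurable]: "h \<in> borel_measurable (\<Pi>\<^sub>M i\<in>{..n}. borel)"
  shows "(\<integral>\<^sup>+z. ennreal (z j) * h z \<partial>gamma_vector n a) = ennreal (a j) *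
    (\<integral>\<^sup>+z. (\<integral>\<^sup>+e. ennreal (exp (- e)) * indicator {0<..} e * h (z(j := z j + e)) \<partial>lborel) \<partial>gamma_vector n a)"
proof -
  interpret product_sigma_finite "\<lambda>i. gamma_law (a i)"
    by (rule product_sigma_finite_gamma_law[OF a])
  define I where "I = {..n} - {j}"
  have [measurable, simp]: "j \<in> {..n}" using j by simp
  have I: "finite I" "j \<notin> I" "{..n} = insert j I" using j by (auto simp: I_def)
  have G: "gamma_vector n a = (\<Pi>\<^sub>M i\<in>insert j I. gamma_law (a i))"
    by (simp add: gamma_vector_def I)
  have SI: "sets (\<Pi>\<^sub>M i\<in>insert j I. gamma_law (a i)) = sets (\<Pi>\<^sub>M i\<in>{..n}. borel)"
    unfolding I(3) by (intro sets_PiM_cong) auto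
  have [measurable]: "h \<in> borel_measurable (\<Pi>\<^sub>M i\<in>insert j I. borel)"
    using assms(3) by (simp add: I)
  have SI': "sets (\<Pi>\<^sub>M i\<in>I. gamma_law (a i)) = sets (\<Pi>\<^sub>M i\<in>I. borel)"
    by (intro sets_PiM_cong) auto
  note [measurable_cong] = SI'
  have hx[measurable]: "(\<lambda>y. h (x(j := y))) \<in> borel_measurable borel"
    if "x \<in> space (\<Pi>\<^sub>M i\<in>I. gamma_law (a i))" for x
  proof -
    have [measurable]: "x \<in> space (\<Pi>\<^sub>M i\<in>I. borel)" using that by (simp add: space_PiM)
    show ?thesis by measurable
  qed
  have m1: "(\<lambda>z. ennreal (z j) * h z) \<in> borel_measurable (\<Pi>\<^sub>M i\<in>insert j I. gamma_law (a i))"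
    unfolding measurable_cong_sets[OF SI refl] by measurable
  have hm: "(\<lambda>p. h ((fst p)(j := fst p j + snd p))) \<in> borel_measurable ((\<Pi>\<^sub>M i\<in>{..n}. borel) \<Otimes>\<^sub>M borel)"
    by (rule measurable_compose[OF measurable_fun_upd[where I = "{..n}"] assms(3)])
      (use j in auto)
  have m2: "(\<lambda>z. \<integral>\<^sup>+e. ennreal (exp (- e)) * indicator {0<..} e * h (z(j := z j + e)) \<partial>lborel) \<in>
     borel_measurable (\<Pi>\<^sub>M i\<in>insert j I. gamma_law (a i))"
    unfolding measurable_cong_sets[OF SI refl]
    using hm by (intro lborel.borel_measurable_nn_integral) (simp add: split_beta')
  have "(\<integral>\<^sup>+z. ennreal (z j) * h z \<partial>gamma_vector n a) =
     (\<integral>\<^sup>+x. (\<integral>\<^sup>+y. ennreal y * h (x(j := y)) \<partial>gamma_law (a j)) \<partial>(\<Pi>\<^sub>M i\<in>I. gamma_law (a i)))"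
    unfolding G by (subst product_nn_integral_insert[OF I(1,2) m1]) simp
  also have "\<dots> = (\<integral>\<^sup>+x. ennreal (a j) * (\<integral>\<^sup>+y. (\<integral>\<^sup>+e. ennreal (exp (- e)) * indicator {0<..} e *
      h (x(j := y + e)) \<partial>lborel) \<partial>gamma_law (a j)) \<partial>(\<Pi>\<^sub>M i\<in>I. gamma_law (a i)))"
    by (intro nn_integral_cong gamma_law_size_bias a hx)
  also have "\<dots> = ennreal (a j) * (\<integral>\<^sup>+x. (\<integral>\<^sup>+y. (\<integral>\<^sup>+e. ennreal (exp (- e)) * indicator {0<..} e *
      h (x(j := y + e)) \<partial>lborel) \<partial>gamma_law (a j)) \<partial>(\<Pi>\<^sub>M i\<in>I. gamma_law (a i)))"
  proof (rule nn_integral_cmult)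
    interpret j: sigma_finite_measure "gamma_law (a j)"
      by (intro prob_space_imp_sigma_finite prob_space_gamma_law a)
    show "(\<lambda>x. \<integral>\<^sup>+y. (\<integral>\<^sup>+e. ennreal (exp (- e)) * indicator {0<..} e *
      h (x(j := y + e)) \<partial>lborel) \<partial>gamma_law (a j)) \<in> borel_measurable (\<Pi>\<^sub>M i\<in>I. gamma_law (a i))"
      by measurable
  qed
  also have "\<dots> = ennreal (a j) *
    (\<integral>\<^sup>+z. (\<integral>\<^sup>+e. ennreal (exp (- e)) * indicator {0<..} e * h (z(j := z j + e)) \<partial>lborel) \<partial>gamma_vector n a)"
    unfolding G by (subst product_nn_integral_insert[OF I(1,2) m2]) simp
  finally show ?thesis .
qed


text \<open>The point at fraction \<open>v\<close> on the way from \<open>y\<close> to the vertex \<open>j\<close> of the simplex. Only the first \<open>n\<close>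
of the \<open>n + 1\<close> barycentric coordinates are stored, so \<open>j = n\<close> stands for the vertex \<open>0\<close>.\<close>

definition mix :: "nat \<Rightarrow> nat \<Rightarrow> real \<Rightarrow> (nat \<Rightarrow> real) \<Rightarrow> nat \<Rightarrow> real" where
  "mix n j v y = (\<lambda>i\<in>{..<n}. v * of_bool (i = j) + (1 - v) * y i)"

lemma measurable_mix [measurable]:
  assumes [measurable]: "f \<in> borel_measurable M" "h \<in> M \<rightarrow>\<^sub>M (\<Pi>\<^sub>M i\<in>{..<n}. borel)"
  shows "(\<lambda>x. mix n j (f x) (h x)) \<in> M \<rightarrow>\<^sub>M (\<Pi>\<^sub>M i\<in>{..<n}. borel)"
  unfolding mix_def by measurable

lemma proportions_add_coordinate:
  assumes "j \<le> n" "(\<Sum>i\<le>n. z i) > 0" "e \<ge> 0"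
  shows "proportions n (z(j := z j + e)) = mix n j (e / ((\<Sum>i\<le>n. z i) + e)) (proportions n z)"
proof -
  define S where "S = (\<Sum>i\<le>n. z i)"
  have "(\<Sum>i\<le>n. (z(j := z j + e)) i) = (\<Sum>i\<le>n. z i + (if i = j then e else 0))"
    by (intro sum.cong) auto
  also have "\<dots> = S + e" using assms by (simp add: sum.distrib S_def)
  finally have S': "(\<Sum>i\<le>n. (z(j := z j + e)) i) = S + e" .
  have *: "1 - e / (S + e) = S / (S + e)" using assms by (simp add: S_def field_simps)
  show ?thesis
    unfolding proportions_def mix_def S' S_def[symmetric] *
    using assms by (intro restrict_ext) (auto simp: S_def[symmetric] add_divide_distrib)
qed

text \<open>Let \<open>S\<close> be the total of the gamma variables \<open>Z\<close>. Writing \<open>1 = (\<Sum>j. Z j) / S\<close> and size-biasing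
each summand adds an exponential variable to a coordinate \<open>j\<close> chosen with probability \<open>a j\<close>. In
the proportions this is a move towards the vertex \<open>j\<close>. The factor \<open>1 / S\<close> and the dependence of
the step length on \<open>S\<close> combine to an exponential weight, which tilting removes, and the step
length comes out uniform and independent of \<open>Z\<close>.\<close>

lemma dirichlet_law_self_similar:
  assumes a: "\<And>i. a i \<ge> 0" "(\<Sum>i\<le>n. a i) = 1"
    and [measurable]: "g \<in> borel_measurable (\<Pi>\<^sub>M i\<in>{..<n}. borel)"
  shows "(\<integral>\<^sup>+y. g y \<partial>dirichlet_law n a) = (\<Sum>j\<le>n. ennreal (a j) *
    (\<integral>\<^sup>+v. indicator {0<..<1} v * (\<integral>\<^sup>+y. g (mix n j v y) \<partial>dirichlet_law n a) \<partial>lborel))"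
proof -
  interpret product_prob_space "\<lambda>i. gamma_law (a i)" "{..n}"
    unfolding product_prob_space_def product_prob_space_axioms_def
    using product_sigma_finite_gamma_law[OF a(1)] prob_space_gamma_law[OF a(1)] by auto
  interpret G: prob_space "gamma_vector n a" by (rule prob_space_gamma_vector[OF a(1)])
  define S where "S z = (\<Sum>i\<le>n. z i)" for z :: "nat \<Rightarrow> real"
  have [measurable]: "S \<in> borel_measurable (\<Pi>\<^sub>M i\<in>{..n}. borel)"
    unfolding S_def[abs_def] by measurable
  define h where "h z = g (proportions n z) * ennreal (1 / S z)" for z
  have [measurable]: "h \<in> borel_measurable (\<Pi>\<^sub>M i\<in>{..n}. borel)"
    unfolding h_def[abs_def] by measurable
  have "AE z in gamma_vector n a. z i \<ge> 0" if "i \<in> {..n}" for i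
    unfolding gamma_vector_def by (rule AE_component[OF that]) (rule AE_gamma_law_nonneg[OF a(1)])
  then have nonneg: "AE z in gamma_vector n a. \<forall>i\<in>{..n}. z i \<ge> 0"
    by (intro AE_finite_allI) auto
  \<comment> \<open>Some shape is positive, so the total is almost surely positive and the proportions are genuine.\<close>
  obtain j0 where j0: "j0 \<in> {..n}" "a j0 > 0"
  proof -
    have "\<exists>j\<in>{..n}. a j \<noteq> 0" using a(2) by (metis sum.neutral zero_neq_one)
    then show ?thesis using that a(1) by (metis less_le)
  qed
  have "AE z in gamma_vector n a. z j0 > 0"
    unfolding gamma_vector_def by (rule AE_component[OF j0(1)]) (rule AE_gamma_law_pos[OF j0(2)])
  with nonneg have S_pos: "AE z in gamma_vector n a. S z > 0 \<and> (\<forall>i\<in>{..n}. z i \<ge> 0)"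
  proof eventually_elim
    case (elim z)
    then show ?case unfolding S_def using j0 by (auto intro!: sum_pos2[where i = j0])
  qed
  have "(\<integral>\<^sup>+y. g y \<partial>dirichlet_law n a) = (\<integral>\<^sup>+z. g (proportions n z) \<partial>gamma_vector n a)"
    unfolding dirichlet_law_eq by (rule nn_integral_distr) measurable
  also have "\<dots> = (\<integral>\<^sup>+z. (\<Sum>j\<le>n. ennreal (z j) * h z) \<partial>gamma_vector n a)"
  proof (rule nn_integral_cong_AE, use S_pos in eventually_elim)
    case (elim z)
    then have "(\<Sum>j\<le>n. ennreal (z j)) = ennreal (S z)"
      unfolding S_def by (intro sum_ennreal) auto
    then have "(\<Sum>j\<le>n. ennreal (z j) * h z) = ennreal (S z) * h z"
      by (simp only: sum_distrib_right[symmetric])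
    also have "\<dots> = ennreal (S z * (1 / S z)) * g (proportions n z)"
      using elim unfolding h_def by (subst ennreal_mult) (auto simp: mult_ac)
    finally show ?case using elim by simp
  qed
  also have "\<dots> = (\<Sum>j\<le>n. \<integral>\<^sup>+z. ennreal (z j) * h z \<partial>gamma_vector n a)"
    by (intro nn_integral_sum) auto
  also have "\<dots> = (\<Sum>j\<le>n. ennreal (a j) *
    (\<integral>\<^sup>+v. indicator {0<..<1} v * (\<integral>\<^sup>+y. g (mix n j v y) \<partial>dirichlet_law n a) \<partial>lborel))"
  proof (rule sum.cong[OF refl])
    fix j assume "j \<in> {..n}"
    then have j: "j \<le> n" by simp
    let ?\<psi> = "\<lambda>z v. g (mix n j v (proportions n z))"
    let ?E = "\<lambda>z v. ennreal (exp (- S z * (v / (1 - v))) / (1 - v))"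
    have "(\<integral>\<^sup>+z. (\<integral>\<^sup>+e. ennreal (exp (- e)) * indicator {0<..} e * h (z(j := z j + e)) \<partial>lborel) \<partial>gamma_vector n a)
      = (\<integral>\<^sup>+z. (\<integral>\<^sup>+v. indicator {0<..<1} v * (?E z v * ?\<psi> z v) \<partial>lborel) \<partial>gamma_vector n a)"
    proof (rule nn_integral_cong_AE, use S_pos AE_space in eventually_elim)
      case (elim z)
      then have [measurable]: "z \<in> space (\<Pi>\<^sub>M i\<in>{..n}. borel)" by (simp add: space_PiM)
      have "(\<integral>\<^sup>+e. ennreal (exp (- e)) * indicator {0<..} e * h (z(j := z j + e)) \<partial>lborel) =
        (\<integral>\<^sup>+e. ennreal (exp (- e)) * indicator {0<..} e * (?\<psi> z (e / (S z + e)) * ennreal (1 / (S z + e))) \<partial>lborel)"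
      proof (rule nn_integral_cong)
        fix e :: real
        have "S (z(j := z j + e)) = S z + e"
        proof -
          have "S (z(j := z j + e)) = (\<Sum>i\<le>n. z i + (if i = j then e else 0))"
            unfolding S_def by (intro sum.cong) auto
          then show ?thesis using j by (simp add: sum.distrib S_def)
        qed
        moreover have "proportions n (z(j := z j + e)) = mix n j (e / (S z + e)) (proportions n z)" if "e > 0"
          using proportions_add_coordinate[of j n z e] elim j that by (simp add: S_def)
        ultimately show "ennreal (exp (- e)) * indicator {0<..} e * h (z(j := z j + e)) =
            ennreal (exp (- e)) * indicator {0<..} e * (?\<psi> z (e / (S z + e)) * ennreal (1 / (S z + e)))"
          by (cases "e > 0") (simp_all add: h_def)
      qed
      also have "\<dots> = (\<integral>\<^sup>+v. indicator {0<..<1} v * (?E z v * ?\<psi> z v) \<partial>lborel)"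
        using elim by (intro exponential_ratio_substitution) auto
      finally show ?case .
    qed
    also have "\<dots> = (\<integral>\<^sup>+v. (\<integral>\<^sup>+z. indicator {0<..<1} v * (?E z v * ?\<psi> z v) \<partial>gamma_vector n a) \<partial>lborel)"
    proof -
      interpret pair_sigma_finite "gamma_vector n a" lborel ..
      show ?thesis by (rule Fubini'[symmetric]) measurable
    qed
    also have "\<dots> = (\<integral>\<^sup>+v. indicator {0<..<1} v * (\<integral>\<^sup>+y. g (mix n j v y) \<partial>dirichlet_law n a) \<partial>lborel)"
    proof (rule nn_integral_cong)
      fix v :: real
      show "(\<integral>\<^sup>+z. indicator {0<..<1} v * (?E z v * ?\<psi> z v) \<partial>gamma_vector n a) =
        indicator {0<..<1} v * (\<integral>\<^sup>+y. g (mix n j v y) \<partial>dirichlet_law n a)"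
      proof (cases "v \<in> {0<..<1}")
        case True
        then have v: "0 < v" "v < 1" by auto
        \<comment> \<open>With this scale the tilting exponent \<open>c - 1\<close> is \<open>v / (1 - v)\<close>, as produced by the substitution.\<close>
        define c where "c = 1 / (1 - v)"
        have c: "c \<ge> 1" "c \<noteq> 0" "c - 1 = v / (1 - v)" using v by (auto simp: c_def field_simps)
        have "(\<integral>\<^sup>+z. ?E z v * ?\<psi> z v \<partial>gamma_vector n a) =
           (\<integral>\<^sup>+z. ennreal (c * exp (- (c - 1) * (\<Sum>i\<le>n. z i))) * ?\<psi> (\<lambda>i\<in>{..n}. c * z i) v \<partial>gamma_vector n a)"
          by (simp only: proportions_scale[OF c(2)] c(3) S_def) (simp add: c_def mult.commute)
        also have "\<dots> = (\<integral>\<^sup>+z. ?\<psi> z v \<partial>gamma_vector n a)"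
          by (rule gamma_vector_tilting[OF a c(1)]) measurable
        also have "\<dots> = (\<integral>\<^sup>+y. g (mix n j v y) \<partial>dirichlet_law n a)"
          unfolding dirichlet_law_eq by (rule nn_integral_distr[symmetric]) measurable
        finally show ?thesis using True by simp
      qed simp
    qed
    finally show "(\<integral>\<^sup>+z. ennreal (z j) * h z \<partial>gamma_vector n a) = ennreal (a j) *
      (\<integral>\<^sup>+v. indicator {0<..<1} v * (\<integral>\<^sup>+y. g (mix n j v y) \<partial>dirichlet_law n a) \<partial>lborel)"
      using gamma_vector_size_bias[where a = a and n = n and h = h, OF a(1) j] by simp
  qed
  finally show ?thesis .
qed

section \<open>Stick-breaking measures\<close>

text \<open>A sample \<open>\<omega>\<close> is a sequence of independent pairs \<open>(V, X)\<close>, with \<open>V\<close> uniform on \<open>(0, 1)\<close> and \<open>X\<close>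
distributed as the base measure \<open>\<alpha>\<close>: the fraction to break off the remaining stick, and the place
where to put that mass. Uniform fractions correspond to total mass 1 of the parameter.\<close>

locale stick_breaking = prob_space \<alpha> for \<alpha> :: "real measure" +
  assumes sets_base [measurable_cong, simp]: "sets \<alpha> = sets borel"
begin

lemma space_base [simp]: "space \<alpha> = UNIV"
  using sets_eq_imp_space_eq[OF sets_base] by simp

definition break_law :: "(real \<times> real) measure" where
  "break_law = uniform_measure lborel {0<..<1} \<Otimes>\<^sub>M \<alpha>"

definition breaks :: "(nat \<Rightarrow> real \<times> real) measure" where
  "breaks = (\<Pi>\<^sub>M k\<in>UNIV. break_law)"

lemma sets_break_law [measurable_cong]: "sets break_law = sets (borel \<Otimes>\<^sub>M borel)"
  unfolding break_law_def by (intro sets_pair_measure_cong) auto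

lemma prob_space_uniform: "prob_space (uniform_measure lborel {0<..<1::real})"
  by (rule prob_space_uniform_measure) auto

lemma prob_space_break_law: "prob_space break_law"
proof -
  interpret U: prob_space "uniform_measure lborel {0<..<1::real}" by (rule prob_space_uniform)
  interpret pair_prob_space "uniform_measure lborel {0<..<1::real}" \<alpha> ..
  show ?thesis unfolding break_law_def by (rule P.prob_space_axioms)
qed

sublocale break: prob_space break_law by (rule prob_space_break_law)

sublocale seq: sequence_space break_law ..

lemma breaks_eq: "breaks = seq.S" by (simp add: breaks_def)

lemma sets_breaks [measurable_cong]: "sets breaks = sets (\<Pi>\<^sub>M k\<in>UNIV. borel \<Otimes>\<^sub>M borel)"
  unfolding breaks_def by (intro sets_PiM_cong sets_break_law refl)

sublocale breaks: prob_space breaks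
  unfolding breaks_def by (rule seq.P.prob_space_axioms)

lemma nn_integral_break_law:
  assumes [measurable]: "f \<in> borel_measurable (borel \<Otimes>\<^sub>M borel)"
  shows "(\<integral>\<^sup>+s. f s \<partial>break_law) = (\<integral>\<^sup>+v. indicator {0<..<1} v * (\<integral>\<^sup>+x. f (v, x) \<partial>\<alpha>) \<partial>lborel)"
proof -
  have "(\<integral>\<^sup>+s. f s \<partial>break_law) = (\<integral>\<^sup>+v. (\<integral>\<^sup>+x. f (v, x) \<partial>\<alpha>) \<partial>uniform_measure lborel {0<..<1})"
    unfolding break_law_def by (rule nn_integral_fst[symmetric]) measurable
  also have "\<dots> = (\<integral>\<^sup>+v. (\<integral>\<^sup>+x. f (v, x) \<partial>\<alpha>) * indicator {0<..<1} v \<partial>lborel) / emeasure lborel {0<..<1::real}"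
    by (rule nn_integral_uniform_measure) measurable
  finally show ?thesis by (simp add: mult.commute divide_ennreal_def)
qed

lemma measurable_case_nat_breaks [measurable]:
  "(\<lambda>p. case_nat (fst p) (snd p)) \<in> break_law \<Otimes>\<^sub>M breaks \<rightarrow>\<^sub>M breaks"
  unfolding breaks_def by measurable

text \<open>A sequence of independent pairs is one pair followed by an independent sequence with the same law.
All self-similarity of the stick-breaking measure comes from this.\<close>

lemma nn_integral_breaks:
  assumes [measurable]: "f \<in> borel_measurable breaks"
  shows "(\<integral>\<^sup>+\<omega>. f \<omega> \<partial>breaks) = (\<integral>\<^sup>+s. (\<integral>\<^sup>+\<omega>. f (case_nat s \<omega>) \<partial>breaks) \<partial>break_law)"
proof -
  have "(\<integral>\<^sup>+\<omega>. f \<omega> \<partial>breaks) = (\<integral>\<^sup>+\<omega>. f \<omega> \<partial>distr (break_law \<Otimes>\<^sub>M breaks) breaks (\<lambda>p. case_nat (fst p) (snd p)))"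
    using seq.PiM_iter by (simp add: breaks_eq split_beta')
  also have "\<dots> = (\<integral>\<^sup>+p. f (case_nat (fst p) (snd p)) \<partial>(break_law \<Otimes>\<^sub>M breaks))"
    by (rule nn_integral_distr) measurable
  also have "\<dots> = (\<integral>\<^sup>+s. (\<integral>\<^sup>+\<omega>. f (case_nat s \<omega>) \<partial>breaks) \<partial>break_law)"
    by (subst breaks.nn_integral_fst[symmetric]) simp_all
  finally show ?thesis .
qed

end

definition remaining :: "(nat \<Rightarrow> real \<times> real) \<Rightarrow> nat \<Rightarrow> real" where
  "remaining \<omega> k = (\<Prod>j<k. 1 - fst (\<omega> j))"

definition weight :: "(nat \<Rightarrow> real \<times> real) \<Rightarrow> nat \<Rightarrow> real" where
  "weight \<omega> k = fst (\<omega> k) * remaining \<omega> k"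

lemma remaining_case_nat:
  "remaining (case_nat s \<omega>) 0 = 1"
  "remaining (case_nat s \<omega>) (Suc k) = (1 - fst s) * remaining \<omega> k"
  unfolding remaining_def by (simp_all add: prod.lessThan_Suc_shift del: prod.lessThan_Suc)

lemma weight_case_nat:
  "weight (case_nat s \<omega>) 0 = fst s"
  "weight (case_nat s \<omega>) (Suc k) = (1 - fst s) * weight \<omega> k"
  by (simp_all add: weight_def remaining_case_nat)

lemma sum_weight: "(\<Sum>j<k. weight \<omega> j) = 1 - remaining \<omega> k"
  by (induction k) (simp_all add: weight_def remaining_def algebra_simps)

context stick_breaking
begin

lemma measurable_breaks_component: "(\<lambda>\<omega>. \<omega> k) \<in> breaks \<rightarrow>\<^sub>M borel \<Otimes>\<^sub>M borel"
  unfolding measurable_cong_sets[OF sets_breaks refl] by (rule measurable_component_singleton) simp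

lemma measurable_fst_break [measurable]: "(\<lambda>\<omega>. fst (\<omega> k)) \<in> borel_measurable breaks"
  and measurable_snd_break [measurable]: "(\<lambda>\<omega>. snd (\<omega> k)) \<in> borel_measurable breaks"
  by (rule measurable_compose[OF measurable_breaks_component], rule measurable_fst measurable_snd)+

lemma measurable_remaining [measurable]: "(\<lambda>\<omega>. remaining \<omega> k) \<in> borel_measurable breaks"
  unfolding remaining_def by measurable

lemma measurable_weight [measurable]: "(\<lambda>\<omega>. weight \<omega> k) \<in> borel_measurable breaks"
  unfolding weight_def by measurable

lemma AE_fraction: "AE \<omega> in breaks. \<forall>k. 0 < fst (\<omega> k) \<and> fst (\<omega> k) < 1"
proof -
  interpret U: prob_space "uniform_measure lborel {0<..<1::real}" by (rule prob_space_uniform)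
  interpret U: pair_sigma_finite "uniform_measure lborel {0<..<1::real}" \<alpha> ..
  have "AE v in uniform_measure lborel {0<..<1::real}. 0 < v \<and> v < 1"
    by (rule AE_uniform_measureI) auto
  moreover have "{s \<in> space break_law. 0 < fst s \<and> fst s < 1} \<in> sets break_law"
    by measurable
  ultimately have "AE s in break_law. 0 < fst s \<and> fst s < 1"
    unfolding break_law_def by (intro U.AE_pair_measure) simp_all
  then have "AE \<omega> in breaks. 0 < fst (\<omega> k) \<and> fst (\<omega> k) < 1" for k
    unfolding breaks_def by (rule seq.AE_component[OF UNIV_I])
  then show ?thesis unfolding AE_all_countable by (rule allI)
qed

lemma nn_integral_remaining: "(\<integral>\<^sup>+\<omega>. ennreal (remaining \<omega> k) \<partial>breaks) = ennreal ((1/2) ^ k)"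
proof (induction k)
  case 0
  then show ?case by (simp add: remaining_def breaks.emeasure_space_1)
next
  case (Suc k)
  have half: "(\<integral>\<^sup>+v. indicator {0<..<1} v * ennreal (1 - v) \<partial>lborel) = ennreal (1/2)"
  proof -
    have "(\<integral>\<^sup>+v. indicator {0<..<1} v * ennreal (1 - v) \<partial>lborel) = (\<integral>\<^sup>+v. ennreal (1 - v) * indicator {0..1} v \<partial>lborel)"
      using AE_lborel_singleton[of "0::real"] AE_lborel_singleton[of "1::real"]
      by (intro nn_integral_cong_AE) (auto elim!: eventually_elim2 simp: indicator_def)
    also have "\<dots> = ennreal ((1 - 1\<^sup>2/2) - (0 - 0\<^sup>2/2))"
      by (rule nn_integral_FTC_Icc) (auto intro!: derivative_eq_intros)
    finally show ?thesis by simp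
  qed
  have "(\<integral>\<^sup>+\<omega>. ennreal (remaining \<omega> (Suc k)) \<partial>breaks) =
    (\<integral>\<^sup>+s. (\<integral>\<^sup>+\<omega>. ennreal ((1 - fst s) * remaining \<omega> k) \<partial>breaks) \<partial>break_law)"
    by (subst nn_integral_breaks) (simp_all add: remaining_case_nat)
  also have "\<dots> = (\<integral>\<^sup>+s. ennreal (1 - fst s) * ennreal ((1/2) ^ k) \<partial>break_law)"
  proof (rule nn_integral_cong)
    fix s
    have "(\<integral>\<^sup>+\<omega>. ennreal ((1 - fst s) * remaining \<omega> k) \<partial>breaks) =
      (\<integral>\<^sup>+\<omega>. ennreal (1 - fst s) * ennreal (remaining \<omega> k) \<partial>breaks)"
    proof (intro nn_integral_cong_AE, use AE_fraction in eventually_elim)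
      case (elim \<omega>)
      then have "remaining \<omega> k \<ge> 0" unfolding remaining_def by (intro prod_nonneg) (auto simp: less_imp_le)
      then show ?case by (simp add: ennreal_mult'')
    qed
    then show "(\<integral>\<^sup>+\<omega>. ennreal ((1 - fst s) * remaining \<omega> k) \<partial>breaks) = ennreal (1 - fst s) * ennreal ((1/2) ^ k)"
      by (simp add: nn_integral_cmult Suc)
  qed
  also have "\<dots> = (\<integral>\<^sup>+v. indicator {0<..<1} v * (\<integral>\<^sup>+x. ennreal (1 - v) * ennreal ((1/2) ^ k) \<partial>\<alpha>) \<partial>lborel)"
    by (subst nn_integral_break_law) simp_all
  also have "\<dots> = (\<integral>\<^sup>+v. indicator {0<..<1} v * ennreal (1 - v) \<partial>lborel) * ennreal ((1/2) ^ k)"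
    by (subst nn_integral_multc[symmetric]) (simp_all add: emeasure_space_1[simplified] mult.assoc)
  also have "\<dots> = ennreal (1/2 * (1/2) ^ k)" unfolding half by (rule ennreal_mult[symmetric]) auto
  finally show ?case by simp
qed

text \<open>Since the expected remaining length is \<open>(1/2) ^ k\<close>, it still decays after multiplication with
\<open>q ^ k\<close> for any \<open>q < 2\<close>. A ratio above 1 is kept for the comparison with the atoms in
\<open>AE_summable_mean\<close>.\<close>

lemma AE_summable_remaining: "AE \<omega> in breaks. summable (\<lambda>k. remaining \<omega> k * (3/2) ^ k)"
proof -
  have "(\<integral>\<^sup>+\<omega>. (\<Sum>k. ennreal (remaining \<omega> k * (3/2) ^ k)) \<partial>breaks) =
      (\<Sum>k. \<integral>\<^sup>+\<omega>. ennreal (remaining \<omega> k * (3/2) ^ k) \<partial>breaks)"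
    by (rule nn_integral_suminf) measurable
  also have "\<dots> = (\<Sum>k. ennreal ((3/4) ^ k))"
  proof (intro suminf_cong)
    fix k
    have "(\<integral>\<^sup>+\<omega>. ennreal (remaining \<omega> k * (3/2) ^ k) \<partial>breaks) = ennreal ((1/2) ^ k) * ennreal ((3/2) ^ k)"
      by (subst nn_integral_remaining[symmetric], subst nn_integral_multc[symmetric]) (simp_all add: ennreal_mult'')
    also have "\<dots> = ennreal ((3/4) ^ k)"
      by (simp flip: ennreal_mult power_mult_distrib)
    finally show "(\<integral>\<^sup>+\<omega>. ennreal (remaining \<omega> k * (3/2) ^ k) \<partial>breaks) = ennreal ((3/4) ^ k)" .
  qed
  also have "\<dots> = ennreal (\<Sum>k. (3/4) ^ k)"
    by (intro suminf_ennreal2) (auto simp: summable_geometric)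
  finally have "(\<integral>\<^sup>+\<omega>. (\<Sum>k. ennreal (remaining \<omega> k * (3/2) ^ k)) \<partial>breaks) \<noteq> \<infinity>" by simp
  then have "AE \<omega> in breaks. (\<Sum>k. ennreal (remaining \<omega> k * (3/2) ^ k)) \<noteq> \<infinity>"
    by (intro nn_integral_PInf_AE) measurable
  with AE_fraction show ?thesis
  proof eventually_elim
    case (elim \<omega>)
    have "remaining \<omega> k \<ge> 0" for k
      unfolding remaining_def using elim by (intro prod_nonneg) (auto simp: less_imp_le)
    then show ?case using elim by (intro summable_suminf_not_top) auto
  qed
qed

lemma AE_remaining_tendsto: "AE \<omega> in breaks. remaining \<omega> \<longlonglongrightarrow> 0"
  using AE_summable_remaining AE_fraction
proof eventually_elim
  case (elim \<omega>)
  have nn: "remaining \<omega> k \<ge> 0" for k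
    unfolding remaining_def using elim by (intro prod_nonneg) (auto simp: less_imp_le)
  have "remaining \<omega> k * 1 \<le> remaining \<omega> k * (3/2) ^ k" for k
    by (rule mult_left_mono[OF one_le_power nn]) simp
  then show ?case
    using nn by (intro real_tendsto_sandwich[OF _ _ tendsto_const summable_LIMSEQ_zero[OF elim(1)]] always_eventually) auto
qed

end

text \<open>The random measure \<open>\<Sum>k. weight \<omega> k * \<delta>(snd (\<omega> k))\<close>. On the null set of samples whose weights do not
add up to 1, the value is an arbitrary probability measure, so that \<open>stick_measure\<close> is everywhere
a point of the space of probability measures.\<close>

definition stick_measure :: "(nat \<Rightarrow> real \<times> real) \<Rightarrow> real measure" where
  "stick_measure \<omega> = (if (\<Sum>k. ennreal (weight \<omega> k)) = 1
     then distr (density (count_space UNIV) (\<lambda>k. ennreal (weight \<omega> k))) borel (\<lambda>k. snd (\<omega> k))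
     else return borel 0)"

lemma sets_stick_measure [measurable_cong, simp]: "sets (stick_measure \<omega>) = sets borel"
  by (simp add: stick_measure_def)

lemma space_stick_measure [simp]: "space (stick_measure \<omega>) = UNIV"
  by (simp add: stick_measure_def)

lemma nn_integral_stick_measure:
  assumes "(\<Sum>k. ennreal (weight \<omega> k)) = 1" and [measurable]: "f \<in> borel_measurable borel"
  shows "(\<integral>\<^sup>+x. f x \<partial>stick_measure \<omega>) = (\<Sum>k. ennreal (weight \<omega> k) * f (snd (\<omega> k)))"
proof -
  have "(\<integral>\<^sup>+x. f x \<partial>stick_measure \<omega>) =
      (\<integral>\<^sup>+k. f (snd (\<omega> k)) \<partial>density (count_space UNIV) (\<lambda>k. ennreal (weight \<omega> k)))"
    unfolding stick_measure_def if_P[OF assms(1)] by (rule nn_integral_distr) auto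
  also have "\<dots> = (\<integral>\<^sup>+k. ennreal (weight \<omega> k) * f (snd (\<omega> k)) \<partial>count_space UNIV)"
    by (rule nn_integral_density) auto
  finally show ?thesis by (simp only: nn_integral_count_space_nat)
qed

lemma emeasure_stick_measure:
  assumes "A \<in> sets borel"
  shows "emeasure (stick_measure \<omega>) A = (if (\<Sum>k. ennreal (weight \<omega> k)) = 1
     then (\<Sum>k. ennreal (weight \<omega> k) * indicator A (snd (\<omega> k))) else indicator A 0)"
proof (cases "(\<Sum>k. ennreal (weight \<omega> k)) = 1")
  case True
  have "emeasure (stick_measure \<omega>) A = (\<integral>\<^sup>+x. indicator A x \<partial>stick_measure \<omega>)"
    by (rule nn_integral_indicator[symmetric]) (simp add: assms)
  then show ?thesis
    unfolding if_P[OF True] using assms by (simp only: nn_integral_stick_measure[OF True] borel_measurable_indicator)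
next
  case False
  show ?thesis
    unfolding stick_measure_def if_not_P[OF False] by (rule emeasure_return[OF assms])
qed

lemma prob_space_stick_measure: "prob_space (stick_measure \<omega>)"
proof (rule prob_spaceI)
  have "emeasure (stick_measure \<omega>) UNIV = (if (\<Sum>k. ennreal (weight \<omega> k)) = 1
     then (\<Sum>k. ennreal (weight \<omega> k) * indicator UNIV (snd (\<omega> k))) else indicator UNIV (0::real))"
    by (rule emeasure_stick_measure) simp
  also have "\<dots> = 1" unfolding indicator_UNIV mult_1_right by (rule if_split_eq1[THEN iffD2]) blast
  finally have "emeasure (stick_measure \<omega>) UNIV = 1" .
  then show "emeasure (stick_measure \<omega>) (space (stick_measure \<omega>)) = 1" by simp
qed

context stick_breaking
begin

lemma measurable_stick_measure [measurable]: "stick_measure \<in> breaks \<rightarrow>\<^sub>M prob_algebra borel"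
proof (rule measurable_prob_algebraI)
  show "stick_measure \<in> breaks \<rightarrow>\<^sub>M subprob_algebra borel"
  proof (rule measurable_subprob_algebra)
    fix A :: "real set" assume [measurable]: "A \<in> sets borel"
    show "(\<lambda>\<omega>. emeasure (stick_measure \<omega>) A) \<in> borel_measurable breaks"
      unfolding emeasure_stick_measure[OF \<open>A \<in> sets borel\<close>] by measurable
  qed (simp_all add: prob_space_imp_subprob_space[OF prob_space_stick_measure])
qed (rule prob_space_stick_measure)

lemma AE_weights: "AE \<omega> in breaks. (\<forall>k. weight \<omega> k \<ge> 0) \<and> weight \<omega> sums 1 \<and> (\<Sum>k. ennreal (weight \<omega> k)) = 1"
  using AE_remaining_tendsto AE_fraction
proof eventually_elim
  case (elim \<omega>)
  have nn: "weight \<omega> k \<ge> 0" for k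
    unfolding weight_def remaining_def using elim by (intro prod_nonneg mult_nonneg_nonneg) (auto simp: less_imp_le)
  have "(\<lambda>k. 1 - remaining \<omega> k) \<longlonglongrightarrow> 1 - 0" using elim by (intro tendsto_intros)
  then have sums: "weight \<omega> sums 1" by (simp add: sums_def sum_weight)
  have "(\<Sum>k. ennreal (weight \<omega> k)) = ennreal (\<Sum>k. weight \<omega> k)"
    by (rule suminf_ennreal2[OF nn sums_summable[OF sums]])
  then have "(\<Sum>k. ennreal (weight \<omega> k)) = 1"
    by (simp only: sums_unique[OF sums, symmetric] ennreal_1)
  with nn sums show ?case by (intro conjI allI)
qed

lemma AE_measure_stick_measure:
  "AE \<omega> in breaks. \<forall>A\<in>sets borel. (\<lambda>k. weight \<omega> k * indicator A (snd (\<omega> k))) sums measure (stick_measure \<omega>) A"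
  using AE_weights
proof eventually_elim
  case (elim \<omega>)
  then have nn: "\<And>k. weight \<omega> k \<ge> 0" and sums: "weight \<omega> sums 1"
    and total: "(\<Sum>k. ennreal (weight \<omega> k)) = 1" by blast+
  show ?case
  proof
    fix A :: "real set" assume A: "A \<in> sets borel"
    have nn': "weight \<omega> k * indicator A (snd (\<omega> k)) \<ge> 0" for k
      using nn[of k] by simp
    have summable: "summable (\<lambda>k. weight \<omega> k * indicator A (snd (\<omega> k)))"
      using nn by (intro summable_comparison_test'[OF sums_summable[OF sums]]) (simp add: indicator_def)
    have "emeasure (stick_measure \<omega>) A = (\<Sum>k. ennreal (weight \<omega> k) * indicator A (snd (\<omega> k)))"
      by (simp only: emeasure_stick_measure[OF A] total if_True refl)
    also have "\<dots> = (\<Sum>k. ennreal (weight \<omega> k * indicator A (snd (\<omega> k))))"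
      by (intro suminf_cong) (simp add: indicator_def)
    also have "\<dots> = ennreal (\<Sum>k. weight \<omega> k * indicator A (snd (\<omega> k)))"
      by (rule suminf_ennreal2[OF nn' summable])
    finally have "measure (stick_measure \<omega>) A = (\<Sum>k. weight \<omega> k * indicator A (snd (\<omega> k)))"
      using suminf_nonneg[OF summable nn'] by (simp only: measure_def enn2real_ennreal)
    then show "(\<lambda>k. weight \<omega> k * indicator A (snd (\<omega> k))) sums measure (stick_measure \<omega>) A"
      using summable_sums[OF summable] by (simp only:)
  qed
qed

end

section \<open>Existence of the Dirichlet process\<close>

lemma prob_space_eqI_boxes:
  fixes P Q :: "(nat \<Rightarrow> real) measure"
  assumes P: "prob_space P" "sets P = sets (\<Pi>\<^sub>M i\<in>{..<n}. borel)"
    and Q: "sets Q = sets (\<Pi>\<^sub>M i\<in>{..<n}. borel)"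
    and eq: "\<And>b. emeasure P (\<Pi>\<^sub>E i\<in>{..<n}. {..b i}) = emeasure Q (\<Pi>\<^sub>E i\<in>{..<n}. {..b i})"
  shows "P = Q"
proof (rule measure_eqI_generator_eq)
  interpret P: prob_space P by fact
  let ?E = "range (\<lambda>b::nat \<Rightarrow> real. \<Pi>\<^sub>E i\<in>{..<n}. {..b i})"
  let ?\<Omega> = "{..<n} \<rightarrow>\<^sub>E (UNIV :: real set)"
  have in_E: "(\<Pi>\<^sub>E i\<in>{..<n}. {..b i}) \<in> ?E" for b
    by (rule image_eqI[where x = b]) (rule refl, rule UNIV_I)
  show "Int_stable ?E"
  proof (rule Int_stableI)
    fix A B assume "A \<in> ?E" "B \<in> ?E"
    then obtain b c where "A = (\<Pi>\<^sub>E i\<in>{..<n}. {..b i})" "B = (\<Pi>\<^sub>E i\<in>{..<n}. {..c i})" by auto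
    then have "A \<inter> B = (\<Pi>\<^sub>E i\<in>{..<n}. {..min (b i) (c i)})"
      by (simp only: PiE_Int Int_atMost)
    then show "A \<inter> B \<in> ?E" by (simp only: in_E)
  qed
  show "?E \<subseteq> Pow ?\<Omega>" by (intro image_subsetI PowI PiE_mono) simp
  show "emeasure P X = emeasure Q X" if "X \<in> ?E" for X using that eq by auto
  have box: "{f \<in> ?\<Omega>. \<forall>i\<in>{..<n}. f i \<in> A i} = Pi\<^sub>E {..<n} A" for A :: "nat \<Rightarrow> real set"
    by (auto simp: PiE_def)
  have borel: "borel = sigma UNIV (range (\<lambda>a::real. {..a}))" by (rule borel_eq_atMost)
  have "sets (\<Pi>\<^sub>M i\<in>{..<n}. (borel :: real measure)) = sets (sigma ?\<Omega>
      {{f \<in> ?\<Omega>. \<forall>i\<in>j. f i \<in> A i} | A j. j \<in> {{..<n}} \<and> A \<in> Pi j (\<lambda>_. range (\<lambda>a::real. {..a}))})"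
    unfolding borel
  proof (rule sets_PiM_sigma)
    have "UNIV = (\<Union>k::nat. {..real k})"
      using real_arch_simple by auto
    then show "\<exists>S\<subseteq>range (\<lambda>a::real. {..a}). countable S \<and> UNIV = \<Union> S"
      by (intro exI[of _ "range (\<lambda>k::nat. {..real k})"]) auto
  qed auto
  also have "{{f \<in> ?\<Omega>. \<forall>i\<in>j. f i \<in> A i} | A j. j \<in> {{..<n}} \<and> A \<in> Pi j (\<lambda>_. range (\<lambda>a::real. {..a}))} = ?E"
  proof (intro set_eqI iffI)
    fix X assume "X \<in> {{f \<in> ?\<Omega>. \<forall>i\<in>j. f i \<in> A i} | A j. j \<in> {{..<n}} \<and> A \<in> Pi j (\<lambda>_. range (\<lambda>a::real. {..a}))}"
    then obtain A where X: "X = {f \<in> ?\<Omega>. \<forall>i\<in>{..<n}. f i \<in> A i}" and A: "A \<in> Pi {..<n} (\<lambda>_. range (\<lambda>a::real. {..a}))"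
      by blast
    from A have "\<forall>i<n. \<exists>a::real. A i = {..a}" by (simp add: Pi_iff image_iff)
    then obtain b where "\<forall>i<n. A i = {..b i}" by metis
    then have "Pi\<^sub>E {..<n} A = (\<Pi>\<^sub>E i\<in>{..<n}. {..b i})" by (intro PiE_cong) simp
    with X box have "X = (\<Pi>\<^sub>E i\<in>{..<n}. {..b i})" by simp
    then show "X \<in> ?E" by (simp only: in_E)
  next
    fix X assume "X \<in> ?E"
    then obtain b where "X = (\<Pi>\<^sub>E i\<in>{..<n}. {..b i})" by auto
    then have "X = {f \<in> ?\<Omega>. \<forall>i\<in>{..<n}. f i \<in> (\<lambda>i. {..b i}) i}" by (simp only: box)
    moreover have "(\<lambda>i. {..b i}) \<in> Pi {..<n} (\<lambda>_. range (\<lambda>a::real. {..a}))" by auto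
    ultimately show "X \<in> {{f \<in> ?\<Omega>. \<forall>i\<in>j. f i \<in> A i} | A j. j \<in> {{..<n}} \<and> A \<in> Pi j (\<lambda>_. range (\<lambda>a::real. {..a}))}"
      by (intro CollectI exI[of _ "\<lambda>i. {..b i}"] exI[of _ "{..<n}"] conjI) simp_all
  qed
  also have "sets (sigma ?\<Omega> ?E) = sigma_sets ?\<Omega> ?E" 
    by (rule sets_measure_of) (intro image_subsetI PowI PiE_mono, simp)
  finally have sets: "sets (\<Pi>\<^sub>M i\<in>{..<n}. (borel :: real measure)) = sigma_sets ?\<Omega> ?E" .
  show "sets P = sigma_sets ?\<Omega> ?E" "sets Q = sigma_sets ?\<Omega> ?E" using P Q sets by simp_all
  show "range (\<lambda>k::nat. \<Pi>\<^sub>E i\<in>{..<n}. {..real k}) \<subseteq> ?E"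
    by (rule image_subsetI) (rule in_E)
  show "(\<Union>k::nat. \<Pi>\<^sub>E i\<in>{..<n}. {..real k}) = ?\<Omega>"
  proof
    show "(\<Union>k::nat. \<Pi>\<^sub>E i\<in>{..<n}. {..real k}) \<subseteq> ?\<Omega>"
      by (intro UN_least PiE_mono) simp
  next
    show "?\<Omega> \<subseteq> (\<Union>k::nat. \<Pi>\<^sub>E i\<in>{..<n}. {..real k})"
    proof
      fix f assume f: "f \<in> ?\<Omega>"
      obtain k :: nat where k: "Max (insert 0 (f ` {..<n})) \<le> real k" using real_arch_simple by blast
      have "f i \<le> real k" if "i < n" for i
        using Max_ge[of "insert 0 (f ` {..<n})" "f i"] that k by simp
      then have "f \<in> (\<Pi>\<^sub>E i\<in>{..<n}. {..real k})" using f unfolding PiE_iff by simp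
      then show "f \<in> (\<Union>k::nat. \<Pi>\<^sub>E i\<in>{..<n}. {..real k})" by blast
    qed
  qed
  show "emeasure P (\<Pi>\<^sub>E i\<in>{..<n}. {..real k}) \<noteq> \<infinity>" for k :: nat by simp
qed

text \<open>Continuous functions that decrease to the indicator of the box below \<open>b\<close> as \<open>m\<close> grows. They
transfer almost sure convergence to an identity of laws.\<close>

definition box_cutoff :: "nat \<Rightarrow> (nat \<Rightarrow> real) \<Rightarrow> nat \<Rightarrow> (nat \<Rightarrow> real) \<Rightarrow> real" where
  "box_cutoff n b m y = (\<Prod>i<n. max 0 (min 1 (1 - real m * (y i - b i))))"

lemma box_cutoff_bounds: "0 \<le> box_cutoff n b m y" "box_cutoff n b m y \<le> 1"
  unfolding box_cutoff_def by (auto intro!: prod_nonneg prod_le_1)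

lemma measurable_box_cutoff [measurable]:
  "box_cutoff n b m \<in> borel_measurable (\<Pi>\<^sub>M i\<in>{..<n}. borel)"
  unfolding box_cutoff_def[abs_def] by measurable

lemma box_cutoff_tendsto:
  assumes "\<And>i. i < n \<Longrightarrow> (\<lambda>k. Y k i) \<longlonglongrightarrow> y i"
  shows "(\<lambda>k. box_cutoff n b m (Y k)) \<longlonglongrightarrow> box_cutoff n b m y"
  unfolding box_cutoff_def using assms
  by (intro tendsto_prod tendsto_max tendsto_min tendsto_diff tendsto_mult tendsto_const) simp

lemma box_cutoff_tendsto_indicator:
  assumes y: "y \<in> space (\<Pi>\<^sub>M i\<in>{..<n}. borel)"
  shows "(\<lambda>m. box_cutoff n b m y) \<longlonglongrightarrow> indicator (\<Pi>\<^sub>E i\<in>{..<n}. {..b i}) y"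
proof -
  have "(\<lambda>m. max 0 (min 1 (1 - real m * (y i - b i)))) \<longlonglongrightarrow> indicator {..b i} (y i)" for i
  proof (cases "y i \<le> b i")
    case True
    have "max 0 (min 1 (1 - real m * (y i - b i))) = 1" for m
      using True mult_nonneg_nonpos[of "real m" "y i - b i"] by (simp add: max_def min_def)
    then show ?thesis using True by simp
  next
    case False
    obtain m0 :: nat where m0: "1 / (y i - b i) \<le> real m0" using real_arch_simple by blast
    have "max 0 (min 1 (1 - real m * (y i - b i))) = 0" if "m \<ge> m0" for m
    proof -
      have "1 / (y i - b i) \<le> real m" using m0 that by simp
      then show ?thesis using False by (simp add: max_def min_def field_simps)
    qed
    then have "\<forall>\<^sub>F m in sequentially. max 0 (min 1 (1 - real m * (y i - b i))) = 0"
      unfolding eventually_sequentially by blast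
    then show ?thesis using False by (simp add: tendsto_eventually)
  qed
  then have "(\<lambda>m. box_cutoff n b m y) \<longlonglongrightarrow> (\<Prod>i<n. indicator {..b i} (y i))"
    unfolding box_cutoff_def by (intro tendsto_prod)
  also have "(\<Prod>i<n. indicator {..b i} (y i)) = (indicator (\<Pi>\<^sub>E i\<in>{..<n}. {..b i}) y :: real)"
    using y by (auto simp: indicator_def space_PiM PiE_iff prod.neutral)
  finally show ?thesis .
qed

lemma emeasure_box_eq_lim:
  assumes "prob_space P" and [measurable_cong]: "sets P = sets (\<Pi>\<^sub>M i\<in>{..<n}. borel)"
  shows "(\<lambda>m. \<integral>\<^sup>+y. ennreal (box_cutoff n b m y) \<partial>P) \<longlonglongrightarrow> emeasure P (\<Pi>\<^sub>E i\<in>{..<n}. {..b i})"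
proof -
  interpret prob_space P by fact
  have [measurable]: "(\<Pi>\<^sub>E i\<in>{..<n}. {..b i}) \<in> sets (\<Pi>\<^sub>M i\<in>{..<n}. borel)"
    by (intro sets_PiM_I_finite) auto
  have "(\<lambda>m. \<integral>\<^sup>+y. ennreal (box_cutoff n b m y) \<partial>P) \<longlonglongrightarrow> (\<integral>\<^sup>+y. indicator (\<Pi>\<^sub>E i\<in>{..<n}. {..b i}) y \<partial>P)"
  proof (rule nn_integral_dominated_convergence[where w = "\<lambda>_. 1"])
    show "AE y in P. (\<lambda>m. ennreal (box_cutoff n b m y)) \<longlonglongrightarrow> indicator (\<Pi>\<^sub>E i\<in>{..<n}. {..b i}) y"
    proof (rule AE_I2)
      fix y assume "y \<in> space P"
      then have "y \<in> space (\<Pi>\<^sub>M i\<in>{..<n}. (borel :: real measure))"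
        using sets_eq_imp_space_eq[OF assms(2)] by simp
      from tendsto_ennrealI[OF box_cutoff_tendsto_indicator[OF this]]
      show "(\<lambda>m. ennreal (box_cutoff n b m y)) \<longlonglongrightarrow> indicator (\<Pi>\<^sub>E i\<in>{..<n}. {..b i}) y"
        by (simp add: ennreal_indicator)
    qed
  qed (auto simp: box_cutoff_bounds emeasure_space_1)
  then show ?thesis by (simp add: assms(2))
qed

context stick_breaking
begin

context
  fixes n :: nat and C :: "nat \<Rightarrow> real set"
  assumes C [measurable]: "\<And>i. i \<le> n \<Longrightarrow> C i \<in> sets borel"
    and disjoint: "disjoint_family_on C {..n}" and cover: "(\<Union>i\<le>n. C i) = UNIV"
begin

lemma measurable_cell [measurable]: "i \<in> {..<n} \<Longrightarrow> C i \<in> sets borel"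
  using C[of i] by simp

text \<open>The effect of breaking off the first stick on the vector of cell masses \<open>y\<close> of the rest.\<close>

definition push :: "real \<times> real \<Rightarrow> (nat \<Rightarrow> real) \<Rightarrow> nat \<Rightarrow> real" where
  "push s y = (\<lambda>i\<in>{..<n}. fst s * indicator (C i) (snd s) + (1 - fst s) * y i)"

text \<open>Cell masses after \<open>k\<close> steps, when the unbroken remainder is distributed over the cells according
to \<open>y\<close>. If \<open>y\<close> has the Dirichlet law then so has this vector, for every \<open>k\<close>, and it converges to
the cell masses of the stick-breaking measure whatever \<open>y\<close> is.\<close>

definition partial :: "nat \<Rightarrow> (nat \<Rightarrow> real \<times> real) \<Rightarrow> (nat \<Rightarrow> real) \<Rightarrow> nat \<Rightarrow> real" where
  "partial k \<omega> y = (\<lambda>i\<in>{..<n}. (\<Sum>j<k. weight \<omega> j * indicator (C i) (snd (\<omega> j))) + remaining \<omega> k * y i)"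

lemma measurable_push [measurable]:
  assumes [measurable]: "f \<in> M \<rightarrow>\<^sub>M borel \<Otimes>\<^sub>M borel" "h \<in> M \<rightarrow>\<^sub>M (\<Pi>\<^sub>M i\<in>{..<n}. borel)"
  shows "(\<lambda>x. push (f x) (h x)) \<in> M \<rightarrow>\<^sub>M (\<Pi>\<^sub>M i\<in>{..<n}. borel)"
  unfolding push_def by measurable

lemma measurable_partial [measurable]:
  assumes [measurable]: "f \<in> M \<rightarrow>\<^sub>M breaks" "h \<in> M \<rightarrow>\<^sub>M (\<Pi>\<^sub>M i\<in>{..<n}. borel)"
  shows "(\<lambda>x. partial k (f x) (h x)) \<in> M \<rightarrow>\<^sub>M (\<Pi>\<^sub>M i\<in>{..<n}. borel)"
proof -
  have [measurable]: "(\<lambda>x. weight (f x) j) \<in> borel_measurable M" "(\<lambda>x. remaining (f x) j) \<in> borel_measurable M"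
    "(\<lambda>x. f x j) \<in> M \<rightarrow>\<^sub>M borel \<Otimes>\<^sub>M borel" for j
    using measurable_compose[OF assms(1) measurable_weight] measurable_compose[OF assms(1) measurable_remaining]
      measurable_compose[OF assms(1) measurable_breaks_component] by auto
  show ?thesis unfolding partial_def by measurable
qed

lemma partial_Suc: "partial (Suc k) (case_nat s \<omega>) y = push s (partial k \<omega> y)"
proof -
  have "(\<Sum>j<Suc k. weight (case_nat s \<omega>) j * indicator (C i) (snd (case_nat s \<omega> j))) =
      fst s * indicator (C i) (snd s) + (1 - fst s) * (\<Sum>j<k. weight \<omega> j * indicator (C i) (snd (\<omega> j)))" for i
    by (simp only: sum.lessThan_Suc_shift weight_case_nat sum_distrib_left mult.assoc nat.case)
  then show ?thesis
    unfolding partial_def push_def remaining_case_nat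
    by (intro restrict_ext) (simp only: distrib_left add.assoc mult.assoc restrict_apply' if_True)
qed

abbreviation cells_law :: "(nat \<Rightarrow> real) measure" where
  "cells_law \<equiv> dirichlet_law n (\<lambda>i. measure \<alpha> (C i))"

lemma sum_measure_cells: "(\<Sum>i\<le>n. measure \<alpha> (C i)) = 1"
proof -
  have "C ` {..n} \<subseteq> sets \<alpha>" using C by auto
  then have "measure \<alpha> (\<Union>i\<le>n. C i) = (\<Sum>i\<le>n. measure \<alpha> (C i))"
    using disjoint by (intro finite_measure_finite_Union) auto
  then show ?thesis using cover prob_space by simp
qed

lemma prob_space_cells_law: "prob_space cells_law"
  by (rule prob_space_dirichlet_law) simp

lemma nn_integral_cells:
  assumes "\<And>i x. i \<le> n \<Longrightarrow> x \<in> C i \<Longrightarrow> f x = c i"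
  shows "(\<integral>\<^sup>+x. f x \<partial>\<alpha>) = (\<Sum>i\<le>n. ennreal (measure \<alpha> (C i)) * c i)"
proof -
  have "(\<integral>\<^sup>+x. f x \<partial>\<alpha>) = (\<integral>\<^sup>+x. (\<Sum>i\<le>n. c i * indicator (C i) x) \<partial>\<alpha>)"
  proof (rule nn_integral_cong)
    fix x :: real
    obtain i where i: "i \<le> n" "x \<in> C i" using cover by auto
    have "(\<Sum>j\<le>n. c j * indicator (C j) x) = (\<Sum>j\<in>{i}. c j * indicator (C j) x)"
      using i disjoint by (intro sum.mono_neutral_right) (auto simp: disjoint_family_on_def indicator_def)
    then show "f x = (\<Sum>j\<le>n. c j * indicator (C j) x)" using i assms by simp
  qed
  also have "\<dots> = (\<Sum>i\<le>n. \<integral>\<^sup>+x. c i * indicator (C i) x \<partial>\<alpha>)"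
    by (rule nn_integral_sum) (use C in \<open>auto intro!: borel_measurable_times_ennreal borel_measurable_indicator simp: sets_base\<close>)
  also have "\<dots> = (\<Sum>i\<le>n. ennreal (measure \<alpha> (C i)) * c i)"
    using C by (intro sum.cong refl) (simp add: nn_integral_cmult_indicator emeasure_eq_measure mult.commute)
  finally show ?thesis .
qed

text \<open>\<open>dirichlet_law_self_similar\<close> with the random vertex realized as the cell that contains the location
of the first stick.\<close>

lemma nn_integral_push:
  assumes [measurable]: "g \<in> borel_measurable (\<Pi>\<^sub>M i\<in>{..<n}. borel)"
  shows "(\<integral>\<^sup>+s. (\<integral>\<^sup>+y. g (push s y) \<partial>cells_law) \<partial>break_law) = (\<integral>\<^sup>+y. g y \<partial>cells_law)"
proof -
  interpret L: prob_space cells_law by (rule prob_space_cells_law)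
  have "(\<integral>\<^sup>+s. (\<integral>\<^sup>+y. g (push s y) \<partial>cells_law) \<partial>break_law) =
    (\<integral>\<^sup>+v. indicator {0<..<1} v * (\<integral>\<^sup>+x. (\<integral>\<^sup>+y. g (push (v, x) y) \<partial>cells_law) \<partial>\<alpha>) \<partial>lborel)"
    by (rule nn_integral_break_law) measurable
  also have "\<dots> = (\<integral>\<^sup>+v. (\<Sum>j\<le>n. ennreal (measure \<alpha> (C j)) *
      (indicator {0<..<1} v * (\<integral>\<^sup>+y. g (mix n j v y) \<partial>cells_law))) \<partial>lborel)"
  proof (rule nn_integral_cong)
    fix v :: real
    have "(\<integral>\<^sup>+x. (\<integral>\<^sup>+y. g (push (v, x) y) \<partial>cells_law) \<partial>\<alpha>) =
      (\<Sum>j\<le>n. ennreal (measure \<alpha> (C j)) * (\<integral>\<^sup>+y. g (mix n j v y) \<partial>cells_law))"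
    proof (rule nn_integral_cells)
      fix j x assume j: "j \<le> n" "x \<in> C j"
      have "x \<in> C i \<longleftrightarrow> i = j" if "i < n" for i
        using j that disjoint_family_onD[OF disjoint, of i j] by (cases "i = j") auto
      then have "push (v, x) y = mix n j v y" for y
        unfolding push_def mix_def by (intro restrict_ext) (auto simp: indicator_def)
      then show "(\<integral>\<^sup>+y. g (push (v, x) y) \<partial>cells_law) = (\<integral>\<^sup>+y. g (mix n j v y) \<partial>cells_law)" by simp
    qed
    then show "indicator {0<..<1} v * (\<integral>\<^sup>+x. (\<integral>\<^sup>+y. g (push (v, x) y) \<partial>cells_law) \<partial>\<alpha>) =
      (\<Sum>j\<le>n. ennreal (measure \<alpha> (C j)) * (indicator {0<..<1} v * (\<integral>\<^sup>+y. g (mix n j v y) \<partial>cells_law)))"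
      by (simp add: sum_distrib_left mult_ac)
  qed
  also have "\<dots> = (\<Sum>j\<le>n. ennreal (measure \<alpha> (C j)) *
      (\<integral>\<^sup>+v. indicator {0<..<1} v * (\<integral>\<^sup>+y. g (mix n j v y) \<partial>cells_law) \<partial>lborel))"
    by (subst nn_integral_sum, measurable) (intro sum.cong refl nn_integral_cmult, measurable)
  also have "\<dots> = (\<integral>\<^sup>+y. g y \<partial>cells_law)"
    by (rule dirichlet_law_self_similar[symmetric]) (auto simp: sum_measure_cells)
  finally show ?thesis .
qed

lemma nn_integral_partial:
  assumes "g \<in> borel_measurable (\<Pi>\<^sub>M i\<in>{..<n}. borel)"
  shows "(\<integral>\<^sup>+\<omega>. (\<integral>\<^sup>+y. g (partial k \<omega> y) \<partial>cells_law) \<partial>breaks) = (\<integral>\<^sup>+y. g y \<partial>cells_law)"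
  using assms
proof (induction k arbitrary: g)
  case (0 g)
  have "(\<integral>\<^sup>+y. g (partial 0 \<omega> y) \<partial>cells_law) = (\<integral>\<^sup>+y. g y \<partial>cells_law)" for \<omega>
  proof (rule nn_integral_cong)
    fix y assume "y \<in> space cells_law"
    then have "y \<in> extensional {..<n}"
      using sets_eq_imp_space_eq[OF sets_dirichlet_law] by (auto simp: space_PiM PiE_iff)
    then have "partial 0 \<omega> y = y"
      unfolding partial_def by (intro extensionalityI[of _ "{..<n}"]) (auto simp: remaining_def)
    then show "g (partial 0 \<omega> y) = g y" by simp
  qed
  then show ?case by (simp add: breaks.emeasure_space_1)
next
  case (Suc k g)
  note [measurable] = Suc.prems
  interpret L: prob_space cells_law by (rule prob_space_cells_law)
  have "(\<integral>\<^sup>+\<omega>. (\<integral>\<^sup>+y. g (partial (Suc k) \<omega> y) \<partial>cells_law) \<partial>breaks) =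
    (\<integral>\<^sup>+s. (\<integral>\<^sup>+\<omega>. (\<integral>\<^sup>+y. g (push s (partial k \<omega> y)) \<partial>cells_law) \<partial>breaks) \<partial>break_law)"
    by (subst nn_integral_breaks) (simp_all add: partial_Suc)
  also have "\<dots> = (\<integral>\<^sup>+s. (\<integral>\<^sup>+y. g (push s y) \<partial>cells_law) \<partial>break_law)"
  proof (rule nn_integral_cong)
    fix s :: "real \<times> real"
    have "(\<lambda>y. push s y) \<in> (\<Pi>\<^sub>M i\<in>{..<n}. borel) \<rightarrow>\<^sub>M (\<Pi>\<^sub>M i\<in>{..<n}. borel)"
      by (rule measurable_push) (simp_all add: space_pair_measure)
    from measurable_compose[OF this Suc.prems]
    show "(\<integral>\<^sup>+\<omega>. (\<integral>\<^sup>+y. g (push s (partial k \<omega> y)) \<partial>cells_law) \<partial>breaks) = (\<integral>\<^sup>+y. g (push s y) \<partial>cells_law)"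
      by (rule Suc.IH)
  qed
  also have "\<dots> = (\<integral>\<^sup>+y. g y \<partial>cells_law)" by (rule nn_integral_push) fact
  finally show ?case .
qed

text \<open>The laws of \<open>partial k\<close> do not change with \<open>k\<close>, and \<open>partial k\<close> converges almost surely to the vector
of cell masses; hence the limit has the same law.\<close>

lemma distr_stick_measure_cells:
  "distr breaks (\<Pi>\<^sub>M i\<in>{..<n}. borel) (\<lambda>\<omega>. \<lambda>i\<in>{..<n}. measure (stick_measure \<omega>) (C i)) = cells_law"
  (is "distr _ _ ?\<Phi> = _")
proof (rule prob_space_eqI_boxes[where n = n])
  interpret L: prob_space cells_law by (rule prob_space_cells_law)
  have [measurable]: "?\<Phi> \<in> breaks \<rightarrow>\<^sub>M (\<Pi>\<^sub>M i\<in>{..<n}. borel)"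
    using C by (intro measurable_restrict measurable_compose[OF measurable_stick_measure]
        measurable_measure_prob_algebra) auto
  let ?P = "distr breaks (\<Pi>\<^sub>M i\<in>{..<n}. borel) ?\<Phi>"
  show P: "prob_space ?P" by (rule breaks.prob_space_distr) measurable
  have key: "(\<integral>\<^sup>+y. ennreal (box_cutoff n b m y) \<partial>?P) = (\<integral>\<^sup>+y. ennreal (box_cutoff n b m y) \<partial>cells_law)" for b m
  proof -
    let ?g = "\<lambda>y. ennreal (box_cutoff n b m y)"
    have "(\<lambda>k. \<integral>\<^sup>+\<omega>. (\<integral>\<^sup>+y. ?g (partial k \<omega> y) \<partial>cells_law) \<partial>breaks) \<longlonglongrightarrow>
        (\<integral>\<^sup>+\<omega>. (\<integral>\<^sup>+y. ?g (?\<Phi> \<omega>) \<partial>cells_law) \<partial>breaks)"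
    proof (rule nn_integral_dominated_convergence[where w = "\<lambda>_. 1"])
      show "AE \<omega> in breaks. (\<integral>\<^sup>+y. ?g (partial k \<omega> y) \<partial>cells_law) \<le> 1" for k
        by (rule AE_I2, rule L.nn_integral_le_const) (auto simp: box_cutoff_bounds)
      show "AE \<omega> in breaks. (\<lambda>k. \<integral>\<^sup>+y. ?g (partial k \<omega> y) \<partial>cells_law) \<longlonglongrightarrow> (\<integral>\<^sup>+y. ?g (?\<Phi> \<omega>) \<partial>cells_law)"
        using AE_measure_stick_measure AE_remaining_tendsto AE_space
      proof eventually_elim
        case (elim \<omega>)
        note [measurable] = elim(3)
        show ?case
        proof (rule nn_integral_dominated_convergence[where w = "\<lambda>_. 1"])
          show "AE y in cells_law. (\<lambda>k. ?g (partial k \<omega> y)) \<longlonglongrightarrow> ?g (?\<Phi> \<omega>)"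
          proof (rule AE_I2, rule tendsto_ennrealI, rule box_cutoff_tendsto)
            fix y i assume i: "i < n"
            have "(\<lambda>k. (\<Sum>j<k. weight \<omega> j * indicator (C i) (snd (\<omega> j))) + remaining \<omega> k * y i)
              \<longlonglongrightarrow> measure (stick_measure \<omega>) (C i) + 0 * y i"
              using elim(1)[rule_format, OF C[of i]] elim(2) i unfolding sums_def by (intro tendsto_intros) auto
            then show "(\<lambda>k. partial k \<omega> y i) \<longlonglongrightarrow> ?\<Phi> \<omega> i" using i by (simp add: partial_def)
          qed
        qed (auto simp: box_cutoff_bounds L.emeasure_space_1 intro!: AE_I2)
      qed
    qed (auto simp: breaks.emeasure_space_1)
    also have "(\<integral>\<^sup>+\<omega>. (\<integral>\<^sup>+y. ?g (?\<Phi> \<omega>) \<partial>cells_law) \<partial>breaks) = (\<integral>\<^sup>+y. ?g y \<partial>?P)"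
      by (simp add: nn_integral_distr L.emeasure_space_1)
    finally show ?thesis
      by (subst (asm) nn_integral_partial) (auto dest: LIMSEQ_unique[OF tendsto_const])
  qed
  show "emeasure ?P (\<Pi>\<^sub>E i\<in>{..<n}. {..b i}) = emeasure cells_law (\<Pi>\<^sub>E i\<in>{..<n}. {..b i})" for b
    using LIMSEQ_unique[OF emeasure_box_eq_lim[OF P, of n b, unfolded key] emeasure_box_eq_lim[OF prob_space_cells_law, of n b]]
    by simp
qed simp_all

end

lemma is_dirichlet_process_law_stick:
  "is_dirichlet_process_law \<alpha> (distr breaks (prob_algebra borel) stick_measure)"
  unfolding is_dirichlet_process_law_def
proof (intro conjI allI impI)
  show "distr breaks (prob_algebra borel) stick_measure \<in> space (prob_algebra (prob_algebra borel))"
    unfolding space_prob_algebra using breaks.prob_space_distr[OF measurable_stick_measure] by simp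
next
  fix n :: nat and C :: "nat \<Rightarrow> real set"
  assume *: "(\<forall>i\<le>n. C i \<in> sets borel) \<and> disjoint_family_on C {..n} \<and> (\<Union>i\<le>n. C i) = UNIV"
  have "(\<lambda>\<phi>. \<lambda>i\<in>{..<n}. measure \<phi> (C i)) \<in> prob_algebra borel \<rightarrow>\<^sub>M (\<Pi>\<^sub>M i\<in>{..<n}. borel)"
    by (rule measurable_restrict, rule measurable_measure_prob_algebra) (simp add: *)
  from distr_distr[OF this measurable_stick_measure] distr_stick_measure_cells[of n C] *
  show "distr (distr breaks (prob_algebra borel) stick_measure) (\<Pi>\<^sub>M i\<in>{..<n}. borel)
      (\<lambda>\<phi>. \<lambda>i\<in>{..<n}. measure \<phi> (C i)) = dirichlet_law n (\<lambda>i. measure \<alpha> (C i))"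
    by (simp only: comp_def)
qed

end

section \<open>Uniqueness of the Dirichlet process\<close>

lemma measurable_evaluations:
  "(\<lambda>\<phi>. \<lambda>A\<in>sets borel. measure \<phi> A) \<in> prob_algebra (borel :: real measure) \<rightarrow>\<^sub>M (\<Pi>\<^sub>M A\<in>sets borel. borel)"
  by (rule measurable_restrict, rule measurable_measure_prob_algebra)

text \<open>The evaluations at Borel sets generate the \<open>\<sigma>\<close>-algebra on probability measures, so every
measurable set is pulled back from the product space that they map into.\<close>

lemma sets_prob_algebra_borel_evaluations:
  assumes X: "X \<in> sets (prob_algebra (borel :: real measure))"
  obtains Y where "Y \<in> sets (\<Pi>\<^sub>M A\<in>sets (borel :: real measure). (borel :: real measure))"
    "X = (\<lambda>\<phi>. \<lambda>A\<in>sets borel. measure \<phi> A) -` Y \<inter> space (prob_algebra borel)"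
proof -
  let ?S = "space (prob_algebra (borel :: real measure))"
  let ?E = "\<lambda>\<phi>. \<lambda>A\<in>sets (borel :: real measure). measure \<phi> A"
  let ?P = "\<Pi>\<^sub>M A\<in>sets (borel :: real measure). (borel :: real measure)"
  let ?V = "vimage_algebra ?S ?E ?P"
  have E: "?E \<in> ?S \<rightarrow> space ?P" by (simp add: space_PiM)
  have "(\<lambda>\<phi>. \<phi>) \<in> ?V \<rightarrow>\<^sub>M prob_algebra borel"
  proof (rule measurable_prob_algebraI)
    show "prob_space \<phi>" if "\<phi> \<in> space ?V" for \<phi>
      using that by (simp add: space_prob_algebra)
    show "(\<lambda>\<phi>. \<phi>) \<in> ?V \<rightarrow>\<^sub>M subprob_algebra borel"
    proof (rule measurable_subprob_algebra)
      fix \<phi> assume "\<phi> \<in> space ?V"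
      then show "subprob_space \<phi>" "sets \<phi> = sets borel"
        by (simp_all add: space_prob_algebra prob_space_imp_subprob_space)
    next
      fix A :: "real set" assume A: "A \<in> sets borel"
      have "(\<lambda>\<phi>. ennreal (?E \<phi> A)) \<in> borel_measurable ?V"
        using measurable_compose[OF measurable_vimage_algebra1[OF E] measurable_component_singleton[OF A]]
        by (rule measurable_compose) (rule measurable_ennreal)
      also have "(\<lambda>\<phi>. ennreal (?E \<phi> A)) \<in> borel_measurable ?V \<longleftrightarrow> (\<lambda>\<phi>. emeasure \<phi> A) \<in> borel_measurable ?V"
      proof (rule measurable_cong)
        fix \<phi> assume "\<phi> \<in> space ?V"
        then interpret prob_space \<phi> by (simp add: space_prob_algebra)
        show "ennreal (?E \<phi> A) = emeasure \<phi> A" using A by (simp add: emeasure_eq_measure)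
      qed
      finally show "(\<lambda>\<phi>. emeasure \<phi> A) \<in> borel_measurable ?V" .
    qed
  qed
  from measurable_sets[OF this X] have "X \<inter> ?S \<in> sets ?V" by (simp add: vimage_def Int_def)
  moreover have "X \<inter> ?S = X" using sets.sets_into_space[OF X] by auto
  ultimately have "X \<in> sets ?V" by simp
  then show ?thesis unfolding sets_vimage_algebra2[OF E] using that by blast
qed

text \<open>The atoms of the algebra generated by \<open>B 0, \<dots>, B (k - 1)\<close>. The binary digits of \<open>m\<close> say which sets
an atom lies in. Index \<open>2 ^ k\<close> gives the empty set: as the last cell of a partition carries no
coordinate in the Dirichlet distribution, an empty last cell lets all atoms be recorded.\<close>

definition atom_of :: "nat \<Rightarrow> (nat \<Rightarrow> 'a set) \<Rightarrow> nat \<Rightarrow> 'a set" where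
  "atom_of k B m = (if m < 2 ^ k then {x. \<forall>i<k. x \<in> B i \<longleftrightarrow> bit m i} else {})"

lemma atom_of_sets: "(\<And>i. i < k \<Longrightarrow> B i \<in> sets borel) \<Longrightarrow> atom_of k B m \<in> sets borel"
proof -
  assume B: "\<And>i. i < k \<Longrightarrow> B i \<in> sets borel"
  have "{x. \<forall>i<k. x \<in> B i \<longleftrightarrow> bit m i} = (\<Inter>i\<in>{..<k}. if bit m i then B i else - B i)" by auto
  also have "\<dots> \<in> sets borel"
  proof (cases "k = 0")
    case False
    then show ?thesis using B by (intro sets.finite_INT) auto
  qed simp
  finally have "{x. \<forall>i<k. x \<in> B i \<longleftrightarrow> bit m i} \<in> sets borel" .
  then show ?thesis unfolding atom_of_def using sets.empty_sets by (rule if_split[where P = "\<lambda>X. X \<in> sets borel", THEN iffD2, OF conjI[OF impI impI]])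
qed

lemma disjoint_atoms: "disjoint_family_on (atom_of k B) I"
proof (unfold disjoint_family_on_def, intro ballI impI)
  fix m m' :: nat assume neq: "m \<noteq> m'"
  show "atom_of k B m \<inter> atom_of k B m' = {}"
  proof (rule ccontr)
    assume "atom_of k B m \<inter> atom_of k B m' \<noteq> {}"
    then obtain x where "x \<in> atom_of k B m" "x \<in> atom_of k B m'" by blast
    then have m: "m < 2 ^ k" "m' < 2 ^ k" and bits: "\<forall>i<k. bit m i \<longleftrightarrow> bit m' i"
      by (auto simp: atom_of_def split: if_splits)
    have "take_bit k m = take_bit k m'"
      using bits by (intro bit_eqI) (auto simp: bit_take_bit_iff)
    then show False using m neq by (simp add: take_bit_nat_eq_self)
  qed
qed

lemma union_atoms: "(\<Union>m\<le>2 ^ k. atom_of k B m) = UNIV"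
proof (intro set_eqI iffI UNIV_I)
  fix x
  define m where "m = (horner_sum of_bool 2 (map (\<lambda>i. x \<in> B i) [0..<k]) :: nat)"
  have "m < 2 ^ k" using horner_sum_of_bool_2_less[of "map (\<lambda>i. x \<in> B i) [0..<k]", where 'a = nat] by (simp add: m_def)
  moreover have "bit m i \<longleftrightarrow> x \<in> B i" if "i < k" for i
    using that unfolding m_def by (subst bit_horner_sum_bit_iff) simp
  ultimately show "x \<in> (\<Union>m\<le>2 ^ k. atom_of k B m)" by (auto simp: atom_of_def intro!: bexI[of _ m])
qed

lemma set_eq_union_atoms:
  assumes "i < k"
  shows "B i = (\<Union>m\<in>{m. m < 2 ^ k \<and> bit m i}. atom_of k B m)"
proof (intro set_eqI iffI)
  fix x assume x: "x \<in> B i"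
  obtain m where m: "m \<le> 2 ^ k" "x \<in> atom_of k B m" using union_atoms[of k B] by blast
  then have "m < 2 ^ k" "bit m i" using x assms by (auto simp: atom_of_def split: if_splits)
  with m show "x \<in> (\<Union>m\<in>{m. m < 2 ^ k \<and> bit m i}. atom_of k B m)" by blast
qed (use assms in \<open>auto simp: atom_of_def split: if_splits\<close>)

text \<open>Evaluations at finitely many Borel sets are sums of the masses of their atoms, so their joint law
is an image of a law along a partition. Such joint laws determine the measure on the product space
of all evaluations.\<close>

lemma prob_algebra_measure_eqI:
  fixes D D' :: "real measure measure"
  assumes D: "D \<in> space (prob_algebra (prob_algebra borel))" "D' \<in> space (prob_algebra (prob_algebra borel))"
    and eq: "\<And>n (C :: nat \<Rightarrow> real set). (\<forall>i\<le>n. C i \<in> sets borel) \<Longrightarrow> disjoint_family_on C {..n} \<Longrightarrow>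
      (\<Union>i\<le>n. C i) = UNIV \<Longrightarrow>
      distr D (\<Pi>\<^sub>M i\<in>{..<n}. borel) (\<lambda>\<phi>. \<lambda>i\<in>{..<n}. measure \<phi> (C i)) =
      distr D' (\<Pi>\<^sub>M i\<in>{..<n}. borel) (\<lambda>\<phi>. \<lambda>i\<in>{..<n}. measure \<phi> (C i))"
  shows "D = D'"
proof -
  let ?S = "space (prob_algebra (borel :: real measure))"
  let ?E = "\<lambda>\<phi>. \<lambda>A\<in>sets (borel :: real measure). measure \<phi> A"
  let ?P = "\<Pi>\<^sub>M A\<in>sets (borel :: real measure). (borel :: real measure)"
  have sets: "sets D = sets (prob_algebra borel)" "sets D' = sets (prob_algebra borel)"
    using D by (simp_all add: space_prob_algebra)
  note space = sets[THEN sets_eq_imp_space_eq]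
  interpret D: prob_space D using D by (simp add: space_prob_algebra)
  have E: "?E \<in> D \<rightarrow>\<^sub>M ?P" "?E \<in> D' \<rightarrow>\<^sub>M ?P"
    using measurable_evaluations by (simp_all add: measurable_cong_sets[OF sets(1) refl] measurable_cong_sets[OF sets(2) refl])
  have "distr D ?P ?E = distr D' ?P ?E"
  proof (rule measure_eqI_PiM_infinite)
    fix A J assume J: "finite J" "J \<subseteq> sets (borel :: real measure)"
      and A: "\<And>i. i \<in> J \<Longrightarrow> A i \<in> sets (borel :: real measure)"
    obtain B where B: "bij_betw B {..<card J} J"
      using ex_bij_betw_nat_finite[OF J(1)] by (auto simp: atLeast0LessThan)
    define k where "k = card J"
    define n where "n = (2::nat) ^ k"
    let ?C = "atom_of k B"
    let ?V = "\<lambda>\<phi>. \<lambda>i\<in>{..<n}. measure \<phi> (?C i)"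
    have BJ: "B ` {..<k} = J" using B by (simp add: bij_betw_def k_def)
    then have Bs: "B i \<in> sets borel" if "i < k" for i using J(2) that by auto
    then have Cs: "?C m \<in> sets borel" for m by (rule atom_of_sets)
    \<comment> \<open>The event in terms of the coordinates of atoms: \<open>B i\<close> is the union of the atoms with binary digit \<open>i\<close> set.\<close>
    let ?Z = "{y \<in> space (\<Pi>\<^sub>M i\<in>{..<n}. (borel :: real measure)). \<forall>i\<in>{..<k}. (\<Sum>m\<in>{m. m < n \<and> bit m i}. y m) \<in> A (B i)}"
    have Z: "?Z \<in> sets (\<Pi>\<^sub>M i\<in>{..<n}. (borel :: real measure))"
    proof (rule sets.sets_Collect_finite_All)
      fix i assume "i \<in> {..<k}"
      then have AB: "A (B i) \<in> sets borel" using A BJ by auto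
      have "(\<lambda>y. \<Sum>m\<in>{m. m < n \<and> bit m i}. y m) \<in> borel_measurable (\<Pi>\<^sub>M i\<in>{..<n}. (borel :: real measure))"
        by (intro borel_measurable_sum measurable_component_singleton) simp
      from measurable_sets[OF this AB]
      show "{y \<in> space (\<Pi>\<^sub>M i\<in>{..<n}. (borel :: real measure)). (\<Sum>m\<in>{m. m < n \<and> bit m i}. y m) \<in> A (B i)}
        \<in> sets (\<Pi>\<^sub>M i\<in>{..<n}. (borel :: real measure))"
        unfolding vimage_def Int_def mem_Collect_eq by (subst conj_commute)
    qed simp
    have pre: "?E -` prod_emb (sets borel) (\<lambda>_. borel) J (Pi\<^sub>E J A) \<inter> ?S = ?V -` ?Z \<inter> ?S"
    proof (intro set_eqI)
      fix \<phi> :: "real measure"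
      show "\<phi> \<in> ?E -` prod_emb (sets borel) (\<lambda>_. borel) J (Pi\<^sub>E J A) \<inter> ?S \<longleftrightarrow> \<phi> \<in> ?V -` ?Z \<inter> ?S"
      proof (cases "\<phi> \<in> ?S")
        case True
        then interpret \<phi>: prob_space \<phi> by (simp add: space_prob_algebra)
        have s: "sets \<phi> = sets borel" using True by (simp add: space_prob_algebra)
        have sum: "measure \<phi> (B i) = (\<Sum>m\<in>{m. m < n \<and> bit m i}. measure \<phi> (?C m))" if "i < k" for i
        proof -
          have "?C ` {m. m < n \<and> bit m i} \<subseteq> sets \<phi>" using Cs s by auto
          then show ?thesis
            by (subst set_eq_union_atoms[OF that], subst \<phi>.finite_measure_finite_Union)
              (auto simp: n_def disjoint_atoms)
        qed
        have "\<phi> \<in> ?E -` prod_emb (sets borel) (\<lambda>_. borel) J (Pi\<^sub>E J A) \<inter> ?S \<longleftrightarrow> (\<forall>C\<in>J. measure \<phi> C \<in> A C)"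
          using True J(2) by (auto simp: prod_emb_def PiE_iff)
        also have "\<dots> \<longleftrightarrow> (\<forall>i\<in>{..<k}. measure \<phi> (B i) \<in> A (B i))" unfolding BJ[symmetric] by simp
        also have "\<dots> \<longleftrightarrow> (\<forall>i\<in>{..<k}. (\<Sum>m\<in>{m. m < n \<and> bit m i}. ?V \<phi> m) \<in> A (B i))"
          using sum by (intro ball_cong refl) simp
        also have "\<dots> \<longleftrightarrow> \<phi> \<in> ?V -` ?Z \<inter> ?S" using True by (simp add: space_PiM)
        finally show ?thesis .
      qed simp
    qed
    have V: "?V \<in> prob_algebra borel \<rightarrow>\<^sub>M (\<Pi>\<^sub>M i\<in>{..<n}. borel)"
      by (rule measurable_restrict, rule measurable_measure_prob_algebra) (rule Cs)
    then have V': "?V \<in> D \<rightarrow>\<^sub>M (\<Pi>\<^sub>M i\<in>{..<n}. borel)" "?V \<in> D' \<rightarrow>\<^sub>M (\<Pi>\<^sub>M i\<in>{..<n}. borel)"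
      by (simp_all add: measurable_cong_sets[OF sets(1) refl] measurable_cong_sets[OF sets(2) refl])
    have X: "prod_emb (sets borel) (\<lambda>_. borel) J (Pi\<^sub>E J A) \<in> sets ?P"
      using J A by (intro sets_PiM_I) auto
    have "distr D (\<Pi>\<^sub>M i\<in>{..<n}. borel) ?V = distr D' (\<Pi>\<^sub>M i\<in>{..<n}. borel) ?V"
      using Cs by (intro eq) (simp_all add: disjoint_atoms union_atoms n_def)
    then have "emeasure D (?V -` ?Z \<inter> ?S) = emeasure D' (?V -` ?Z \<inter> ?S)"
      using emeasure_distr[OF V'(1) Z] emeasure_distr[OF V'(2) Z] by (simp only: space)
    then show "emeasure (distr D ?P ?E) (prod_emb (sets borel) (\<lambda>_. borel) J (Pi\<^sub>E J A)) =
      emeasure (distr D' ?P ?E) (prod_emb (sets borel) (\<lambda>_. borel) J (Pi\<^sub>E J A))"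
      by (simp only: emeasure_distr[OF E(1) X] emeasure_distr[OF E(2) X] space pre)
  next
    show "finite_measure (distr D ?P ?E)"
      using D.prob_space_distr[OF E(1)] by (rule prob_space.finite_measure)
  qed simp_all
  then have *: "emeasure D (?E -` Y \<inter> ?S) = emeasure D' (?E -` Y \<inter> ?S)" if "Y \<in> sets ?P" for Y
    using emeasure_distr[OF E(1) that] emeasure_distr[OF E(2) that] by (simp only: space)
  show "D = D'"
  proof (rule measure_eqI)
    show "sets D = sets D'" using sets by simp
    fix X assume "X \<in> sets D"
    then have "X \<in> sets (prob_algebra borel)" using sets by simp
    then obtain Y where "Y \<in> sets ?P" "X = ?E -` Y \<inter> ?S"
      by (rule sets_prob_algebra_borel_evaluations)
    then show "emeasure D X = emeasure D' X" using * by simp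
  qed
qed

lemma (in stick_breaking) dirichlet_process_law_eq:
  "dirichlet_process_law \<alpha> = distr breaks (prob_algebra borel) stick_measure"
  unfolding dirichlet_process_law_def
proof (rule the_equality)
  show "is_dirichlet_process_law \<alpha> (distr breaks (prob_algebra borel) stick_measure)"
    by (rule is_dirichlet_process_law_stick)
next
  fix D assume D: "is_dirichlet_process_law \<alpha> D"
  show "D = distr breaks (prob_algebra borel) stick_measure"
  proof (rule prob_algebra_measure_eqI)
    show "D \<in> space (prob_algebra (prob_algebra borel))"
      using D unfolding is_dirichlet_process_law_def by (rule conjunct1)
    show "distr breaks (prob_algebra borel) stick_measure \<in> space (prob_algebra (prob_algebra borel))"
      using is_dirichlet_process_law_stick unfolding is_dirichlet_process_law_def by (rule conjunct1)
  next
    fix n :: nat and C :: "nat \<Rightarrow> real set"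
    assume C: "\<forall>i\<le>n. C i \<in> sets borel" "disjoint_family_on C {..n}" "(\<Union>i\<le>n. C i) = UNIV"
    have "distr D' (\<Pi>\<^sub>M i\<in>{..<n}. borel) (\<lambda>\<phi>. \<lambda>i\<in>{..<n}. measure \<phi> (C i)) =
        dirichlet_law n (\<lambda>i. measure \<alpha> (C i))" if "is_dirichlet_process_law \<alpha> D'" for D'
      using that C unfolding is_dirichlet_process_law_def by blast
    from this[OF D] this[OF is_dirichlet_process_law_stick]
    show "distr D (\<Pi>\<^sub>M i\<in>{..<n}. borel) (\<lambda>\<phi>. \<lambda>i\<in>{..<n}. measure \<phi> (C i)) =
      distr (distr breaks (prob_algebra borel) stick_measure) (\<Pi>\<^sub>M i\<in>{..<n}. borel) (\<lambda>\<phi>. \<lambda>i\<in>{..<n}. measure \<phi> (C i))"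
      by (simp only:)
  qed
qed

section \<open>The mean of a Dirichlet process\<close>

definition stick_mean :: "(nat \<Rightarrow> real \<times> real) \<Rightarrow> real" where
  "stick_mean \<omega> = (\<Sum>k. weight \<omega> k * snd (\<omega> k))"

lemma stick_mean_case_nat:
  assumes "summable (\<lambda>k. weight \<omega> k * snd (\<omega> k))"
  shows "stick_mean (case_nat s \<omega>) = fst s * snd s + (1 - fst s) * stick_mean \<omega>"
proof -
  have Suc: "(\<lambda>k. weight (case_nat s \<omega>) (Suc k) * snd (case_nat s \<omega> (Suc k))) =
      (\<lambda>k. (1 - fst s) * (weight \<omega> k * snd (\<omega> k)))"
    by (simp add: weight_case_nat mult.assoc)
  then have "summable (\<lambda>k. weight (case_nat s \<omega>) (Suc k) * snd (case_nat s \<omega> (Suc k)))"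
    using summable_mult[OF assms, of "1 - fst s"] by (simp only:)
  then have "summable (\<lambda>k. weight (case_nat s \<omega>) k * snd (case_nat s \<omega> k))"
    by (simp only: summable_Suc_iff[where f = "\<lambda>k. weight (case_nat s \<omega>) k * snd (case_nat s \<omega> k)"])
  from suminf_split_head[OF this] show ?thesis
    unfolding stick_mean_def Suc suminf_mult[OF assms] by (simp add: weight_case_nat algebra_simps)
qed

lemma integral_stick_measure:
  fixes f :: "real \<Rightarrow> real"
  assumes "(\<Sum>k. ennreal (weight \<omega> k)) = 1" and nn: "\<And>k. weight \<omega> k \<ge> 0"
    and [measurable]: "f \<in> borel_measurable borel"
    and summable: "summable (\<lambda>k. weight \<omega> k * \<bar>f (snd (\<omega> k))\<bar>)"
  shows "(\<integral>x. f x \<partial>stick_measure \<omega>) = (\<Sum>k. weight \<omega> k * f (snd (\<omega> k)))"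
proof -
  have "(\<integral>x. f x \<partial>stick_measure \<omega>) =
      (\<integral>k. f (snd (\<omega> k)) \<partial>density (count_space UNIV) (\<lambda>k. ennreal (weight \<omega> k)))"
    unfolding stick_measure_def if_P[OF assms(1)] by (rule integral_distr) auto
  also have "\<dots> = (\<integral>k. weight \<omega> k *\<^sub>R f (snd (\<omega> k)) \<partial>count_space UNIV)"
    using nn by (intro integral_density) auto
  also have "\<dots> = (\<integral>k. weight \<omega> k * f (snd (\<omega> k)) \<partial>count_space UNIV)" by simp
  also have "\<dots> = (\<Sum>k. weight \<omega> k * f (snd (\<omega> k)))"
    using summable nn by (intro integral_count_space_nat) (simp add: integrable_count_space_nat_iff abs_mult)
  finally show ?thesis .
qed

lemma measure_eq_distr_triple:
  fixes f :: "real \<times> real \<times> real \<Rightarrow> real"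
  assumes "prob_space L" "prob_space M" "prob_space N"
    and [measurable_cong]: "sets L = sets borel" "sets M = sets borel" "sets N = sets borel"
    and [measurable]: "f \<in> borel_measurable (borel \<Otimes>\<^sub>M borel \<Otimes>\<^sub>M borel)"
    and sP: "sets P = sets borel"
    and eq: "\<And>g. g \<in> borel_measurable borel \<Longrightarrow>
      (\<integral>\<^sup>+y. g y \<partial>P) = (\<integral>\<^sup>+v. (\<integral>\<^sup>+x. (\<integral>\<^sup>+m. g (f (v, x, m)) \<partial>N) \<partial>M) \<partial>L)"
  shows "P = distr (L \<Otimes>\<^sub>M (M \<Otimes>\<^sub>M N)) borel f"
proof (rule measure_eqI)
  interpret L: prob_space L by fact
  interpret M: prob_space M by fact
  interpret N: prob_space N by fact
  interpret MN: pair_prob_space M N ..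
  show "sets P = sets (distr (L \<Otimes>\<^sub>M (M \<Otimes>\<^sub>M N)) borel f)" by (simp add: sP)
  fix A assume AP: "A \<in> sets P"
  then have A: "A \<in> sets borel" by (simp only: sP)
  define g where "g = (indicator A :: real \<Rightarrow> ennreal)"
  have [measurable]: "g \<in> borel_measurable borel"
    unfolding g_def by (rule borel_measurable_indicator[OF A])
  have "emeasure P A = (\<integral>\<^sup>+y. g y \<partial>P)"
    unfolding g_def by (rule nn_integral_indicator[OF AP, symmetric])
  also have "\<dots> = (\<integral>\<^sup>+v. (\<integral>\<^sup>+x. (\<integral>\<^sup>+m. g (f (v, x, m)) \<partial>N) \<partial>M) \<partial>L)"
    by (rule eq) measurable
  also have "\<dots> = (\<integral>\<^sup>+v. (\<integral>\<^sup>+p. g (f (v, p)) \<partial>(M \<Otimes>\<^sub>M N)) \<partial>L)"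
    by (intro nn_integral_cong N.nn_integral_fst) measurable
  also have "\<dots> = (\<integral>\<^sup>+q. g (f q) \<partial>(L \<Otimes>\<^sub>M (M \<Otimes>\<^sub>M N)))"
    by (rule MN.nn_integral_fst) measurable
  also have "\<dots> = (\<integral>\<^sup>+y. g y \<partial>distr (L \<Otimes>\<^sub>M (M \<Otimes>\<^sub>M N)) borel f)"
    by (rule nn_integral_distr[symmetric]) measurable
  also have "\<dots> = emeasure (distr (L \<Otimes>\<^sub>M (M \<Otimes>\<^sub>M N)) borel f) A"
    unfolding g_def by (rule nn_integral_indicator) (simp add: A)
  finally show "emeasure P A = emeasure (distr (L \<Otimes>\<^sub>M (M \<Otimes>\<^sub>M N)) borel f) A" .
qed

context stick_breaking
begin

lemma measurable_stick_mean [measurable]: "stick_mean \<in> borel_measurable breaks"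
  unfolding stick_mean_def[abs_def] by measurable

lemma nn_integral_atom:
  assumes [measurable]: "f \<in> borel_measurable borel"
  shows "(\<integral>\<^sup>+\<omega>. f (snd (\<omega> k)) \<partial>breaks) = (\<integral>\<^sup>+x. f x \<partial>\<alpha>)"
proof -
  have "(\<integral>\<^sup>+\<omega>. f (snd (\<omega> k)) \<partial>breaks) = (\<integral>\<^sup>+s. f (snd s) \<partial>distr breaks break_law (\<lambda>\<omega>. \<omega> k))"
    by (subst nn_integral_distr) (auto simp: breaks_def)
  also have "distr breaks break_law (\<lambda>\<omega>. \<omega> k) = break_law"
    unfolding breaks_def by (rule seq.PiM_component) simp
  also have "(\<integral>\<^sup>+s. f (snd s) \<partial>break_law) = (\<integral>\<^sup>+v. indicator {0<..<1::real} v * (\<integral>\<^sup>+x. f x \<partial>\<alpha>) \<partial>lborel)"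
    by (subst nn_integral_break_law) simp_all
  also have "\<dots> = (\<integral>\<^sup>+x. f x \<partial>\<alpha>)"
    by (subst nn_integral_multc) simp_all
  finally show ?thesis .
qed

text \<open>The expected number of \<open>k\<close> with \<open>(3/2) ^ k < \<bar>X\<^sub>k\<bar>\<close> is the expectation under \<open>\<alpha>\<close> of the number of \<open>k\<close>
with \<open>(3/2) ^ k < \<bar>x\<bar>\<close>, which is at most \<open>1 + ln (1 + \<bar>x\<bar>) / ln (3/2)\<close>. This is where the
logarithmic moment is used.\<close>

lemma AE_atoms_bounded:
  assumes "integrable \<alpha> (\<lambda>x. ln (1 + \<bar>x\<bar>))"
  shows "AE \<omega> in breaks. \<forall>\<^sub>F k in sequentially. \<bar>snd (\<omega> k)\<bar> \<le> (3/2) ^ k"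
proof -
  define c where "c = ln (3/2 :: real)"
  have c: "c > 0" by (simp add: c_def)
  define I where "I k x = (indicator {x. (3/2) ^ k < \<bar>x\<bar>} x :: ennreal)" for k and x :: real
  have [measurable]: "I k \<in> borel_measurable borel" for k
    unfolding I_def[abs_def] by measurable
  have bound: "(\<Sum>k. I k x) \<le> ennreal (1 + ln (1 + \<bar>x\<bar>) / c)" for x
  proof -
    \<comment> \<open>All \<open>k\<close> with \<open>(3/2) ^ k < \<bar>x\<bar>\<close> lie below \<open>N\<close>.\<close>
    define N where "N = nat \<lceil>ln (1 + \<bar>x\<bar>) / c\<rceil>"
    have "I k x = 0" if "k \<notin> {..<N}" for k
    proof -
      have "ln (1 + \<bar>x\<bar>) / c \<le> real k" using that unfolding N_def by (simp add: not_less nat_ceiling_le_eq)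
      then have "ln (1 + \<bar>x\<bar>) \<le> real k * c" using c by (simp add: pos_divide_le_eq)
      also have "\<dots> = ln ((3/2) ^ k)" by (simp add: c_def ln_realpow)
      finally have "1 + \<bar>x\<bar> \<le> (3/2) ^ k" by simp
      then show ?thesis by (simp add: I_def)
    qed
    then have "(\<Sum>k. I k x) = (\<Sum>k<N. I k x)" by (intro suminf_finite) auto
    also have "\<dots> \<le> (\<Sum>k<N. 1)" by (intro sum_mono) (simp add: I_def indicator_def)
    also have "\<dots> = ennreal (real N)" by (simp add: ennreal_of_nat_eq_real_of_nat)
    also have "\<dots> \<le> ennreal (1 + ln (1 + \<bar>x\<bar>) / c)"
    proof (rule ennreal_leI)
      have "ln (1 + \<bar>x\<bar>) / c \<ge> 0" using c by simp
      then show "real N \<le> 1 + ln (1 + \<bar>x\<bar>) / c" unfolding N_def by linarith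
    qed
    finally show ?thesis .
  qed
  have "(\<integral>\<^sup>+\<omega>. (\<Sum>k. I k (snd (\<omega> k))) \<partial>breaks) = (\<Sum>k. \<integral>\<^sup>+\<omega>. I k (snd (\<omega> k)) \<partial>breaks)"
    by (rule nn_integral_suminf) measurable
  also have "\<dots> = (\<Sum>k. \<integral>\<^sup>+x. I k x \<partial>\<alpha>)" by (simp add: nn_integral_atom)
  also have "\<dots> = (\<integral>\<^sup>+x. (\<Sum>k. I k x) \<partial>\<alpha>)" by (rule nn_integral_suminf[symmetric]) measurable
  also have "\<dots> \<le> (\<integral>\<^sup>+x. ennreal (1 + ln (1 + \<bar>x\<bar>) / c) \<partial>\<alpha>)"
    by (intro nn_integral_mono bound)
  also have "\<dots> < \<infinity>"
  proof -
    have "integrable \<alpha> (\<lambda>x. 1 + ln (1 + \<bar>x\<bar>) / c)"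
      by (rule Bochner_Integration.integrable_add[OF _ integrable_divide[OF assms]]) simp
    moreover have "0 \<le> 1 + ln (1 + \<bar>x\<bar>) / c" for x :: real using c by simp
    ultimately show ?thesis
      by (subst nn_integral_eq_integral) simp_all
  qed
  finally have "(\<integral>\<^sup>+\<omega>. (\<Sum>k. I k (snd (\<omega> k))) \<partial>breaks) \<noteq> \<infinity>" by simp
  then have "AE \<omega> in breaks. (\<Sum>k. I k (snd (\<omega> k))) \<noteq> \<infinity>"
    by (intro nn_integral_PInf_AE) measurable
  then show ?thesis
  proof eventually_elim
    case (elim \<omega>)
    define J where "J k = (indicator {x. (3/2) ^ k < \<bar>x\<bar>} (snd (\<omega> k)) :: real)" for k
    have "(\<Sum>k. ennreal (J k)) \<noteq> \<infinity>" using elim by (simp add: I_def J_def ennreal_indicator)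
    then have "summable J"
      unfolding infinity_ennreal_def by (rule summable_suminf_not_top[rotated]) (simp add: J_def)
    from order_tendstoD(2)[OF summable_LIMSEQ_zero[OF this] zero_less_one]
    have "\<forall>\<^sub>F k in sequentially. J k < 1" .
    then show ?case by eventually_elim (auto simp: J_def indicator_def split: if_splits)
  qed
qed

lemma AE_summable_mean:
  assumes "integrable \<alpha> (\<lambda>x. ln (1 + \<bar>x\<bar>))"
  shows "AE \<omega> in breaks. summable (\<lambda>k. weight \<omega> k * \<bar>snd (\<omega> k)\<bar>)"
  using AE_atoms_bounded[OF assms] AE_summable_remaining AE_fraction
proof eventually_elim
  case (elim \<omega>)
  have r: "remaining \<omega> k \<ge> 0" for k
    unfolding remaining_def using elim(3) by (intro prod_nonneg) (auto simp: less_imp_le)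
  have w: "0 \<le> weight \<omega> k" "weight \<omega> k \<le> remaining \<omega> k" for k
    using elim(3) r[of k] by (auto simp: weight_def less_imp_le mult_left_le_one_le)
  show ?case
  proof (rule summable_comparison_test_ev[OF _ elim(2)])
    show "\<forall>\<^sub>F k in sequentially. norm (weight \<omega> k * \<bar>snd (\<omega> k)\<bar>) \<le> remaining \<omega> k * (3/2) ^ k"
      using elim(1)
    proof eventually_elim
      case (elim k)
      have "weight \<omega> k * \<bar>snd (\<omega> k)\<bar> \<le> remaining \<omega> k * (3/2) ^ k"
        using elim w[of k] r[of k] by (intro mult_mono) auto
      then show ?case using w[of k] by (simp add: abs_mult)
    qed
  qed
qed

lemma AE_summable_signed_mean:
  assumes "integrable \<alpha> (\<lambda>x. ln (1 + \<bar>x\<bar>))"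
  shows "AE \<omega> in breaks. summable (\<lambda>k. weight \<omega> k * snd (\<omega> k))"
  using AE_summable_mean[OF assms] AE_weights
proof eventually_elim
  case (elim \<omega>)
  then have nn: "weight \<omega> k \<ge> 0" for k by blast
  have "(\<lambda>k. weight \<omega> k * \<bar>snd (\<omega> k)\<bar>) = (\<lambda>k. \<bar>weight \<omega> k * snd (\<omega> k)\<bar>)"
    by (intro ext) (simp add: abs_mult nn)
  with elim(1) show ?case by (simp only: summable_rabs_cancel)
qed

lemma mean_law_eq:
  assumes "integrable \<alpha> (\<lambda>x. ln (1 + \<bar>x\<bar>))"
  shows "mean_law \<alpha> = distr breaks borel stick_mean"
proof -
  have "mean_law \<alpha> = distr breaks borel ((\<lambda>\<phi>. \<integral>x. x \<partial>\<phi>) \<circ> stick_measure)"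
    unfolding mean_law_def dirichlet_process_law_eq
    by (rule distr_distr[OF measurable_mean measurable_stick_measure])
  also have "\<dots> = distr breaks borel stick_mean"
  proof (rule distr_cong_AE)
    show "AE \<omega> in breaks. ((\<lambda>\<phi>. \<integral>x. x \<partial>\<phi>) \<circ> stick_measure) \<omega> = stick_mean \<omega>"
      using AE_weights AE_summable_mean[OF assms]
    proof eventually_elim
      case (elim \<omega>)
      then have "(\<Sum>k. ennreal (weight \<omega> k)) = 1" "\<And>k. weight \<omega> k \<ge> 0" by blast+
      from integral_stick_measure[OF this measurable_ident_sets[OF refl] elim(2)]
      show ?case unfolding stick_mean_def comp_def .
    qed
    show "(\<lambda>\<phi>. \<integral>x. x \<partial>\<phi>) \<circ> stick_measure \<in> borel_measurable breaks"
      by (rule measurable_comp[OF measurable_stick_measure measurable_mean])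
  qed (rule refl measurable_stick_mean)+
  finally show ?thesis .
qed

lemma prob_space_mean_law:
  assumes "integrable \<alpha> (\<lambda>x. ln (1 + \<bar>x\<bar>))"
  shows "prob_space (mean_law \<alpha>)"
  unfolding mean_law_eq[OF assms] by (rule breaks.prob_space_distr[OF measurable_stick_mean])

lemma nn_integral_mean_law:
  assumes int: "integrable \<alpha> (\<lambda>x. ln (1 + \<bar>x\<bar>))"
    and [measurable]: "g \<in> borel_measurable borel"
  shows "(\<integral>\<^sup>+m. g m \<partial>mean_law \<alpha>) =
    (\<integral>\<^sup>+v. (\<integral>\<^sup>+x. (\<integral>\<^sup>+m. g (v * x + (1 - v) * m) \<partial>mean_law \<alpha>) \<partial>\<alpha>) \<partial>uniform_measure lborel {0<..<1})"
proof -
  have "(\<integral>\<^sup>+m. g m \<partial>mean_law \<alpha>) = (\<integral>\<^sup>+\<omega>. g (stick_mean \<omega>) \<partial>breaks)"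
    unfolding mean_law_eq[OF int] by (rule nn_integral_distr[OF measurable_stick_mean]) measurable
  also have "\<dots> = (\<integral>\<^sup>+s. (\<integral>\<^sup>+\<omega>. g (stick_mean (case_nat s \<omega>)) \<partial>breaks) \<partial>break_law)"
    by (rule nn_integral_breaks) measurable
  also have "\<dots> = (\<integral>\<^sup>+s. (\<integral>\<^sup>+\<omega>. g (fst s * snd s + (1 - fst s) * stick_mean \<omega>) \<partial>breaks) \<partial>break_law)"
  proof (rule nn_integral_cong, rule nn_integral_cong_AE)
    fix s
    show "AE \<omega> in breaks. g (stick_mean (case_nat s \<omega>)) = g (fst s * snd s + (1 - fst s) * stick_mean \<omega>)"
      using AE_summable_signed_mean[OF int] by eventually_elim (simp only: stick_mean_case_nat)
  qed
  also have "\<dots> = (\<integral>\<^sup>+s. (\<integral>\<^sup>+m. g (fst s * snd s + (1 - fst s) * m) \<partial>mean_law \<alpha>) \<partial>break_law)"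
    unfolding mean_law_eq[OF int] by (intro nn_integral_cong nn_integral_distr[symmetric]) measurable
  also have "\<dots> = (\<integral>\<^sup>+v. (\<integral>\<^sup>+x. (\<integral>\<^sup>+m. g (v * x + (1 - v) * m) \<partial>mean_law \<alpha>) \<partial>\<alpha>) \<partial>uniform_measure lborel {0<..<1})"
  proof -
    interpret M: prob_space "mean_law \<alpha>" by (rule prob_space_mean_law[OF int])
    have [measurable_cong]: "sets (mean_law \<alpha>) = sets borel" by (simp add: mean_law_def)
    have "(\<lambda>s. \<integral>\<^sup>+m. g (fst s * snd s + (1 - fst s) * m) \<partial>mean_law \<alpha>) \<in> borel_measurable (uniform_measure lborel {0<..<1} \<Otimes>\<^sub>M \<alpha>)"
      by measurable
    from nn_integral_fst[OF this] show ?thesis unfolding break_law_def by simp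
  qed
  finally show ?thesis .
qed

lemma mean_law_self_similar:
  assumes int: "integrable \<alpha> (\<lambda>x. ln (1 + \<bar>x\<bar>))"
  shows "mean_law \<alpha> = distr (uniform_measure lborel {0<..<1} \<Otimes>\<^sub>M (\<alpha> \<Otimes>\<^sub>M mean_law \<alpha>)) borel
    (\<lambda>(v, x, m). v * x + (1 - v) * m)"
proof (rule measure_eq_distr_triple)
  show "sets (mean_law \<alpha>) = sets borel" "sets (mean_law \<alpha>) = sets borel" by (simp_all add: mean_law_def)
  fix g :: "real \<Rightarrow> ennreal" assume "g \<in> borel_measurable borel"
  from nn_integral_mean_law[OF int this]
  show "(\<integral>\<^sup>+m. g m \<partial>mean_law \<alpha>) = (\<integral>\<^sup>+v. (\<integral>\<^sup>+x. (\<integral>\<^sup>+m. g (case (v, x, m) of (v, x, m) \<Rightarrow> v * x + (1 - v) * m)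
     \<partial>mean_law \<alpha>) \<partial>\<alpha>) \<partial>uniform_measure lborel {0<..<1})"
    by (simp only: prod.case)
qed (simp_all add: prob_space_uniform prob_space_axioms prob_space_mean_law[OF int])

end

section \<open>Poisson kernels and Stieltjes transforms\<close>

text \<open>The centred Cauchy density with scale \<open>l\<close>. The parameter \<open>s\<close> of \<open>cauchy_law\<close> is \<open>1 / l\<^sup>2\<close>.\<close>

definition poisson_kernel :: "real \<Rightarrow> real \<Rightarrow> real" where
  "poisson_kernel l u = l / (pi * (l\<^sup>2 + u\<^sup>2))"

lemma poisson_kernel_nonneg: "l > 0 \<Longrightarrow> 0 \<le> poisson_kernel l u"
  by (simp add: poisson_kernel_def)

lemma measurable_poisson_kernel [measurable]: "poisson_kernel l \<in> borel_measurable borel"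
  unfolding poisson_kernel_def[abs_def] by measurable

lemma poisson_kernel_denominator_pos: "(l::real) > 0 \<Longrightarrow> 0 < l\<^sup>2 + u\<^sup>2"
  by (simp add: add_pos_nonneg)

lemma has_bochner_integral_poisson_kernel:
  assumes l: "l > 0"
  shows "has_bochner_integral lborel (poisson_kernel l) 1"
proof -
  let ?F = "\<lambda>u. arctan (u / l) / pi"
  have deriv: "DERIV ?F u :> poisson_kernel l u" for u
  proof -
    have "DERIV ?F u :> inverse (1 + (u / l)\<^sup>2) * (1 / l) / pi"
      using l by (auto intro!: derivative_eq_intros)
    also have "inverse (1 + (u / l)\<^sup>2) * (1 / l) / pi = poisson_kernel l u"
      using l poisson_kernel_denominator_pos[OF l, of u]
      by (simp add: poisson_kernel_def field_simps power2_eq_square)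
    finally show ?thesis .
  qed
  have cont: "isCont (poisson_kernel l) u" for u
    unfolding poisson_kernel_def[abs_def]
    using poisson_kernel_denominator_pos[OF l, of u] by (intro continuous_intros) auto
  have top: "(?F \<longlongrightarrow> 1/2) at_top"
  proof -
    have "((\<lambda>u. arctan (u / l)) \<longlongrightarrow> pi / 2) at_top"
    proof (rule filterlim_compose[OF tendsto_arctan_at_top])
      have "filterlim (\<lambda>u. 1 / l * u) at_top at_top"
        using l by (intro filterlim_tendsto_pos_mult_at_top[OF tendsto_const _ filterlim_ident]) simp
      then show "filterlim (\<lambda>u. u / l) at_top at_top" by simp
    qed
    from tendsto_divide[OF this tendsto_const[of pi]] show ?thesis by simp
  qed
  have bot: "(?F \<longlongrightarrow> - 1/2) at_bot"
    unfolding filterlim_at_bot_mirror using tendsto_minus[OF top] by (simp add: arctan_minus)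
  have A: "((?F \<circ> real_of_ereal) \<longlongrightarrow> - 1/2) (at_right (- \<infinity>))"
    and B: "((?F \<circ> real_of_ereal) \<longlongrightarrow> 1/2) (at_left \<infinity>)"
    using top bot by (simp_all add: ereal_tendsto_simps)
  have nn: "AE x in lborel. - \<infinity> < ereal x \<longrightarrow> ereal x < \<infinity> \<longrightarrow> 0 \<le> poisson_kernel l x"
    using poisson_kernel_nonneg[OF l] by simp
  have UNIV: "einterval (- \<infinity>) \<infinity> = UNIV" by (auto simp: einterval_def)
  have "set_integrable lborel UNIV (poisson_kernel l)"
    using interval_integral_FTC_nonneg(1)[OF _ deriv cont nn A B] by (simp add: UNIV)
  moreover have "(LBINT x=-\<infinity>..\<infinity>. poisson_kernel l x) = 1"
    using interval_integral_FTC_nonneg(2)[OF _ deriv cont nn A B] by simp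
  ultimately show ?thesis
    by (simp add: has_bochner_integral_iff interval_lebesgue_integral_def set_integrable_def
        set_lebesgue_integral_def UNIV)
qed

lemma integrable_poisson_kernel_shift:
  assumes "l > 0"
  shows "integrable lborel (\<lambda>u. poisson_kernel l (u - t))"
  using lborel_integrable_real_affine[of "poisson_kernel l" 1 "- t"] has_bochner_integral_poisson_kernel[OF assms]
  by (simp add: has_bochner_integral_iff)

lemma integral_poisson_kernel_shift:
  assumes "l > 0"
  shows "(\<integral>u. poisson_kernel l (u - t) \<partial>lborel) = 1"
  using lborel_integral_real_affine[of 1 "poisson_kernel l" "- t"] has_bochner_integral_poisson_kernel[OF assms]
  by (simp add: has_bochner_integral_iff)

lemma cauchy_law_finite:
  assumes "0 < s" "s \<noteq> \<infinity>"
  obtains l where "l > 0" "s = ennreal (1 / l\<^sup>2)"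
    "\<And>\<theta>. cauchy_law \<theta> s = density lborel (\<lambda>x. ennreal (poisson_kernel l (x - \<theta>)))"
proof -
  define \<sigma> where "\<sigma> = sqrt (enn2real s)"
  have pos: "\<sigma> > 0" using assms by (simp add: \<sigma>_def enn2real_positive_iff less_top)
  have "s = ennreal (enn2real s)" using assms by (simp add: less_top)
  also have "enn2real s = \<sigma>\<^sup>2" by (simp add: \<sigma>_def)
  finally have s: "s = ennreal (1 / (1 / \<sigma>)\<^sup>2)" using pos by (simp add: power_divide)
  have "\<sigma> / (pi * (1 + \<sigma>\<^sup>2 * y\<^sup>2)) = poisson_kernel (1 / \<sigma>) y" for y
  proof -
    have "1 + \<sigma>\<^sup>2 * y\<^sup>2 > 0" by (intro add_pos_nonneg) auto
    moreover have "(1 / \<sigma>)\<^sup>2 + y\<^sup>2 = (1 + \<sigma>\<^sup>2 * y\<^sup>2) / \<sigma>\<^sup>2" using pos by (simp add: field_simps)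
    ultimately show ?thesis using pos by (simp add: poisson_kernel_def power2_eq_square)
  qed
  then have "cauchy_law \<theta> s = density lborel (\<lambda>x. ennreal (poisson_kernel (1 / \<sigma>) (x - \<theta>)))" for \<theta>
    using assms(2) unfolding cauchy_law_def \<sigma>_def[symmetric] Let_def by simp
  then show ?thesis using that[of "1 / \<sigma>"] pos s by simp
qed

lemma real_distribution_poisson_density:
  assumes "l > 0"
  shows "real_distribution (density lborel (\<lambda>x. ennreal (poisson_kernel l (x - \<theta>))))"
proof -
  have "(\<integral>\<^sup>+x. ennreal (poisson_kernel l (x - \<theta>)) \<partial>lborel) = ennreal 1"
    using integrable_poisson_kernel_shift[OF assms, of \<theta>] integral_poisson_kernel_shift[OF assms, of \<theta>]
      poisson_kernel_nonneg[OF assms]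
    by (subst nn_integral_eq_integral) simp_all
  then have "prob_space (density lborel (\<lambda>x. ennreal (poisson_kernel l (x - \<theta>))))"
    by (intro prob_spaceI) (simp add: emeasure_density)
  then show ?thesis by (simp add: real_distribution_def real_distribution_axioms_def)
qed

text \<open>The Stieltjes transform with the half-plane rotated, so that the poles \<open>\<i> x\<close> lie on the boundary of
the convex domain \<open>Re z > 0\<close>. There \<open>stieltjes M\<close> is also the Laplace transform of the
characteristic function.\<close>

definition stieltjes :: "real measure \<Rightarrow> complex \<Rightarrow> complex" where
  "stieltjes M z = (\<integral>x. 1 / (z - \<i> * complex_of_real x) \<partial>M)"

lemma resolvent_nonzero: "Re z > 0 \<Longrightarrow> z - \<i> * complex_of_real x \<noteq> 0"
  by (auto simp: complex_eq_iff)

lemma norm_resolvent: "Re z > 0 \<Longrightarrow> norm (1 / (z - \<i> * complex_of_real x)) \<le> 1 / Re z"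
  using complex_Re_le_cmod[of "z - \<i> * complex_of_real x"]
  by (simp add: norm_divide frac_le)

context real_distribution
begin

lemma integrable_resolvent: "Re z > 0 \<Longrightarrow> integrable M (\<lambda>x. 1 / (z - \<i> * complex_of_real x))"
  by (rule integrable_const_bound[where B = "1 / Re z"]) (auto simp: norm_resolvent simp del: norm_divide)

lemma integrable_resolvent_product:
  assumes "Re z > 0" "Re w > 0"
  shows "integrable M (\<lambda>x. 1 / (z - \<i> * complex_of_real x) * (1 / (w - \<i> * complex_of_real x)))"
proof (rule integrable_const_bound[where B = "1 / Re z * (1 / Re w)"])
  show "AE x in M. norm (1 / (z - \<i> * complex_of_real x) * (1 / (w - \<i> * complex_of_real x))) \<le> 1 / Re z * (1 / Re w)"
    using assms by (intro AE_I2) (subst norm_mult, intro mult_mono norm_resolvent, auto)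
qed measurable

text \<open>The difference quotient and the integral on the right differ by the integral of
\<open>(w - z) / ((w - \<i> x) (z - \<i> x)\<^sup>2)\<close>, which is bounded by a multiple of \<open>\<bar>w - z\<bar>\<close> as long as \<open>w\<close> stays away
from the imaginary axis.\<close>

lemma stieltjes_has_field_derivative:
  assumes z: "Re z > 0"
  shows "(stieltjes M has_field_derivative - (\<integral>x. 1 / (z - \<i> * complex_of_real x) * (1 / (z - \<i> * complex_of_real x)) \<partial>M)) (at z)"
proof -
  let ?r = "\<lambda>z x. 1 / (z - \<i> * complex_of_real x)"
  let ?G = "\<integral>x. ?r z x * ?r z x \<partial>M"
  have bound: "norm ((stieltjes M w - stieltjes M z) / (w - z) - (- ?G)) \<le> norm (w - z) * (2 / Re z ^ 3)"
    if w: "Re w > Re z / 2" "w \<noteq> z" for w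
  proof -
    have w0: "Re w > 0" using w z by linarith
    have "?r w x - ?r z x = - (w - z) * (?r w x * ?r z x)" for x
      using resolvent_nonzero[OF z, of x] resolvent_nonzero[OF w0, of x] by (simp add: field_simps)
    then have "stieltjes M w - stieltjes M z = (\<integral>x. - (w - z) * (?r w x * ?r z x) \<partial>M)"
      unfolding stieltjes_def
      using Bochner_Integration.integral_diff[OF integrable_resolvent[OF w0] integrable_resolvent[OF z]]
      by (simp only:)
    also have "\<dots> = - (w - z) * (\<integral>x. ?r w x * ?r z x \<partial>M)"
      by (rule Bochner_Integration.integral_mult_right) (rule integrable_resolvent_product[OF w0 z])
    finally have quotient: "stieltjes M w - stieltjes M z = - (w - z) * (\<integral>x. ?r w x * ?r z x \<partial>M)" .
    have "a = - (w - z) * b \<Longrightarrow> a / (w - z) - (- c) = c - b" for a b c :: complex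
      using w by (simp add: field_simps)
    from this[OF quotient, of ?G]
    have "(stieltjes M w - stieltjes M z) / (w - z) - (- ?G) = ?G - (\<integral>x. ?r w x * ?r z x \<partial>M)" .
    also have "\<dots> = (\<integral>x. ?r z x * ?r z x - ?r w x * ?r z x \<partial>M)"
      using integrable_resolvent_product z w0 by (subst Bochner_Integration.integral_diff) simp_all
    also have "norm \<dots> \<le> norm (w - z) * (2 / Re z ^ 3)"
    proof (rule Bochner_Integration.integral_norm_bound_integral[THEN order_trans])
      show "integrable M (\<lambda>x. ?r z x * ?r z x - ?r w x * ?r z x)"
        using integrable_resolvent_product z w0 by (intro Bochner_Integration.integrable_diff) simp_all
      show "integrable M (\<lambda>x. norm (w - z) * (2 / Re z ^ 3))" by simp
      show "(\<integral>x. norm (w - z) * (2 / Re z ^ 3) \<partial>M) \<le> norm (w - z) * (2 / Re z ^ 3)"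
        using prob_space by simp
      fix x
      have "1 / q * (1 / q) - 1 / p * (1 / q) = (p - q) * (1 / p * (1 / q * (1 / q)))"
        if "p \<noteq> 0" "q \<noteq> 0" for p q :: complex
        using that by (simp add: field_simps)
      from this[OF resolvent_nonzero[OF w0] resolvent_nonzero[OF z], of x x]
      have "?r z x * ?r z x - ?r w x * ?r z x = (w - z) * (?r w x * (?r z x * ?r z x))"
        by (simp only: diff_diff_eq2 diff_add_cancel)
      then have "norm (?r z x * ?r z x - ?r w x * ?r z x) =
          norm (w - z) * (norm (?r w x) * (norm (?r z x) * norm (?r z x)))"
        by (simp only: norm_mult)
      also have "\<dots> \<le> norm (w - z) * (2 / Re z * (1 / Re z * (1 / Re z)))"
      proof -
        have "norm (?r w x) \<le> 1 / Re w" by (rule norm_resolvent[OF w0])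
        also have "\<dots> \<le> 2 / Re z" using w z w0 by (simp add: field_simps)
        finally show ?thesis
          using norm_resolvent[OF z, of x] z by (intro mult_left_mono mult_mono) auto
      qed
      also have "2 / Re z * (1 / Re z * (1 / Re z)) = 2 / Re z ^ 3" by (simp add: power3_eq_cube)
      finally show "norm (?r z x * ?r z x - ?r w x * ?r z x) \<le> norm (w - z) * (2 / Re z ^ 3)" .
    qed
    finally show ?thesis .
  qed
  have ev: "\<forall>\<^sub>F w in at z. Re w > Re z / 2 \<and> w \<noteq> z"
  proof -
    have "(Re \<longlongrightarrow> Re z) (at z)" by (intro tendsto_intros)
    then have "\<forall>\<^sub>F w in at z. Re w > Re z / 2" using z by (intro order_tendstoD) auto
    then show ?thesis using eventually_neq_at_within by (rule eventually_conj)
  qed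
  have "((\<lambda>w. norm (w - z) * (2 / Re z ^ 3)) \<longlongrightarrow> norm (z - z) * (2 / Re z ^ 3)) (at z)"
    by (intro tendsto_intros)
  then have lim0: "((\<lambda>w. norm (w - z) * (2 / Re z ^ 3)) \<longlongrightarrow> 0) (at z)" by simp
  have "((\<lambda>w. (stieltjes M w - stieltjes M z) / (w - z) - (- ?G)) \<longlongrightarrow> 0) (at z)"
    by (rule Lim_null_comparison[OF _ lim0]) (use ev in eventually_elim, use bound in blast)
  then show ?thesis unfolding has_field_derivative_iff by (simp only: LIM_zero_iff)
qed

lemma stieltjes_Re_pos:
  assumes z: "Re z > 0"
  shows "Re (stieltjes M z) > 0"
proof -
  let ?r = "\<lambda>x. Re (1 / (z - \<i> * complex_of_real x))"
  have pos: "?r x > 0" for x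
    using z resolvent_nonzero[OF z, of x] by (simp add: Re_divide_numeral Re_divide complex_eq_iff add_pos_nonneg sum_power2_gt_zero_iff)
  have int: "integrable M ?r" using integrable_resolvent[OF z] by (rule integrable_Re)
  have "Re (stieltjes M z) = (\<integral>x. ?r x \<partial>M)"
    unfolding stieltjes_def using integrable_resolvent[OF z] by (rule integral_Re[symmetric])
  moreover have "(\<integral>x. ?r x \<partial>M) \<noteq> 0"
  proof
    assume "(\<integral>x. ?r x \<partial>M) = 0"
    then have "AE x in M. ?r x = 0"
      using pos by (subst (asm) integral_nonneg_eq_0_iff_AE[OF int]) (auto simp: less_imp_le)
    then have "AE x in M. False" by (rule eventually_mono) (metis pos less_irrefl)
    then show False by simp
  qed
  moreover have "(\<integral>x. ?r x \<partial>M) \<ge> 0" using pos by (intro integral_nonneg_AE) (simp add: less_imp_le)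
  ultimately show ?thesis by linarith
qed

lemma stieltjes_asymptotic: "(\<lambda>n. of_nat (Suc n) * stieltjes M (of_nat (Suc n))) \<longlonglongrightarrow> 1"
proof -
  let ?f = "\<lambda>n x. of_nat (Suc n) * (1 / (of_nat (Suc n) - \<i> * complex_of_real x))"
  have "(\<lambda>n. \<integral>x. ?f n x \<partial>M) \<longlonglongrightarrow> (\<integral>x. 1 \<partial>M)"
  proof (rule integral_dominated_convergence[where w = "\<lambda>_. 1"])
    show "AE x in M. (\<lambda>n. ?f n x) \<longlonglongrightarrow> 1"
    proof (rule AE_I2)
      fix x
      have "(\<lambda>n. 1 - \<i> * complex_of_real x * inverse (of_nat (Suc n))) \<longlonglongrightarrow> 1 - \<i> * complex_of_real x * 0"
        by (intro tendsto_intros LIMSEQ_inverse_real_of_nat) (rule LIMSEQ_Suc[OF lim_inverse_n])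
      then have "(\<lambda>n. 1 / (1 - \<i> * complex_of_real x * inverse (of_nat (Suc n)))) \<longlonglongrightarrow> 1 / 1"
        by (intro tendsto_divide tendsto_const) auto
      moreover have "1 / (1 - \<i> * complex_of_real x * inverse (of_nat (Suc n))) = ?f n x" for n
      proof -
        have "of_nat (Suc n) - \<i> * complex_of_real x \<noteq> 0" by (rule resolvent_nonzero) simp
        moreover have "(of_nat (Suc n) :: complex) \<noteq> 0" by (simp del: of_nat_Suc)
        ultimately show ?thesis by (simp add: field_simps del: of_nat_Suc)
      qed
      ultimately show "(\<lambda>n. ?f n x) \<longlonglongrightarrow> 1" by simp
    qed
    show "AE x in M. norm (?f n x) \<le> 1" for n
    proof (rule AE_I2)
      fix x
      have "norm (?f n x) \<le> real (Suc n) * (1 / Re (of_nat (Suc n)))"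
        unfolding norm_mult by (intro mult_mono norm_resolvent) (simp_all del: of_nat_Suc)
      then show "norm (?f n x) \<le> 1" by (simp del: of_nat_Suc)
    qed
  qed auto
  moreover have "(\<integral>x. ?f n x \<partial>M) = of_nat (Suc n) * stieltjes M (of_nat (Suc n))" for n
    unfolding stieltjes_def 
    by (rule Bochner_Integration.integral_mult_right) (rule integrable_resolvent, simp)
  moreover have "prob UNIV = 1" using prob_space by simp
  ultimately show ?thesis by (simp del: of_nat_Suc)
qed

end

section \<open>Injectivity of the Stieltjes transform\<close>

text \<open>On the line \<open>Re z = l\<close>, the real part of the transform divided by \<open>\<pi>\<close> is the density of the convolution
of \<open>M\<close> with the Cauchy law of scale \<open>l\<close>; its Fourier transform is a product.\<close>

lemma (in real_distribution) poisson_smoothing_char: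
  assumes l: "l > 0"
  shows "(\<integral>\<tau>. iexp (t * \<tau>) * complex_of_real (Re (stieltjes M (Complex l \<tau>)) / pi) \<partial>lborel) =
    char M t * (\<integral>u. iexp (t * u) * complex_of_real (poisson_kernel l u) \<partial>lborel)"
proof -
  interpret MN: pair_sigma_finite M lborel ..
  let ?f = "\<lambda>x \<tau>. iexp (t * \<tau>) * complex_of_real (poisson_kernel l (\<tau> - x))"
  have kernel: "Re (1 / (Complex l \<tau> - \<i> * complex_of_real x)) = pi * poisson_kernel l (\<tau> - x)" for \<tau> x
    using l by (simp add: poisson_kernel_def Re_divide power2_eq_square)
  have "complex_of_real (Re (stieltjes M (Complex l \<tau>)) / pi) = (\<integral>x. complex_of_real (poisson_kernel l (\<tau> - x)) \<partial>M)" for \<tau>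
  proof -
    have "Re (stieltjes M (Complex l \<tau>)) = (\<integral>x. Re (1 / (Complex l \<tau> - \<i> * complex_of_real x)) \<partial>M)"
      unfolding stieltjes_def using l by (intro integral_Re[symmetric] integrable_resolvent) simp
    also have "\<dots> = pi * (\<integral>x. poisson_kernel l (\<tau> - x) \<partial>M)" unfolding kernel by simp
    finally show ?thesis by (simp add: integral_complex_of_real)
  qed
  then have "(\<integral>\<tau>. iexp (t * \<tau>) * complex_of_real (Re (stieltjes M (Complex l \<tau>)) / pi) \<partial>lborel) =
      (\<integral>\<tau>. (\<integral>x. ?f x \<tau> \<partial>M) \<partial>lborel)"
    by (simp only: Bochner_Integration.integral_mult_right_zero)
  also have "\<dots> = (\<integral>x. (\<integral>\<tau>. ?f x \<tau> \<partial>lborel) \<partial>M)"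
  proof (rule MN.Fubini_integral, rule MN.Fubini_integrable)
    have norm: "norm (?f x \<tau>) = poisson_kernel l (\<tau> - x)" for x \<tau>
      using poisson_kernel_nonneg[OF l, of "\<tau> - x"] by (simp add: norm_mult)
    show "integrable M (\<lambda>x. \<integral>\<tau>. norm (case (x, \<tau>) of (x, \<tau>) \<Rightarrow> ?f x \<tau>) \<partial>lborel)"
      by (simp only: prod.case norm integral_poisson_kernel_shift[OF l]) simp
    show "AE x in M. integrable lborel (\<lambda>\<tau>. case (x, \<tau>) of (x, \<tau>) \<Rightarrow> ?f x \<tau>)"
    proof (rule AE_I2)
      fix x
      have "integrable lborel (\<lambda>\<tau>. ?f x \<tau>)"
      proof (rule Bochner_Integration.integrable_bound[OF integrable_poisson_kernel_shift[OF l, of x]])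
        show "AE \<tau> in lborel. norm (?f x \<tau>) \<le> norm (poisson_kernel l (\<tau> - x))"
          unfolding norm by (intro AE_I2) simp
      qed measurable
      then show "integrable lborel (\<lambda>\<tau>. case (x, \<tau>) of (x, \<tau>) \<Rightarrow> ?f x \<tau>)" by simp
    qed
  qed measurable
  also have "\<dots> = (\<integral>x. iexp (t * x) * (\<integral>u. iexp (t * u) * complex_of_real (poisson_kernel l u) \<partial>lborel) \<partial>M)"
  proof (rule Bochner_Integration.integral_cong[OF refl])
    fix x
    have "(\<integral>\<tau>. ?f x \<tau> \<partial>lborel) = \<bar>1\<bar> *\<^sub>R (\<integral>u. ?f x (x + 1 * u) \<partial>lborel)"
      by (rule lborel_integral_real_affine) simp
    also have "\<dots> = (\<integral>u. iexp (t * x) * (iexp (t * u) * complex_of_real (poisson_kernel l u)) \<partial>lborel)"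
      by (simp add: distrib_left exp_add mult.assoc)
    also have "\<dots> = iexp (t * x) * (\<integral>u. iexp (t * u) * complex_of_real (poisson_kernel l u) \<partial>lborel)"
      by (rule Bochner_Integration.integral_mult_right_zero)
    finally show "(\<integral>\<tau>. ?f x \<tau> \<partial>lborel) = iexp (t * x) * (\<integral>u. iexp (t * u) * complex_of_real (poisson_kernel l u) \<partial>lborel)" .
  qed
  also have "\<dots> = char M t * (\<integral>u. iexp (t * u) * complex_of_real (poisson_kernel l u) \<partial>lborel)"
    unfolding char_def by (rule Bochner_Integration.integral_mult_left_zero)
  finally show ?thesis .
qed

text \<open>The Fourier transform of the Poisson kernel at \<open>t\<close> depends only on \<open>l * t\<close> and equals 1 at 0, so
continuity keeps it away from 0 for small \<open>l\<close>.\<close>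

lemma integral_iexp_poisson_kernel_nonzero:
  obtains l where "l > 0" "(\<integral>u. iexp (t * u) * complex_of_real (poisson_kernel l u) \<partial>lborel) \<noteq> 0"
proof -
  let ?C = "density lborel (\<lambda>x. ennreal (poisson_kernel 1 (x - 0)))"
  interpret C: real_distribution ?C by (rule real_distribution_poisson_density) simp
  have "(char ?C \<longlongrightarrow> char ?C 0) (at 0)" using C.isCont_char[of 0] by (simp only: isCont_def)
  then have "(char ?C \<longlongrightarrow> 1) (at 0)" by (simp only: C.char_zero)
  from tendstoD[OF this, of 1] obtain d where d: "d > 0"
    "\<And>s. s \<noteq> 0 \<Longrightarrow> \<bar>s\<bar> < d \<Longrightarrow> dist (char ?C s) 1 < 1"
    by (auto simp: eventually_at dist_real_def)
  \<comment> \<open>Adding 1 covers \<open>t = 0\<close>; the factor 2 makes \<open>\<bar>l * t\<bar> < d\<close> strict.\<close>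
  define l where "l = d / (2 * (\<bar>t\<bar> + 1))"
  have l: "l > 0" using d by (simp add: l_def add_nonneg_pos)
  have "\<bar>l * t\<bar> < d"
  proof -
    have "\<bar>l * t\<bar> = d * (\<bar>t\<bar> / (2 * (\<bar>t\<bar> + 1)))" using l d by (simp add: l_def abs_mult)
    also have "\<dots> < d * 1" using d by (intro mult_strict_left_mono) (auto simp: field_simps)
    finally show ?thesis by simp
  qed
  then have nz: "char ?C (l * t) \<noteq> 0"
    using d(2)[of "l * t"] C.char_zero by (cases "l * t = 0") auto
  have "(\<integral>u. iexp (t * u) * complex_of_real (poisson_kernel l u) \<partial>lborel) =
     \<bar>l\<bar> *\<^sub>R (\<integral>u. iexp (t * (0 + l * u)) * complex_of_real (poisson_kernel l (0 + l * u)) \<partial>lborel)"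
    using l by (intro lborel_integral_real_affine) simp
  also have "\<dots> = (\<integral>u. \<bar>l\<bar> *\<^sub>R (iexp (t * (0 + l * u)) * complex_of_real (poisson_kernel l (0 + l * u))) \<partial>lborel)"
    by (rule integral_scaleR_right[symmetric])
  also have "\<dots> = (\<integral>u. poisson_kernel 1 (u - 0) *\<^sub>R iexp (l * t * u) \<partial>lborel)"
  proof (rule Bochner_Integration.integral_cong[OF refl])
    fix u :: real
    have "l * poisson_kernel l (l * u) = poisson_kernel 1 u"
    proof -
      have "l\<^sup>2 + (l * u)\<^sup>2 = l\<^sup>2 * (1 + u\<^sup>2)" by (simp add: power_mult_distrib algebra_simps)
      then show ?thesis using l by (simp add: poisson_kernel_def power2_eq_square)
    qed
    then show "\<bar>l\<bar> *\<^sub>R (iexp (t * (0 + l * u)) * complex_of_real (poisson_kernel l (0 + l * u))) =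
        poisson_kernel 1 (u - 0) *\<^sub>R iexp (l * t * u)"
      using l by (simp add: scaleR_conv_of_real mult_ac flip: of_real_mult)
  qed
  also have "\<dots> = char ?C (l * t)"
    unfolding char_def using poisson_kernel_nonneg[of 1] by (intro integral_density[symmetric]) auto
  finally show ?thesis using that[OF l] nz by simp
qed

text \<open>Divide the Fourier transform of the smoothed measures by that of the kernel, and apply Levy's
uniqueness theorem.\<close>

lemma stieltjes_inj:
  assumes M: "real_distribution M" and N: "real_distribution N"
    and eq: "\<And>z. Re z > 0 \<Longrightarrow> stieltjes M z = stieltjes N z"
  shows "M = N"
proof (rule Levy_uniqueness[OF M N], rule ext)
  fix t
  obtain l where l: "l > 0" and nz: "(\<integral>u. iexp (t * u) * complex_of_real (poisson_kernel l u) \<partial>lborel) \<noteq> 0"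
    by (rule integral_iexp_poisson_kernel_nonzero)
  have "stieltjes M (Complex l \<tau>) = stieltjes N (Complex l \<tau>)" for \<tau>
    using l by (intro eq) simp
  then have "char M t * (\<integral>u. iexp (t * u) * complex_of_real (poisson_kernel l u) \<partial>lborel) =
      char N t * (\<integral>u. iexp (t * u) * complex_of_real (poisson_kernel l u) \<partial>lborel)"
    unfolding real_distribution.poisson_smoothing_char[OF M l, symmetric]
      real_distribution.poisson_smoothing_char[OF N l, symmetric] by (simp only:)
  then show "char M t = char N t" using nz by simp
qed

section \<open>The Stieltjes transform of a Cauchy law\<close>

lemma Ln_asymptotic:
  assumes c: "c \<notin> \<real>\<^sub>\<le>\<^sub>0" and b: "Re b > 0"  and d: "Re c = 0"
  shows "((\<lambda>u. Ln (b + c * complex_of_real u) - complex_of_real (ln u)) \<longlongrightarrow> Ln c) at_top"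
proof -
  have "((\<lambda>u. b * complex_of_real (inverse u) + c) \<longlongrightarrow> b * complex_of_real 0 + c) at_top"
    by (intro tendsto_intros tendsto_inverse_0_at_top filterlim_ident)
  then have "((\<lambda>u. Ln (b * complex_of_real (inverse u) + c)) \<longlongrightarrow> Ln c) at_top"
    using c by (intro tendsto_Ln) simp_all
  moreover have "\<forall>\<^sub>F u in at_top. Ln (b * complex_of_real (inverse u) + c) =
      Ln (b + c * complex_of_real u) - complex_of_real (ln u)"
    using eventually_gt_at_top[of "0::real"]
  proof eventually_elim
    case (elim u)
    have "Re (b * complex_of_real (inverse u) + c) > 0" using elim b d by simp
    then have "b * complex_of_real (inverse u) + c \<noteq> 0" by (metis less_irrefl zero_complex.sel(1))
    moreover have "b + c * complex_of_real u = complex_of_real u * (b * complex_of_real (inverse u) + c)"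
      using elim by (simp add: field_simps)
    ultimately show ?case using Ln_times_of_real[OF elim, of "b * complex_of_real (inverse u) + c"] Ln_of_real[OF elim] by simp
  qed
  ultimately show ?thesis by (rule Lim_transform_eventually)
qed

text \<open>Partial fractions give a primitive made of logarithms. At infinity their growth cancels, and only
the jump of the argument of \<open>a - \<i> u\<close> against that of \<open>l + \<i> u\<close> contributes. The primitive has the
denominator \<open>a - l\<close>, which is why \<open>a \<noteq> l\<close> is assumed.\<close>

lemma stieltjes_poisson_kernel_generic:
  assumes l: "l > 0" and a: "Re a > 0" "a \<noteq> complex_of_real l"
  shows "(\<integral>u. poisson_kernel l u *\<^sub>R (1 / (a - \<i> * complex_of_real u)) \<partial>lborel) = 1 / (a + l)"
proof -
  let ?l = "complex_of_real l"
  let ?f = "\<lambda>u. poisson_kernel l u *\<^sub>R (1 / (a - \<i> * complex_of_real u))"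
  define \<Psi> where "\<Psi> w = (\<i> / (a - ?l) * (Ln (?l + - \<i> * w) - Ln (a + - \<i> * w))
    + \<i> / (a + ?l) * (Ln (a + - \<i> * w) - Ln (?l + \<i> * w))) / (2 * pi)" for w :: complex
  have nz: "a - ?l \<noteq> 0" "a + ?l \<noteq> 0" using a l by (auto simp: complex_eq_iff)
  have deriv: "((\<lambda>u. \<Psi> (complex_of_real u)) has_vector_derivative ?f u) (at u)" for u
  proof (rule has_vector_derivative_real_field)
    let ?u = "complex_of_real u"
    have n: "?l + - \<i> * ?u \<notin> \<real>\<^sub>\<le>\<^sub>0" "a + - \<i> * ?u \<notin> \<real>\<^sub>\<le>\<^sub>0" "?l + \<i> * ?u \<notin> \<real>\<^sub>\<le>\<^sub>0"
      using a l by (auto simp: complex_nonpos_Reals_iff)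
    have "x \<noteq> 0" if "x \<notin> \<real>\<^sub>\<le>\<^sub>0" for x :: complex using that by auto
    note nn = this[OF n(1)] this[OF n(2)] this[OF n(3)]
    have dLn: "((\<lambda>w. Ln (b + c * w)) has_field_derivative inverse (b + c * v) * c) (at v)"
      if "b + c * v \<notin> \<real>\<^sub>\<le>\<^sub>0" for b c v :: complex
      using that by (auto intro!: derivative_eq_intros simp: divide_inverse)
    have "(\<Psi> has_field_derivative
       (\<i> / (a - ?l) * (inverse (?l + - \<i> * ?u) * (- \<i>) - inverse (a + - \<i> * ?u) * (- \<i>))
      + \<i> / (a + ?l) * (inverse (a + - \<i> * ?u) * (- \<i>) - inverse (?l + \<i> * ?u) * \<i>)) / (2 * pi)) (at ?u)"
      unfolding \<Psi>_def[abs_def] by (intro DERIV_cdivide DERIV_add DERIV_cmult DERIV_diff dLn n)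
    also have "\<i> / (a - ?l) * (inverse (?l + - \<i> * ?u) * (- \<i>) - inverse (a + - \<i> * ?u) * (- \<i>))
      = 1 / (a + - \<i> * ?u) * (1 / (?l + - \<i> * ?u))"
    proof -
      have "\<i> / (q - p) * (inverse p * (- \<i>) - inverse q * (- \<i>)) = 1 / q * (1 / p)"
        if "p \<noteq> 0" "q \<noteq> 0" "q - p \<noteq> 0" for p q :: complex
      proof -
        have "\<i> / (q - p) * (inverse p * (- \<i>) - inverse q * (- \<i>)) = (inverse p - inverse q) / (q - p)"
          by (simp add: algebra_simps divide_inverse)
        also have "inverse p - inverse q = (q - p) * (1 / q * (1 / p))" using that by (simp add: field_simps)
        finally show ?thesis using that by simp
      qed
      from this[OF nn(1,2)] show ?thesis using nz by simp
    qed
    also have "\<i> / (a + ?l) * (inverse (a + - \<i> * ?u) * (- \<i>) - inverse (?l + \<i> * ?u) * \<i>)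
      = 1 / (a + - \<i> * ?u) * (1 / (?l + \<i> * ?u))"
    proof -
      have "\<i> / (q + p) * (inverse q * (- \<i>) - inverse p * \<i>) = 1 / q * (1 / p)"
        if "p \<noteq> 0" "q \<noteq> 0" "q + p \<noteq> 0" for p q :: complex
      proof -
        have "\<i> / (q + p) * (inverse q * (- \<i>) - inverse p * \<i>) = (inverse q + inverse p) / (q + p)"
          by (simp add: algebra_simps divide_inverse)
        also have "inverse q + inverse p = (q + p) * (1 / q * (1 / p))" using that by (simp add: field_simps)
        finally show ?thesis using that by simp
      qed
      from this[OF nn(3,2)] show ?thesis using nz by (simp add: add.commute)
    qed
    also have "(1 / (a + - \<i> * ?u) * (1 / (?l + - \<i> * ?u)) + 1 / (a + - \<i> * ?u) * (1 / (?l + \<i> * ?u))) / (2 * pi)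
       = 1 / (a + - \<i> * ?u) * ((1 / (?l + - \<i> * ?u) + 1 / (?l + \<i> * ?u)) / (2 * pi))"
      by (simp only: distrib_left times_divide_eq_right)
    also have "1 / (?l + - \<i> * ?u) + 1 / (?l + \<i> * ?u) = 2 * ?l / (?l\<^sup>2 + ?u\<^sup>2)"
    proof -
      have "(?l + - \<i> * ?u) * (?l + \<i> * ?u) = ?l\<^sup>2 + ?u\<^sup>2" by (simp add: algebra_simps power2_eq_square)
      then show ?thesis using nn by (simp add: add_frac_eq)
    qed
    also have "1 / (a + - \<i> * ?u) * (2 * ?l / (?l\<^sup>2 + ?u\<^sup>2) / (2 * pi)) = ?f u"
      by (simp add: poisson_kernel_def scaleR_conv_of_real mult.commute)
    finally show "(\<Psi> has_field_derivative ?f u) (at ?u)" .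
  qed
  have cont: "isCont ?f u" for u
    unfolding poisson_kernel_def
    using poisson_kernel_denominator_pos[OF l, of u] resolvent_nonzero[OF a(1), of u]
    by (intro continuous_intros) auto
  have int: "integrable lborel ?f"
  proof (rule Bochner_Integration.integrable_bound)
    show "integrable lborel (\<lambda>u. poisson_kernel l u * (1 / Re a))"
      using has_bochner_integral_poisson_kernel[OF l] by (simp add: has_bochner_integral_iff)
    show "AE u in lborel. norm (?f u) \<le> norm (poisson_kernel l u * (1 / Re a))"
    proof (rule AE_I2)
      fix u
      have "norm (?f u) = poisson_kernel l u * norm (1 / (a - \<i> * complex_of_real u))"
        using poisson_kernel_nonneg[OF l, of u] by (simp only: norm_scaleR abs_of_nonneg)
      also have "\<dots> \<le> poisson_kernel l u * (1 / Re a)"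
        by (intro mult_left_mono norm_resolvent a poisson_kernel_nonneg l)
      finally show "norm (?f u) \<le> norm (poisson_kernel l u * (1 / Re a))"
        using poisson_kernel_nonneg[OF l, of u] a(1) by (simp add: abs_of_pos)
    qed
  qed measurable
  have i: "\<i> \<notin> \<real>\<^sub>\<le>\<^sub>0" "- \<i> \<notin> \<real>\<^sub>\<le>\<^sub>0" by (auto simp: complex_nonpos_Reals_iff)
  note minus = Ln_asymptotic[OF i(2)] and plus = Ln_asymptotic[OF i(1)]
  \<comment> \<open>Subtracting \<open>r = ln u\<close> from every logarithm makes each of them converge without changing the value.\<close>
  have cancel: "(\<i> / (a - ?l) * ((p - r) - (q - r)) + \<i> / (a + ?l) * ((q - r) - (s - r))) / (2 * pi) =
     (\<i> / (a - ?l) * (p - q) + \<i> / (a + ?l) * (q - s)) / (2 * pi)" for p q r s by simp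
  have limits: "(\<i> / (a - ?l) * (Ln (- \<i>) - Ln (- \<i>)) + \<i> / (a + ?l) * (Ln (- \<i>) - Ln \<i>)) / (2 * pi) = 1 / (2 * (a + ?l))"
    "(\<i> / (a - ?l) * (Ln \<i> - Ln \<i>) + \<i> / (a + ?l) * (Ln \<i> - Ln (- \<i>))) / (2 * pi) = - 1 / (2 * (a + ?l))"
  proof -
    have "Ln (- \<i>) - Ln \<i> = - \<i> * pi" "Ln \<i> - Ln (- \<i>) = \<i> * pi"
      by (simp_all add: Ln_minus_ii Ln_ii)
    then show "(\<i> / (a - ?l) * (Ln (- \<i>) - Ln (- \<i>)) + \<i> / (a + ?l) * (Ln (- \<i>) - Ln \<i>)) / (2 * pi) = 1 / (2 * (a + ?l))"
      "(\<i> / (a - ?l) * (Ln \<i> - Ln \<i>) + \<i> / (a + ?l) * (Ln \<i> - Ln (- \<i>))) / (2 * pi) = - 1 / (2 * (a + ?l))"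
      by simp_all
  qed
  have top: "((\<lambda>u. \<Psi> (complex_of_real u)) \<longlongrightarrow> 1 / (2 * (a + ?l))) at_top"
  proof -
    have "((\<lambda>u. (\<i> / (a - ?l) * ((Ln (?l + - \<i> * complex_of_real u) - complex_of_real (ln u))
           - (Ln (a + - \<i> * complex_of_real u) - complex_of_real (ln u)))
       + \<i> / (a + ?l) * ((Ln (a + - \<i> * complex_of_real u) - complex_of_real (ln u))
           - (Ln (?l + \<i> * complex_of_real u) - complex_of_real (ln u)))) / (2 * pi))
      \<longlongrightarrow> (\<i> / (a - ?l) * (Ln (- \<i>) - Ln (- \<i>)) + \<i> / (a + ?l) * (Ln (- \<i>) - Ln \<i>)) / (2 * pi)) at_top"
      using a l by (intro tendsto_intros minus plus) simp_all
    then show ?thesis unfolding cancel \<Psi>_def limits .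
  qed
  have bot: "((\<lambda>u. \<Psi> (complex_of_real u)) \<longlongrightarrow> - 1 / (2 * (a + ?l))) at_bot"
  proof -
    have "((\<lambda>u. (\<i> / (a - ?l) * ((Ln (?l + \<i> * complex_of_real u) - complex_of_real (ln u))
           - (Ln (a + \<i> * complex_of_real u) - complex_of_real (ln u)))
       + \<i> / (a + ?l) * ((Ln (a + \<i> * complex_of_real u) - complex_of_real (ln u))
           - (Ln (?l + - \<i> * complex_of_real u) - complex_of_real (ln u)))) / (2 * pi))
      \<longlongrightarrow> (\<i> / (a - ?l) * (Ln \<i> - Ln \<i>) + \<i> / (a + ?l) * (Ln \<i> - Ln (- \<i>))) / (2 * pi)) at_top"
      using a l by (intro tendsto_intros minus plus) simp_all
    moreover have "(\<i> / (a - ?l) * (Ln (?l + \<i> * complex_of_real u) - Ln (a + \<i> * complex_of_real u))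
       + \<i> / (a + ?l) * (Ln (a + \<i> * complex_of_real u) - Ln (?l + - \<i> * complex_of_real u))) / (2 * pi)
      = \<Psi> (complex_of_real (- u))" for u
      by (simp only: \<Psi>_def of_real_minus mult_minus_right mult_minus_left minus_minus)
    ultimately show ?thesis unfolding cancel filterlim_at_bot_mirror limits by (simp only:)
  qed
  have A: "(((\<lambda>u. \<Psi> (complex_of_real u)) \<circ> real_of_ereal) \<longlongrightarrow> - 1 / (2 * (a + ?l))) (at_right (- \<infinity>))"
    and B: "(((\<lambda>u. \<Psi> (complex_of_real u)) \<circ> real_of_ereal) \<longlongrightarrow> 1 / (2 * (a + ?l))) (at_left \<infinity>)"
    using top bot by (simp_all add: ereal_tendsto_simps)
  have "(LBINT u=-\<infinity>..\<infinity>. ?f u) = 1 / (2 * (a + ?l)) - (- 1 / (2 * (a + ?l)))"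
    using int by (intro interval_integral_FTC_integrable[OF _ deriv cont _ A B]) (simp_all add: set_integrable_def)
  also have "\<dots> = 1 / (a + ?l)"
  proof -
    have "1 / (2 * k) - (- 1 / (2 * k)) = 1 / k" if "k \<noteq> 0" for k :: complex
      using that by (simp add: field_simps)
    from this[OF nz(2)] show ?thesis .
  qed
  finally show ?thesis by (simp add: interval_lebesgue_integral_def set_lebesgue_integral_def)
qed

text \<open>The one point left out by \<open>stieltjes_poisson_kernel_generic\<close> follows by continuity.\<close>

lemma stieltjes_poisson_kernel:
  assumes l: "l > 0" and z: "Re z > 0"
  shows "stieltjes (density lborel (\<lambda>x. ennreal (poisson_kernel l (x - \<theta>)))) z = 1 / (z + Complex l (- \<theta>))"
proof -
  let ?C = "density lborel (\<lambda>x. ennreal (poisson_kernel l (x - \<theta>)))"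
  let ?c = "Complex l (- \<theta>)"
  interpret C: real_distribution ?C by (rule real_distribution_poisson_density[OF l])
  have generic: "stieltjes ?C w = 1 / (w + ?c)" if w: "Re w > 0" "w \<noteq> Complex l \<theta>" for w
  proof -
    let ?a = "w - \<i> * complex_of_real \<theta>"
    have a: "Re ?a > 0" "?a \<noteq> complex_of_real l" using w by (auto simp: complex_eq_iff)
    have "stieltjes ?C w = (\<integral>x. poisson_kernel l (x - \<theta>) *\<^sub>R (1 / (w - \<i> * complex_of_real x)) \<partial>lborel)"
      unfolding stieltjes_def using poisson_kernel_nonneg[OF l] by (intro integral_density) auto
    also have "\<dots> = \<bar>1\<bar> *\<^sub>R (\<integral>u. poisson_kernel l ((\<theta> + 1 * u) - \<theta>) *\<^sub>R (1 / (w - \<i> * complex_of_real (\<theta> + 1 * u))) \<partial>lborel)"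
      by (rule lborel_integral_real_affine) simp
    also have "\<dots> = (\<integral>u. poisson_kernel l u *\<^sub>R (1 / (?a - \<i> * complex_of_real u)) \<partial>lborel)"
      by (simp add: algebra_simps)
    also have "\<dots> = 1 / (?a + l)" by (rule stieltjes_poisson_kernel_generic[OF l a])
    also have "?a + l = w + ?c" by (simp add: complex_eq_iff)
    finally show ?thesis .
  qed
  have nz: "z + ?c \<noteq> 0" using z l by (auto simp: complex_eq_iff)
  have "(stieltjes ?C \<longlongrightarrow> stieltjes ?C z) (at z)"
    using DERIV_isCont[OF C.stieltjes_has_field_derivative[OF z]] by (simp only: isCont_def)
  moreover have "(stieltjes ?C \<longlongrightarrow> 1 / (z + ?c)) (at z)"
  proof (rule Lim_transform_eventually)
    show "((\<lambda>w. 1 / (w + ?c)) \<longlongrightarrow> 1 / (z + ?c)) (at z)" using nz by (intro tendsto_intros)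
    have "(Re \<longlongrightarrow> Re z) (at z)" by (intro tendsto_intros)
    then have "\<forall>\<^sub>F w in at z. Re w > 0" using z by (rule order_tendstoD)
    moreover have "\<forall>\<^sub>F w in at z. w \<noteq> Complex l \<theta>"
      by (cases "z = Complex l \<theta>") (auto simp: eventually_neq_at_within intro: eventually_neq_at_within tendsto_imp_eventually_ne[OF tendsto_ident_at])
    ultimately show "\<forall>\<^sub>F w in at z. 1 / (w + ?c) = stieltjes ?C w"
      by eventually_elim (rule generic[symmetric])
  qed
  ultimately show ?thesis by (rule tendsto_unique[OF trivial_limit_at])
qed

lemma stieltjes_return: "stieltjes (return borel \<theta>) z = 1 / (z + Complex 0 (- \<theta>))"
proof -
  have "stieltjes (return borel \<theta>) z = 1 / (z - \<i> * complex_of_real \<theta>)"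
    unfolding stieltjes_def by (rule integral_return) simp_all
  also have "z - \<i> * complex_of_real \<theta> = z + Complex 0 (- \<theta>)" by (simp add: complex_eq_iff)
  finally show ?thesis .
qed

section \<open>The differential equation of the mean\<close>

text \<open>With \<open>q v = v a + (1 - v) b\<close>, a primitive of \<open>1 / (q v)\<^sup>2\<close> is \<open>v / (b * q v)\<close>; it stays meaningful for
\<open>a = b\<close>.\<close>

lemma integral_segment_resolvent:
  fixes a b :: complex
  assumes a: "Re a > 0" and b: "Re b > 0"
  shows "(\<integral>v. 1 / (complex_of_real v * a + complex_of_real (1 - v) * b) *
    (1 / (complex_of_real v * a + complex_of_real (1 - v) * b)) \<partial>uniform_measure lborel {0<..<1}) = 1 / a * (1 / b)"
proof -
  let ?q = "\<lambda>v. complex_of_real v * a + complex_of_real (1 - v) * b"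
  let ?f = "\<lambda>v. 1 / ?q v * (1 / ?q v)"
  have q: "?q v \<noteq> 0" if "0 \<le> v" "v \<le> 1" for v
  proof -
    have "Re (?q v) = v * Re a + (1 - v) * Re b" by simp
    also have "\<dots> > 0"
    proof (cases "v = 0")
      case False
      then have "0 < v * Re a" using that a by simp
      then show ?thesis using that b by (intro add_pos_nonneg) auto
    qed (use b in simp)
    finally show ?thesis by (metis less_irrefl zero_complex.sel(1))
  qed
  have b0: "b \<noteq> 0" and a0: "a \<noteq> 0" using a b by auto
  have [measurable]: "?f \<in> borel_measurable borel" by measurable
  have "(\<integral>v. ?f v \<partial>uniform_measure lborel {0<..<1}) = (\<integral>v. indicat_real {0<..<1} v *\<^sub>R ?f v \<partial>lborel)"
  proof -
    have "uniform_measure lborel {0<..<1::real} = density lborel (\<lambda>v. ennreal (indicat_real {0<..<1} v))"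
      by (simp add: uniform_measure_def divide_ennreal_def ennreal_indicator)
    then show ?thesis by (simp only:) (rule integral_density, auto)
  qed
  also have "\<dots> = (\<integral>v. indicat_real {0..1} v *\<^sub>R ?f v \<partial>lborel)"
    using AE_lborel_singleton[of "0::real"] AE_lborel_singleton[of "1::real"]
    by (intro integral_cong_AE) (auto elim!: eventually_elim2 simp: indicator_def)
  also have "\<dots> = complex_of_real 1 / (b * ?q 1) - complex_of_real 0 / (b * ?q 0)"
  proof (rule integral_FTC_Icc)
    fix v :: real assume v: "0 \<le> v" "v \<le> 1"
    let ?Q = "\<lambda>w. w * a + (1 - w) * b"
    have "((\<lambda>w. w / (b * ?Q w)) has_field_derivative ?f v) (at (complex_of_real v))"
    proof -
      have d: "((\<lambda>w. w / (b * ?Q w)) has_field_derivative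
          (1 * (b * ?Q v) - v * (b * (a - b))) / ((b * ?Q v) * (b * ?Q v))) (at (complex_of_real v))"
      proof (rule DERIV_divide[OF DERIV_ident DERIV_cmult])
        show "(?Q has_field_derivative a - b) (at (complex_of_real v))"
          by (auto intro!: derivative_eq_intros)
        show "b * ?Q (complex_of_real v) \<noteq> 0" using q[OF v] b0 by simp
      qed
      have "1 * (b * ?Q v) - v * (b * (a - b)) = b * b" by (simp add: algebra_simps)
      moreover have "b * b / ((b * k) * (b * k)) = 1 / k * (1 / k)" if "k \<noteq> 0" for k
        using b0 that by simp
      note this[OF q[OF v]]
      moreover have "?Q (complex_of_real v) = ?q v" by simp
      ultimately show ?thesis using d by (simp only:)
    qed
    from has_vector_derivative_real_field[OF this]
    show "((\<lambda>v. complex_of_real v / (b * ?q v)) has_vector_derivative ?f v) (at v within {0..1})"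
      by (simp only: of_real_diff of_real_1)
  next
    show "continuous_on {0..1} ?f"
      using q by (intro continuous_intros) auto
  qed simp
  also have "\<dots> = 1 / a * (1 / b)" using a0 b0 by simp
  finally show ?thesis .
qed

context stick_breaking
begin

lemma real_distribution_base: "real_distribution \<alpha>"
  by standard simp

lemma real_distribution_mean_law:
  assumes "integrable \<alpha> (\<lambda>x. ln (1 + \<bar>x\<bar>))"
  shows "real_distribution (mean_law \<alpha>)"
  using prob_space_mean_law[OF assms] by (simp add: real_distribution_def real_distribution_axioms_def mean_law_def)

text \<open>The derivative is minus the expectation of \<open>1 / (z - \<i> M)\<^sup>2\<close>. Substitute \<open>M = V X + (1 - V) M'\<close> and
integrate over \<open>V\<close> first: \<open>integral_segment_resolvent\<close> separates \<open>X\<close> from \<open>M'\<close>, and independence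
factorizes the expectation.\<close>

lemma stieltjes_mean_law_derivative:
  assumes int: "integrable \<alpha> (\<lambda>x. ln (1 + \<bar>x\<bar>))" and z: "Re z > 0"
  shows "(stieltjes (mean_law \<alpha>) has_field_derivative - (stieltjes \<alpha> z * stieltjes (mean_law \<alpha>) z)) (at z)"
proof -
  define N where "N = mean_law \<alpha>"
  interpret A: real_distribution \<alpha> by (rule real_distribution_base)
  interpret N: real_distribution N unfolding N_def by (rule real_distribution_mean_law[OF int])
  let ?U = "uniform_measure lborel {0<..<1::real}"
  interpret U: prob_space ?U by (rule prob_space_uniform)
  interpret AN: pair_prob_space \<alpha> N ..
  interpret UAN: pair_prob_space ?U "\<alpha> \<Otimes>\<^sub>M N" ..
  let ?r = "\<lambda>x. 1 / (z - \<i> * complex_of_real x)"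
  let ?h = "\<lambda>v p. ?r (v * fst p + (1 - v) * snd p) * ?r (v * fst p + (1 - v) * snd p)"
  have "(\<integral>y. ?r y * ?r y \<partial>N) = (\<integral>q. ?r ((\<lambda>(v, x, m). v * x + (1 - v) * m) q) * ?r ((\<lambda>(v, x, m). v * x + (1 - v) * m) q)
      \<partial>(?U \<Otimes>\<^sub>M (\<alpha> \<Otimes>\<^sub>M N)))"
    unfolding N_def by (subst mean_law_self_similar[OF int]) (rule integral_distr, auto simp: mean_law_def)
  also have "\<dots> = (\<integral>q. (case q of (v, p) \<Rightarrow> ?h v p) \<partial>(?U \<Otimes>\<^sub>M (\<alpha> \<Otimes>\<^sub>M N)))"
    by (simp only: split_beta' fst_conv snd_conv)
  also have "\<dots> = (\<integral>p. (\<integral>v. ?h v p \<partial>?U) \<partial>(\<alpha> \<Otimes>\<^sub>M N))"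
  proof (rule UAN.integral_snd[symmetric])
    show "integrable (?U \<Otimes>\<^sub>M (\<alpha> \<Otimes>\<^sub>M N)) (case_prod ?h)"
    proof (rule UAN.P.integrable_const_bound[where B = "1 / Re z * (1 / Re z)"])
      show "AE q in ?U \<Otimes>\<^sub>M (\<alpha> \<Otimes>\<^sub>M N). norm (case_prod ?h q) \<le> 1 / Re z * (1 / Re z)"
        unfolding split_beta' norm_mult using z by (intro AE_I2 mult_mono norm_resolvent) auto
    qed measurable
  qed
  also have "\<dots> = (\<integral>p. ?r (fst p) * ?r (snd p) \<partial>(\<alpha> \<Otimes>\<^sub>M N))"
  proof (rule Bochner_Integration.integral_cong[OF refl])
    fix p :: "real \<times> real"
    have "z - \<i> * complex_of_real (v * fst p + (1 - v) * snd p) =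
        complex_of_real v * (z - \<i> * complex_of_real (fst p)) + complex_of_real (1 - v) * (z - \<i> * complex_of_real (snd p))" for v
      by (simp add: algebra_simps)
    then show "(\<integral>v. ?h v p \<partial>?U) = ?r (fst p) * ?r (snd p)"
      using z by (simp only:) (rule integral_segment_resolvent, simp_all)
  qed
  also have "\<dots> = (\<integral>x. (\<integral>m. ?r x * ?r m \<partial>N) \<partial>\<alpha>)"
  proof -
    have "integrable (\<alpha> \<Otimes>\<^sub>M N) (\<lambda>p. ?r (fst p) * ?r (snd p))"
    proof (rule AN.P.integrable_const_bound[where B = "1 / Re z * (1 / Re z)"])
      show "AE p in \<alpha> \<Otimes>\<^sub>M N. norm (?r (fst p) * ?r (snd p)) \<le> 1 / Re z * (1 / Re z)"
        unfolding norm_mult using z by (intro AE_I2 mult_mono norm_resolvent) auto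
    qed measurable
    from AN.integral_fst'[OF this] show ?thesis by (simp only: fst_conv snd_conv)
  qed
  also have "\<dots> = stieltjes \<alpha> z * stieltjes N z"
    unfolding stieltjes_def
    by (simp only: Bochner_Integration.integral_mult_right_zero Bochner_Integration.integral_mult_left_zero)
  finally show ?thesis
    using N.stieltjes_has_field_derivative[OF z] unfolding N_def by (simp only:)
qed

text \<open>With \<open>F\<^sub>\<alpha>(z) = 1 / (z + c)\<close>, the product \<open>F\<^sub>\<mu>(z) (z + c)\<close> has derivative zero, so it is constant. Its
value is found by letting \<open>z\<close> tend to infinity along the integers.\<close>

lemma mean_law_eq_self:
  assumes int: "integrable \<alpha> (\<lambda>x. ln (1 + \<bar>x\<bar>))"
    and c: "Re c \<ge> 0" "\<And>z. Re z > 0 \<Longrightarrow> stieltjes \<alpha> z = 1 / (z + c)"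
  shows "mean_law \<alpha> = \<alpha>"
proof (rule stieltjes_inj[OF real_distribution_mean_law[OF int] real_distribution_base])
  interpret N: real_distribution "mean_law \<alpha>" by (rule real_distribution_mean_law[OF int])
  let ?F = "stieltjes (mean_law \<alpha>)"
  have nz: "z + c \<noteq> 0" if "Re z > 0" for z
  proof -
    have "Re (z + c) > 0" using that c(1) by simp
    then show ?thesis by (metis less_irrefl zero_complex.sel(1))
  qed
  have "\<exists>K. \<forall>z\<in>{z. Re z > 0}. ?F z * (z + c) = K"
  proof (rule has_field_derivative_zero_constant)
    show "convex {z. Re z > 0}" by (rule convex_halfspace_Re_gt)
    fix z assume "z \<in> {z. Re z > 0}"
    then have z: "Re z > 0" by simp
    have "((\<lambda>w. w + c) has_field_derivative 1) (at z)" by (auto intro!: derivative_eq_intros)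
    from DERIV_mult[OF stieltjes_mean_law_derivative[OF int z] this]
    have "((\<lambda>z. ?F z * (z + c)) has_field_derivative 0) (at z)"
      using nz[OF z] by (simp add: c(2)[OF z])
    then show "((\<lambda>z. ?F z * (z + c)) has_field_derivative 0) (at z within {z. Re z > 0})"
      by (rule has_field_derivative_at_within)
  qed
  then obtain K where K: "?F z * (z + c) = K" if "Re z > 0" for z by blast
  have "(\<lambda>n. of_nat (Suc n) * ?F (of_nat (Suc n)) * (1 + c * inverse (of_nat (Suc n)))) \<longlonglongrightarrow> 1 * (1 + c * 0)"
    by (intro tendsto_intros N.stieltjes_asymptotic) (rule LIMSEQ_Suc[OF lim_inverse_n])
  moreover have "of_nat (Suc n) * ?F (of_nat (Suc n)) * (1 + c * inverse (of_nat (Suc n))) = K" for n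
  proof -
    have "(of_nat (Suc n) :: complex) \<noteq> 0" by (simp del: of_nat_Suc)
    then have "of_nat (Suc n) * ?F (of_nat (Suc n)) * (1 + c * inverse (of_nat (Suc n))) =
        ?F (of_nat (Suc n)) * (of_nat (Suc n) + c)" by (simp add: field_simps del: of_nat_Suc)
    also have "\<dots> = K" by (rule K) (simp del: of_nat_Suc)
    finally show ?thesis .
  qed
  ultimately have "K = 1" by (simp add: LIMSEQ_const_iff)
  then show "?F z = stieltjes \<alpha> z" if "Re z > 0" for z
    unfolding c(2)[OF that] using K[OF that] nz[OF that] by (simp add: eq_divide_eq)
qed

text \<open>At a fixed point the differential equation is \<open>F' = - F\<^sup>2\<close>, that is, \<open>(1 / F)' = 1\<close>.\<close>

lemma stieltjes_fixed_point:
  assumes int: "integrable \<alpha> (\<lambda>x. ln (1 + \<bar>x\<bar>))" and fixed: "mean_law \<alpha> = \<alpha>"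
  obtains c where "Re c \<ge> 0" "\<And>z. Re z > 0 \<Longrightarrow> stieltjes \<alpha> z = 1 / (z + c)"
proof -
  interpret A: real_distribution \<alpha> by (rule real_distribution_base)
  have nz: "stieltjes \<alpha> z \<noteq> 0" if "Re z > 0" for z
    using A.stieltjes_Re_pos[OF that] by (metis less_irrefl zero_complex.sel(1))
  have "\<exists>c. \<forall>z\<in>{z. Re z > 0}. inverse (stieltjes \<alpha> z) - z = c"
  proof (rule has_field_derivative_zero_constant)
    show "convex {z. Re z > 0}" by (rule convex_halfspace_Re_gt)
    fix z assume "z \<in> {z. Re z > 0}"
    then have z: "Re z > 0" by simp
    from DERIV_diff[OF DERIV_inverse'[OF stieltjes_mean_law_derivative[OF int z]] DERIV_ident]
    have "((\<lambda>z. inverse (stieltjes \<alpha> z) - z) has_field_derivative 0) (at z)"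
      using nz[OF z] by (simp add: fixed field_simps)
    then show "((\<lambda>z. inverse (stieltjes \<alpha> z) - z) has_field_derivative 0) (at z within {z. Re z > 0})"
      by (rule has_field_derivative_at_within)
  qed
  then obtain c where c: "inverse (stieltjes \<alpha> z) - z = c" if "Re z > 0" for z by blast
  have F: "stieltjes \<alpha> z = 1 / (z + c)" if "Re z > 0" for z
  proof -
    have "inverse (stieltjes \<alpha> z) = z + c" using c[OF that] by (simp add: algebra_simps)
    then show ?thesis by (metis inverse_eq_divide inverse_inverse_eq)
  qed
  \<comment> \<open>The real part of \<open>stieltjes \<alpha> l\<close> is positive for every \<open>l > 0\<close>, however small.\<close>
  have pos: "l + Re c > 0" if "l > 0" for l
  proof -
    have "Re (inverse (complex_of_real l + c)) > 0"
      using A.stieltjes_Re_pos[of "complex_of_real l"] F[of "complex_of_real l"] that by (simp add: inverse_eq_divide)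
    then show ?thesis
      by (simp add: zero_less_divide_iff) (smt (verit) sum_power2_ge_zero)
  qed
  have "Re c \<ge> 0"
  proof (rule ccontr)
    assume "\<not> Re c \<ge> 0"
    then show False using pos[of "- Re c"] by simp
  qed
  with F show ?thesis using that by blast
qed

end

section \<open>Fixed points\<close>

lemma integrable_one_plus_abs_powr: "integrable lborel (\<lambda>x::real. (1 + \<bar>x\<bar>) powr (- 3/2))"
proof -
  let ?f = "\<lambda>x::real. (1 + \<bar>x\<bar>) powr (- 3/2)"
  have half: "(\<integral>\<^sup>+x. ennreal (?f x) * indicator {0..} x \<partial>lborel) = ennreal 2"
  proof -
    have "(\<integral>\<^sup>+x. ennreal (?f x) * indicator {0..} x \<partial>lborel) = ennreal (0 - (- 2 * (1 + 0) powr (- 1/2)))"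
    proof (rule nn_integral_FTC_atLeast)
      fix x :: real assume x: "0 \<le> x"
      have "((\<lambda>x. - 2 * (1 + x) powr (- 1/2)) has_real_derivative - 2 * (- 1/2 * (1 + x) powr (- 1/2 - 1))) (at x)"
        using x by (auto intro!: derivative_eq_intros)
      then show "((\<lambda>x. - 2 * (1 + x) powr (- 1/2)) has_real_derivative ?f x) (at x)"
        using x by simp
    next
      have "((\<lambda>x::real. (1 + x) powr (- 1/2)) \<longlongrightarrow> 0) at_top"
        by (rule tendsto_neg_powr) (auto intro: filterlim_tendsto_add_at_top filterlim_ident)
      from tendsto_mult[OF tendsto_const[of "- 2"] this]
      show "((\<lambda>x::real. - 2 * (1 + x) powr (- 1/2)) \<longlongrightarrow> 0) at_top" by simp
    qed auto
    then show ?thesis by simp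
  qed
  have "(\<integral>\<^sup>+x. ennreal (?f x) \<partial>lborel) \<le>
      (\<integral>\<^sup>+x. ennreal (?f x) * indicator {0..} x + ennreal (?f (- x)) * indicator {0..} (- x) \<partial>lborel)"
    by (intro nn_integral_mono) (auto simp: indicator_def)
  also have "\<dots> = (\<integral>\<^sup>+x. ennreal (?f x) * indicator {0..} x \<partial>lborel) +
      (\<integral>\<^sup>+x. ennreal (?f (- x)) * indicator {0..} (- x) \<partial>lborel)"
    by (rule nn_integral_add) measurable
  also have "(\<integral>\<^sup>+x. ennreal (?f (- x)) * indicator {0..} (- x) \<partial>lborel) = (\<integral>\<^sup>+x. ennreal (?f x) * indicator {0..} x \<partial>lborel)"
    by (subst (2) nn_integral_real_affine[where c = "- 1" and t = 0]) simp_all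
  finally have "(\<integral>\<^sup>+x. ennreal (?f x) \<partial>lborel) \<le> ennreal 2 + ennreal 2" unfolding half .
  also have "\<dots> < \<infinity>" by simp
  finally show ?thesis by (intro integrableI_bounded) simp_all
qed

text \<open>The density decays like \<open>(1 + \<bar>x\<bar>) powr (-2)\<close>, and the logarithm costs at most half a power.\<close>

lemma integrable_log_poisson_density:
  assumes l: "l > 0"
  shows "integrable (density lborel (\<lambda>x. ennreal (poisson_kernel l (x - \<theta>)))) (\<lambda>x. ln (1 + \<bar>x\<bar>))"
proof -
  \<comment> \<open>Chosen so that \<open>(1 + \<bar>x\<bar>)\<^sup>2 \<le> A * (l\<^sup>2 + (x - \<theta>)\<^sup>2)\<close>.\<close>
  define A where "A = 2 * (1 + \<bar>\<theta>\<bar>)\<^sup>2 / l\<^sup>2 + 2"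
  have A: "A > 0" unfolding A_def by (intro add_nonneg_pos) auto
  have bound: "poisson_kernel l (x - \<theta>) * ln (1 + \<bar>x\<bar>) \<le> l / pi * A * 2 * (1 + \<bar>x\<bar>) powr (- 3/2)" for x
  proof -
    define u where "u = 1 + \<bar>x\<bar>"
    have u: "u \<ge> 1" by (simp add: u_def)
    have "u \<le> (1 + \<bar>\<theta>\<bar>) + \<bar>x - \<theta>\<bar>" by (simp add: u_def)
    then have "u\<^sup>2 \<le> ((1 + \<bar>\<theta>\<bar>) + \<bar>x - \<theta>\<bar>)\<^sup>2" using u by (intro power_mono) auto
    also have "\<dots> \<le> 2 * (1 + \<bar>\<theta>\<bar>)\<^sup>2 + 2 * \<bar>x - \<theta>\<bar>\<^sup>2"
    proof -
      have "(p + q)\<^sup>2 \<le> 2 * p\<^sup>2 + 2 * q\<^sup>2" for p q :: real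
        using zero_le_power2[of "p - q"] by (simp add: power2_eq_square algebra_simps)
      then show ?thesis .
    qed
    also have "\<dots> \<le> A * (l\<^sup>2 + (x - \<theta>)\<^sup>2)"
      using l by (simp add: A_def distrib_left distrib_right)
    finally have "1 / (l\<^sup>2 + (x - \<theta>)\<^sup>2) \<le> A / u\<^sup>2"
      using poisson_kernel_denominator_pos[OF l, of "x - \<theta>"] u by (simp add: field_simps)
    then have "l / pi * (1 / (l\<^sup>2 + (x - \<theta>)\<^sup>2)) \<le> l / pi * (A / u\<^sup>2)"
      using l by (intro mult_left_mono) auto
    then have P: "poisson_kernel l (x - \<theta>) \<le> l / pi * A * u powr (- 2)"
      using u by (simp add: poisson_kernel_def powr_minus divide_inverse mult_ac)
    have "ln u = 2 * ln (u powr (1/2))" using u by (simp add: ln_powr)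
    also have "\<dots> \<le> 2 * u powr (1/2)" using ln_le_minus_one[of "u powr (1/2)"] u by simp
    finally have "poisson_kernel l (x - \<theta>) * ln u \<le> (l / pi * A * u powr (- 2)) * (2 * u powr (1/2))"
      using P u l A by (intro mult_mono) auto
    also have "\<dots> = l / pi * A * 2 * (u powr (- 2) * u powr (1/2))" by simp
    also have "u powr (- 2) * u powr (1/2) = u powr (- 3/2)" by (simp flip: powr_add)
    finally show ?thesis by (simp add: u_def)
  qed
  have "integrable lborel (\<lambda>x. poisson_kernel l (x - \<theta>) *\<^sub>R ln (1 + \<bar>x\<bar>))"
  proof (rule Bochner_Integration.integrable_bound)
    show "integrable lborel (\<lambda>x::real. l / pi * A * 2 * (1 + \<bar>x\<bar>) powr (- 3/2))"
      using integrable_one_plus_abs_powr by (rule integrable_mult_right)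
    show "AE x in lborel. norm (poisson_kernel l (x - \<theta>) *\<^sub>R ln (1 + \<bar>x\<bar>)) \<le> norm (l / pi * A * 2 * (1 + \<bar>x\<bar>) powr (- 3/2))"
    proof (rule AE_I2)
      fix x
      have "norm (poisson_kernel l (x - \<theta>) *\<^sub>R ln (1 + \<bar>x\<bar>)) = poisson_kernel l (x - \<theta>) * ln (1 + \<bar>x\<bar>)"
        using poisson_kernel_nonneg[OF l, of "x - \<theta>"] by (simp add: abs_mult)
      also have "\<dots> \<le> norm (l / pi * A * 2 * (1 + \<bar>x\<bar>) powr (- 3/2))"
        by (rule order_trans[OF bound]) (simp only: real_norm_def abs_ge_self)
      finally show "norm (poisson_kernel l (x - \<theta>) *\<^sub>R ln (1 + \<bar>x\<bar>)) \<le> norm (l / pi * A * 2 * (1 + \<bar>x\<bar>) powr (- 3/2))" .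
    qed
  qed measurable
  then show ?thesis
    using poisson_kernel_nonneg[OF l] by (subst integrable_density) auto
qed

lemma cauchy_law_in_F1_fixed:
  assumes "0 < s"
  shows "cauchy_law \<theta> s \<in> F1 \<and> mean_law (cauchy_law \<theta> s) = cauchy_law \<theta> s"
proof (cases "s = \<infinity>")
  case True
  then have law: "cauchy_law \<theta> s = return borel \<theta>" by (simp add: cauchy_law_def)
  interpret P: prob_space "return borel \<theta>" by (rule prob_space_return) simp
  interpret stick_breaking "return borel \<theta>" by standard simp
  have int: "integrable (return borel \<theta>) (\<lambda>x. ln (1 + \<bar>x\<bar>))"
    by (subst integrable_cong_AE[where g = "\<lambda>_. ln (1 + \<bar>\<theta>\<bar>)"]) (auto simp: AE_return)
  moreover have "mean_law (return borel \<theta>) = return borel \<theta>"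
    by (rule mean_law_eq_self[OF int, where c = "Complex 0 (- \<theta>)"]) (simp_all add: stieltjes_return)
  ultimately show ?thesis unfolding law F1_def using P.prob_space_axioms by simp
next
  case False
  then obtain l where l: "l > 0" and law: "cauchy_law \<theta> s = density lborel (\<lambda>x. ennreal (poisson_kernel l (x - \<theta>)))"
    using cauchy_law_finite[OF assms] by metis
  interpret C: real_distribution "cauchy_law \<theta> s"
    unfolding law by (rule real_distribution_poisson_density[OF l])
  interpret stick_breaking "cauchy_law \<theta> s" by standard simp
  have int: "integrable (cauchy_law \<theta> s) (\<lambda>x. ln (1 + \<bar>x\<bar>))"
    unfolding law by (rule integrable_log_poisson_density[OF l])
  moreover have "mean_law (cauchy_law \<theta> s) = cauchy_law \<theta> s"
  proof (rule mean_law_eq_self[OF int, where c = "Complex l (- \<theta>)"])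
    show "stieltjes (cauchy_law \<theta> s) z = 1 / (z + Complex l (- \<theta>))" if "Re z > 0" for z
      unfolding law by (rule stieltjes_poisson_kernel[OF l that])
  qed (use l in simp)
  ultimately show ?thesis unfolding F1_def using C.prob_space_axioms by simp
qed

lemma fixed_point_is_cauchy_law:
  assumes "\<alpha> \<in> F1" and fixed: "mean_law \<alpha> = \<alpha>"
  shows "\<exists>\<theta> s. 0 < s \<and> \<alpha> = cauchy_law \<theta> s"
proof -
  interpret P: prob_space \<alpha> using assms by (simp add: F1_def)
  interpret stick_breaking \<alpha> using assms by unfold_locales (simp add: F1_def)
  have int: "integrable \<alpha> (\<lambda>x. ln (1 + \<bar>x\<bar>))" using assms by (simp add: F1_def)
  obtain c where c: "Re c \<ge> 0" "\<And>z. Re z > 0 \<Longrightarrow> stieltjes \<alpha> z = 1 / (z + c)"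
    by (rule stieltjes_fixed_point[OF int fixed]) blast
  define \<theta> where "\<theta> = - Im c"
  show ?thesis
  proof (cases "Re c = 0")
    case True
    have "real_distribution (return borel \<theta>)"
      by (simp add: real_distribution_def real_distribution_axioms_def prob_space_return)
    moreover have "Complex 0 (- \<theta>) = c" using True by (simp add: \<theta>_def complex_eq_iff)
    ultimately have "\<alpha> = return borel \<theta>"
      by (intro stieltjes_inj[OF real_distribution_base]) (simp_all only: stieltjes_return c(2))
    then have "\<alpha> = cauchy_law \<theta> \<infinity>" by (simp add: cauchy_law_def)
    then show ?thesis by (intro exI[of _ \<theta>] exI[of _ \<infinity>]) simp
  next
    case False
    with c have l: "Re c > 0" by simp
    define s where "s = ennreal (1 / (Re c)\<^sup>2)"
    have s: "0 < s" "s \<noteq> \<infinity>" using l by (simp_all add: s_def)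
    obtain l' where l': "l' > 0" "s = ennreal (1 / l'\<^sup>2)"
      and law: "\<And>\<theta>. cauchy_law \<theta> s = density lborel (\<lambda>x. ennreal (poisson_kernel l' (x - \<theta>)))"
      using cauchy_law_finite[OF s] by blast
    have "1 / (Re c)\<^sup>2 = 1 / l'\<^sup>2" using l'(2) by (simp add: s_def)
    then have "(Re c)\<^sup>2 = l'\<^sup>2" by simp
    then have eq: "l' = Re c" using l l'(1) by (simp add: power2_eq_iff_nonneg)
    then have c': "Complex l' (- \<theta>) = c" by (simp add: \<theta>_def complex_eq_iff)
    have "\<alpha> = cauchy_law \<theta> s"
      unfolding law
    proof (rule stieltjes_inj[OF real_distribution_base real_distribution_poisson_density[OF l'(1)]])
      fix z :: complex assume z: "Re z > 0"
      show "stieltjes \<alpha> z = stieltjes (density lborel (\<lambda>x. ennreal (poisson_kernel l' (x - \<theta>)))) z"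
        using stieltjes_poisson_kernel[OF l'(1) z, of \<theta>] c(2)[OF z] by (simp only: c')
    qed
    then show ?thesis using s(1) by blast
  qed
qed

theorem theorem5:
  shows "{\<alpha> \<in> F1. beta1 \<alpha> = \<alpha>} = {cauchy_law \<theta> s | \<theta> s. 0 < s} \<and>
    (\<forall>\<alpha>\<in>F1. mean_law \<alpha> = \<alpha> \<longleftrightarrow> (\<exists>\<theta> s. 0 < s \<and> \<alpha> = cauchy_law \<theta> s))"
proof -
  have iff: "mean_law \<alpha> = \<alpha> \<longleftrightarrow> (\<exists>\<theta> s. 0 < s \<and> \<alpha> = cauchy_law \<theta> s)" if "\<alpha> \<in> F1" for \<alpha>
    using fixed_point_is_cauchy_law[OF that] cauchy_law_in_F1_fixed by metis
  have "{\<alpha> \<in> F1. beta1 \<alpha> = \<alpha>} = {\<alpha> \<in> F1. mean_law \<alpha> = \<alpha>}"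
    by (auto simp: beta1_def)
  also have "\<dots> = {cauchy_law \<theta> s | \<theta> s. 0 < s}"
    using iff cauchy_law_in_F1_fixed by blast
  finally show ?thesis using iff by blast
qed

end
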